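(* Let $B$ be a set, $Q_B$ the free abelian group with $\mathbb{Z}$-basis $B$, $\mathcal{N}:B\times B\to\mathbb{C}$ a symmetric function (extended biadditively to $Q_B$), $\Delta(\alpha,\beta)=\mathcal{N}(\alpha,\beta)+\mathbb{Z}$, and $\eta:Q_B\times Q_B\to\mathbb{C}^\times$ a bimultiplicative function with $\eta(\alpha,\alpha)=e^{-\pi i\mathcal{N}(\alpha,\alpha)}$ for all $\alpha\in Q_B$. Let $F=F(B,\mathcal{N},\eta)$ be the free generalized vertex algebra. Let $V'$ be a generalized vertex algebra (GVA) with a charge factor $(Q',\Delta',\eta')$. Suppose that there exists a group homomorphism $\rho:Q_B\to Q'$ such that $\Delta(\alpha,\beta)=\Delta'(\rho(\alpha),\rho(\beta))$ and $\eta(\alpha,\beta)=\eta'(\rho(\alpha),\rho(\beta))$ for all $\alpha,\beta\in Q_B$. Suppose also that there exists a map $i:B\to V'$ such that each vector $i(b)$ ($b\in B$) is zero or a homogeneous vector of charge $\rho(b)$, that $i(B)$ generates the GVA $V'$, and that the map $\mathcal{N}':i(B)\times i(B)\to\mathbb{C}$, $\mathcal{N}'(i(b),i(c))=\mathcal{N}(b,c)$, is well defined and is a locality bound on $i(B)$ (that is, for all $b,c\in B$ the number $\mathcal{N}(b,c)$ is a locality bound of $Y(i(b),z)$ and $Y(i(c),z)$). Then there is a unique surjective GVA-homomorphism $\pi:F\to V'$ such that $\pi|_B=i$.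
   Context: All vector spaces are over a field $\mathbf{k}\supseteq\mathbb{C}$; $\mathbb{Z}_+$ is the set of non-negative integers. GVAs. $U[[z,z^{\mathbb{C}}]]$ is the space of formal series $\sum_{n\in\mathbb{C}}f(n)z^n$ with $f(n)\in U$; for a coset $\Gamma\in\mathbb{C}/\mathbb{Z}$, $U[[z]]z^\Gamma$ is the space of finite sums of $\psi(z)z^d$ with $d\in\Gamma$, $\psi\in U[[z]]$. Put $\iota_{z,w}(z-w)^N=\sum_{j\ge0}\binom Nj z^{N-j}(-w)^j$ and $\iota_{w,z}(z-w)^N=e^{\pi iN}\sum_{j\ge0}\binom Nj w^{N-j}(-z)^j$. A weak GVA $(V,Y,|0\rangle,T)$ is a vector space $V$ with a non-zero vector $|0\rangle$, $T\in\mathrm{End}(V)$ and a linear map $Y:V\to\mathrm{End}(V)[[z,z^{\mathbb{C}}]]$, $Y(a,z)=\sum_{n\in\mathbb{C}}a(n)z^{-n-1}$, such that $T|0\rangle=0$, $Y(a,z)|0\rangle|_{z=0}=a$ (in particular $Y(a,z)|0\rangle\in V[[z]]$) and $[T,Y(a,z)]=\partial_zY(a,z)$. Given an abelian group $Q$, a symmetric biadditive $\Delta:Q\times Q\to\mathbb{C}/\mathbb{Z}$ and a grading $V=\bigoplus_{\alpha\in Q}V^\alpha$, a field of charge $\alpha$ is a series $a(z)\in\mathrm{End}(V)[[z,z^{\mathbb{C}}]]$ with $a(z)b\in V^{\alpha+\beta}[[z]]z^{-\Delta(\alpha,\beta)}$ for $b\in V^\beta$. Fields $a(z),b(z)$ of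 charges $\alpha,\beta$ are mutually $p$-local ($p\in\mathbb{C}^\times$) if there is $N\in\Delta(\alpha,\beta)$, called a locality bound, with $\iota_{z,w}(z-w)^Na(z)b(w)=p\,\iota_{w,z}(z-w)^Nb(w)a(z)$. A GVA is a weak GVA admitting a charge factor $(Q,\Delta,\eta)$: an abelian group $Q$, a symmetric biadditive $\Delta$, a grading $V=\bigoplus_{\alpha\in Q}V^\alpha$ and a bimultiplicative $\eta:Q\times Q\to\mathbb{C}^\times$ with $\eta(\alpha,\beta)\eta(\beta,\alpha)=e^{-2\pi i\Delta(\alpha,\beta)}$, such that $|0\rangle\in V^0$, $T$ preserves the grading, $Y(a,z)$ is a field of charge $\alpha$ for $a\in V^\alpha$, and $Y(a,z),Y(b,z)$ are mutually $\eta(\alpha,\beta)$-local for $a\in V^\alpha,b\in V^\beta$. A subset generates $V$ if the smallest $T$-invariant subspace containing it and $|0\rangle$ and closed under all products $u(n)v$ ($n\in\mathbb{C}$) is $V$. A GVA-homomorphism $f:V_1\to V_2$ is a linear map with $f(Y_1(a,z)b)=Y_2(f(a),z)f(b)$, $f(|0\rangle_1)=|0\rangle_2$, $fT_1=T_2f$, for which there exist charge factors $(Q_i,\Delta_i,\eta_i)$ on $V_i$ and a group homomorphism $\phi:Q_1\to Q_2$ with $f(V_1^\alpha)\subset V_2^{\phi(\alpha)}$, $\Delta_2(\phi(\alpha),\phi(\beta))=\Delta_1(\alpha,\beta)$, $\eta_2(\phi(\alpha),\phi(\beta))=\eta_1(\alpha,\beta)$. The free GVA $F(B,\mathcal{N},\eta)$.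 Let $A$ be the free associative unital $\mathbf{k}$-algebra on the symbols $a(n)$ ($a\in B$, $n\in\mathbb{C}$), with unit denoted $|0\rangle$. It is graded by $Q_B\times\mathbb{C}$, $A=\bigoplus A(\alpha,d)$, with $a_1(n_1)\cdots a_m(n_m)$ of degree $(a_1+\cdots+a_m,\ \sum_i(-n_i-1))$. Let $T$ be the derivation of $A$ with $T(a(n))=-n\,a(n-1)$. Put $\mathrm{F}_pA=\bigoplus_{\alpha\in Q_B,\ \mathrm{Re}(d)\le p}A(\alpha,d)$ ($p\in\mathbb{Z}$), $\mathrm{I}_n(A(\alpha,d))=A(\alpha,d)\cap(A\cdot\mathrm{F}_{-n-1}A)$ ($n\in\mathbb{Z}_+$), $\hat A(\alpha,d)=\varprojlim_nA(\alpha,d)/\mathrm{I}_n(A(\alpha,d))$ and $\hat A=\bigoplus_{\alpha,d}\hat A(\alpha,d)$; the product and $T$ extend continuously to $\hat A$. For $a,b\in B$, $s,t\in\mathbb{C}$ and $N=\mathcal{N}(a,b)$ let $l(a,b,s,t)=\sum_{j\ge0}(-1)^j\binom Nj\bigl(a(s+N-j)b(t+j)-\eta(a,b)e^{\pi iN}b(t+N-j)a(s+j)\bigr)\in\hat A$. Let $I$ be the two-sided ideal of $\hat A$ generated by all $l(a,b,s,t)$, and $J$ the left ideal of $\hat A$ generated by all $a(n)$ with $a\in B$, $n\in\mathbb{C}\setminus\mathbb{Z}_{<0}$, and all $a_1(n_1)\cdots a_m(n_m)$ with $m\ge2$, $a_i\in B$, $n_i\in\mathbb{C}$, $n_1\notin\mathcal{N}(a_1,\sum_{i=2}^ma_i)+\mathbb{Z}$.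 Let $\hat I,\hat J$ be their componentwise closures (the sum over $(\alpha,d)$ of the closures of the homogeneous components in $\hat A(\alpha,d)$), and $F=\hat A/(\hat I+\hat J)$, with the induced grading $F=\bigoplus F(\alpha,d)$, left $A$-action and operator $T$. The set $B$ is embedded in $F$ via $a\mapsto$ class of $a(-1)$. The series $a(z)=\sum_{n\in\mathbb{C}}a(n)z^{-n-1}$ ($a\in B$) of operators on $F$ are translation covariant, mutually local fields generating $F$ from $|0\rangle$, and $F$ carries the unique GVA structure with $Y(a,z)=a(z)$ for $a\in B$, vacuum $|0\rangle$, translation operator $T$ and charge factor $(Q_B,\Delta,\eta)$ (grading $F(\alpha)=\bigoplus_dF(\alpha,d)$). *)

theory Defs
  imports
    "HOL-Algebra.Module"
    "HOL-Algebra.Free_Abelian_Groups"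
    "HOL-Algebra.Algebraic_Closure_Type"
    "HOL-Library.Function_Algebras"
    "HOL-Library.Set_Algebras"
    "HOL-Library.FuncSet"
    Complex_Main
begin

text \<open>
  The base field is an arbitrary type \<open>'k :: field\<close> together with a ring homomorphism
  \<open>emb\<close> from the complex numbers to it (necessarily injective). Vector spaces are modules
  of HOL-Algebra over \<open>ring_of_type_algebra :: 'k ring\<close>; only the fields \<open>carrier\<close>, \<open>zero\<close>,
  \<open>add\<close> and \<open>smult\<close> of the module record matter.
\<close>

definition complex_subfield :: "(complex \<Rightarrow> 'k::field) \<Rightarrow> bool" where
  "complex_subfield emb \<longleftrightarrow>
     emb \<in> ring_hom (ring_of_type_algebra :: complex ring) (ring_of_type_algebra :: 'k ring)"

definition linear_map ::
  "('k::field, 'v, 'm) module_scheme \<Rightarrow> ('k, 'w, 'n) module_scheme \<Rightarrow> ('v \<Rightarrow> 'w) \<Rightarrow> bool" where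
  "linear_map V W f \<longleftrightarrow> f \<in> carrier V \<rightarrow> carrier W \<and>
     (\<forall>x\<in>carrier V. \<forall>y\<in>carrier V. f (x \<oplus>\<^bsub>V\<^esub> y) = f x \<oplus>\<^bsub>W\<^esub> f y) \<and>
     (\<forall>c. \<forall>x\<in>carrier V. f (c \<odot>\<^bsub>V\<^esub> x) = c \<odot>\<^bsub>W\<^esub> f x)"


section \<open>Generalized vertex algebras\<close>

text \<open>
  A series \<open>a(z) = \<Sum>\<^sub>n a(n) z^(-n-1)\<close> with coefficients in \<open>End(V)\<close> is given by its modes
  \<open>a :: complex \<Rightarrow> 'v \<Rightarrow> 'v\<close>; in particular \<open>modes V u n v\<close> is the product \<open>u(n)v\<close>.
\<close>

record ('k, 'v) gva = "('k, 'v) module" +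
  vacuum :: 'v
  translation :: "'v \<Rightarrow> 'v"
  modes :: "'v \<Rightarrow> complex \<Rightarrow> 'v \<Rightarrow> 'v"

text \<open>
  Taking coefficients at \<open>z^(-n-1)\<close>: the condition on \<open>Y(a,z)|0>\<close> says that \<open>a(n)|0>\<close> is \<open>a\<close> for
  \<open>n = -1\<close> and vanishes unless \<open>-n-1\<close> is a non-negative integer, and \<open>[T,Y(a,z)] = \<partial>\<^sub>z Y(a,z)\<close> says
  \<open>[T,a(n)] = -n a(n-1)\<close>.
\<close>

definition weak_gva :: "(complex \<Rightarrow> 'k::field) \<Rightarrow> ('k, 'v) gva \<Rightarrow> bool" where
  "weak_gva emb V \<longleftrightarrow>
     Module.module (ring_of_type_algebra :: 'k ring) V \<and>
     vacuum V \<in> carrier V \<and> vacuum V \<noteq> \<zero>\<^bsub>V\<^esub> \<and>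
     linear_map V V (translation V) \<and>
     (\<forall>a\<in>carrier V. \<forall>n. linear_map V V (modes V a n)) \<and>
     (\<forall>n. \<forall>b\<in>carrier V. linear_map V V (\<lambda>a. modes V a n b)) \<and>
     translation V (vacuum V) = \<zero>\<^bsub>V\<^esub> \<and>
     (\<forall>a\<in>carrier V. modes V a (-1) (vacuum V) = a \<and>
        (\<forall>n. (\<nexists>k::nat. - n - 1 = of_nat k) \<longrightarrow> modes V a n (vacuum V) = \<zero>\<^bsub>V\<^esub>)) \<and>
     (\<forall>a\<in>carrier V. \<forall>b\<in>carrier V. \<forall>n.
        translation V (modes V a n b) \<ominus>\<^bsub>V\<^esub> modes V a n (translation V b)
          = emb (- n) \<odot>\<^bsub>V\<^esub> modes V a (n - 1) b)"

text \<open>\<open>\<complex>/\<int>\<close>, as the set of cosets \<open>c +o \<int>\<close>; the sum of two cosets is their elementwise sum.\<close>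

definition complex_mod_int :: "complex set set" where
  "complex_mod_int = range (\<lambda>c. c +o \<int>)"

definition symmetric_biadditive ::
  "('q, 'm) monoid_scheme \<Rightarrow> ('q \<Rightarrow> 'q \<Rightarrow> complex set) \<Rightarrow> bool" where
  "symmetric_biadditive Q \<Delta> \<longleftrightarrow>
     (\<forall>\<alpha>\<in>carrier Q. \<forall>\<beta>\<in>carrier Q. \<Delta> \<alpha> \<beta> \<in> complex_mod_int \<and> \<Delta> \<alpha> \<beta> = \<Delta> \<beta> \<alpha>) \<and>
     (\<forall>\<alpha>\<in>carrier Q. \<forall>\<beta>\<in>carrier Q. \<forall>\<gamma>\<in>carrier Q. \<Delta> (\<alpha> \<otimes>\<^bsub>Q\<^esub> \<beta>) \<gamma> = \<Delta> \<alpha> \<gamma> + \<Delta> \<beta> \<gamma>)"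

definition bimultiplicative ::
  "('q, 'm) monoid_scheme \<Rightarrow> ('q \<Rightarrow> 'q \<Rightarrow> complex) \<Rightarrow> bool" where
  "bimultiplicative Q \<eta> \<longleftrightarrow>
     (\<forall>\<alpha>\<in>carrier Q. \<forall>\<beta>\<in>carrier Q. \<eta> \<alpha> \<beta> \<noteq> 0) \<and>
     (\<forall>\<alpha>\<in>carrier Q. \<forall>\<beta>\<in>carrier Q. \<forall>\<gamma>\<in>carrier Q.
        \<eta> (\<alpha> \<otimes>\<^bsub>Q\<^esub> \<beta>) \<gamma> = \<eta> \<alpha> \<gamma> * \<eta> \<beta> \<gamma> \<and> \<eta> \<gamma> (\<alpha> \<otimes>\<^bsub>Q\<^esub> \<beta>) = \<eta> \<gamma> \<alpha> * \<eta> \<gamma> \<beta>)"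

definition is_grading ::
  "('k::field, 'v, 'm) module_scheme \<Rightarrow> ('q, 'n) monoid_scheme \<Rightarrow> ('q \<Rightarrow> 'v set) \<Rightarrow> bool" where
  "is_grading V Q G \<longleftrightarrow>
     (\<forall>\<alpha>\<in>carrier Q. submodule (G \<alpha>) (ring_of_type_algebra :: 'k ring) V) \<and>
     (\<forall>v\<in>carrier V. \<exists>!x. x \<in> (\<Pi>\<^sub>E \<alpha>\<in>carrier Q. G \<alpha>) \<and>
        finite {\<alpha>\<in>carrier Q. x \<alpha> \<noteq> \<zero>\<^bsub>V\<^esub>} \<and>
        v = (\<Oplus>\<^bsub>V\<^esub>\<alpha>\<in>{\<alpha>\<in>carrier Q. x \<alpha> \<noteq> \<zero>\<^bsub>V\<^esub>}. x \<alpha>))"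

text \<open>
  \<open>U[[z]]z\<^sup>\<Gamma>\<close> inside \<open>V[[z,z\<^sup>\<complex>]]\<close>, for a coset \<open>\<Gamma>\<close>; \<open>f e\<close> is the coefficient at \<open>z^e\<close>. A series
  is a finite sum of terms \<open>\<psi>(z)z^d\<close> with \<open>d \<in> \<Gamma>\<close> iff its support lies in the union of finitely
  many sets \<open>d + \<nat>\<close> with \<open>d \<in> \<Gamma>\<close>.
\<close>

definition series_space ::
  "('k, 'v, 'm) module_scheme \<Rightarrow> 'v set \<Rightarrow> complex set \<Rightarrow> (complex \<Rightarrow> 'v) set" where
  "series_space V U \<Gamma> =
     {f. (\<forall>e. f e \<in> U) \<and>
         (\<exists>D. finite D \<and> D \<subseteq> \<Gamma> \<and> (\<forall>e. f e \<noteq> \<zero>\<^bsub>V\<^esub> \<longrightarrow> (\<exists>d\<in>D. \<exists>k::nat. e = d + of_nat k)))}"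

definition field_of_charge ::
  "('k::field, 'v, 'm) module_scheme \<Rightarrow> ('q, 'n) monoid_scheme \<Rightarrow> ('q \<Rightarrow> 'q \<Rightarrow> complex set) \<Rightarrow>
   ('q \<Rightarrow> 'v set) \<Rightarrow> 'q \<Rightarrow> (complex \<Rightarrow> 'v \<Rightarrow> 'v) \<Rightarrow> bool" where
  "field_of_charge V Q \<Delta> G \<alpha> a \<longleftrightarrow>
     (\<forall>n. linear_map V V (a n)) \<and>
     (\<forall>\<beta>\<in>carrier Q. \<forall>b\<in>G \<beta>.
        (\<lambda>e. a (- e - 1) b) \<in> series_space V (G (\<alpha> \<otimes>\<^bsub>Q\<^esub> \<beta>)) (uminus ` \<Delta> \<alpha> \<beta>))"

definition support_sum :: "('k, 'v, 'm) module_scheme \<Rightarrow> (nat \<Rightarrow> 'v) \<Rightarrow> 'v" where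
  "support_sum V f = (\<Oplus>\<^bsub>V\<^esub>j\<in>{j. f j \<noteq> \<zero>\<^bsub>V\<^esub>}. f j)"

text \<open>
  \<open>locality_bound V emb \<Gamma> p N a b\<close>: \<open>N\<close> lies in the coset \<open>\<Gamma>\<close> (which is \<open>\<Delta>(\<alpha>,\<beta>)\<close> when \<open>a(z)\<close>,
  \<open>b(z)\<close> have charges \<open>\<alpha>\<close>, \<open>\<beta>\<close>) and
  \<open>\<iota>\<^bsub>z,w\<^esub>(z-w)^N a(z)b(w) = p \<iota>\<^bsub>w,z\<^esub>(z-w)^N b(w)a(z)\<close>. The equation below is the coefficient of
  \<open>z^(-s-1) w^(-t-1)\<close> of the latter applied to \<open>c\<close>. If \<open>a(z)\<close> and \<open>b(z)\<close> are fields, only finitely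
  many summands are non-zero.
\<close>

definition locality_bound ::
  "(complex \<Rightarrow> 'k::field) \<Rightarrow> ('k, 'v, 'm) module_scheme \<Rightarrow> complex set \<Rightarrow> complex \<Rightarrow> complex \<Rightarrow>
   (complex \<Rightarrow> 'v \<Rightarrow> 'v) \<Rightarrow> (complex \<Rightarrow> 'v \<Rightarrow> 'v) \<Rightarrow> bool" where
  "locality_bound emb V \<Gamma> p N a b \<longleftrightarrow> N \<in> \<Gamma> \<and>
     (\<forall>c\<in>carrier V. \<forall>s t.
        support_sum V (\<lambda>j. emb ((-1) ^ j * (N gchoose j)) \<odot>\<^bsub>V\<^esub> a (s + N - of_nat j) (b (t + of_nat j) c))
        = emb (p * exp (of_real pi * \<i> * N)) \<odot>\<^bsub>V\<^esub>
          support_sum V (\<lambda>j. emb ((-1) ^ j * (N gchoose j)) \<odot>\<^bsub>V\<^esub> b (t + N - of_nat j) (a (s + of_nat j) c)))"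

definition mutually_local ::
  "(complex \<Rightarrow> 'k::field) \<Rightarrow> ('k, 'v, 'm) module_scheme \<Rightarrow> complex set \<Rightarrow> complex \<Rightarrow>
   (complex \<Rightarrow> 'v \<Rightarrow> 'v) \<Rightarrow> (complex \<Rightarrow> 'v \<Rightarrow> 'v) \<Rightarrow> bool" where
  "mutually_local emb V \<Gamma> p a b \<longleftrightarrow> (\<exists>N. locality_bound emb V \<Gamma> p N a b)"

text \<open>The grading \<open>G\<close> is part of the data of a charge factor \<open>(Q,\<Delta>,\<eta>)\<close>.\<close>

definition charge_factor ::
  "(complex \<Rightarrow> 'k::field) \<Rightarrow> ('k, 'v) gva \<Rightarrow> 'q monoid \<Rightarrow> ('q \<Rightarrow> 'q \<Rightarrow> complex set) \<Rightarrow>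
   ('q \<Rightarrow> 'q \<Rightarrow> complex) \<Rightarrow> ('q \<Rightarrow> 'v set) \<Rightarrow> bool" where
  "charge_factor emb V Q \<Delta> \<eta> G \<longleftrightarrow>
     comm_group Q \<and> symmetric_biadditive Q \<Delta> \<and> is_grading V Q G \<and> bimultiplicative Q \<eta> \<and>
     (\<forall>\<alpha>\<in>carrier Q. \<forall>\<beta>\<in>carrier Q. \<forall>d\<in>\<Delta> \<alpha> \<beta>.
        \<eta> \<alpha> \<beta> * \<eta> \<beta> \<alpha> = exp (- 2 * of_real pi * \<i> * d)) \<and>
     vacuum V \<in> G \<one>\<^bsub>Q\<^esub> \<and>
     (\<forall>\<alpha>\<in>carrier Q. translation V ` G \<alpha> \<subseteq> G \<alpha>) \<and>
     (\<forall>\<alpha>\<in>carrier Q. \<forall>a\<in>G \<alpha>. field_of_charge V Q \<Delta> G \<alpha> (modes V a)) \<and>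
     (\<forall>\<alpha>\<in>carrier Q. \<forall>\<beta>\<in>carrier Q. \<forall>a\<in>G \<alpha>. \<forall>b\<in>G \<beta>.
        mutually_local emb V (\<Delta> \<alpha> \<beta>) (\<eta> \<alpha> \<beta>) (modes V a) (modes V b))"

definition gva_with_charge_factor ::
  "(complex \<Rightarrow> 'k::field) \<Rightarrow> ('k, 'v) gva \<Rightarrow> 'q monoid \<Rightarrow> ('q \<Rightarrow> 'q \<Rightarrow> complex set) \<Rightarrow>
   ('q \<Rightarrow> 'q \<Rightarrow> complex) \<Rightarrow> ('q \<Rightarrow> 'v set) \<Rightarrow> bool" where
  "gva_with_charge_factor emb V Q \<Delta> \<eta> G \<longleftrightarrow> weak_gva emb V \<and> charge_factor emb V Q \<Delta> \<eta> G"

definition gva_subspace :: "('k::field, 'v) gva \<Rightarrow> 'v set \<Rightarrow> bool" where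
  "gva_subspace V U \<longleftrightarrow> submodule U (ring_of_type_algebra :: 'k ring) V \<and>
     translation V ` U \<subseteq> U \<and> vacuum V \<in> U \<and> (\<forall>u\<in>U. \<forall>v\<in>U. \<forall>n. modes V u n v \<in> U)"

definition generates_gva :: "('k::field, 'v) gva \<Rightarrow> 'v set \<Rightarrow> bool" where
  "generates_gva V S \<longleftrightarrow> S \<subseteq> carrier V \<and> gva_subspace V hull S = carrier V"

text \<open>
  HOL cannot quantify over types, so the types \<open>'p\<close>, \<open>'q\<close> in which the charge groups of the two
  sides live are parameters of the notion of homomorphism.
\<close>

definition gva_hom ::
  "'p itself \<Rightarrow> 'q itself \<Rightarrow> (complex \<Rightarrow> 'k::field) \<Rightarrow> ('k, 'v) gva \<Rightarrow> ('k, 'w) gva \<Rightarrow> ('v \<Rightarrow> 'w) \<Rightarrow> bool" where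
  "gva_hom _ _ emb V1 V2 f \<longleftrightarrow>
     linear_map V1 V2 f \<and>
     (\<forall>a\<in>carrier V1. \<forall>b\<in>carrier V1. \<forall>n. f (modes V1 a n b) = modes V2 (f a) n (f b)) \<and>
     f (vacuum V1) = vacuum V2 \<and>
     (\<forall>a\<in>carrier V1. f (translation V1 a) = translation V2 (f a)) \<and>
     (\<exists>(Q1 :: 'p monoid) \<Delta>1 \<eta>1 G1 (Q2 :: 'q monoid) \<Delta>2 \<eta>2 G2 \<phi>.
        charge_factor emb V1 Q1 \<Delta>1 \<eta>1 G1 \<and> charge_factor emb V2 Q2 \<Delta>2 \<eta>2 G2 \<and>
        \<phi> \<in> hom Q1 Q2 \<and>
        (\<forall>\<alpha>\<in>carrier Q1. f ` G1 \<alpha> \<subseteq> G2 (\<phi> \<alpha>)) \<and>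
        (\<forall>\<alpha>\<in>carrier Q1. \<forall>\<beta>\<in>carrier Q1.
           \<Delta>2 (\<phi> \<alpha>) (\<phi> \<beta>) = \<Delta>1 \<alpha> \<beta> \<and> \<eta>2 (\<phi> \<alpha>) (\<phi> \<beta>) = \<eta>1 \<alpha> \<beta>))"


section \<open>The free generalized vertex algebra\<close>

text \<open>The biadditive extension to \<open>Q\<^sub>B = free_Abelian_group B\<close> of a function on \<open>B \<times> B\<close>.\<close>

definition biadd_ext ::
  "('b \<Rightarrow> 'b \<Rightarrow> complex) \<Rightarrow> ('b \<Rightarrow>\<^sub>0 int) \<Rightarrow> ('b \<Rightarrow>\<^sub>0 int) \<Rightarrow> complex" where
  "biadd_ext N \<alpha> \<beta> = (\<Sum>a\<in>Poly_Mapping.keys \<alpha>. \<Sum>b\<in>Poly_Mapping.keys \<beta>.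
     of_int (Poly_Mapping.lookup \<alpha> a) * of_int (Poly_Mapping.lookup \<beta> b) * N a b)"

subsection \<open>The free associative algebra and its completion\<close>

text \<open>
  The letter \<open>(a, n)\<close> stands for the symbol \<open>a(n)\<close>, a word for a monomial, and a function on words
  for a formal, possibly infinite, linear combination of monomials (addition is pointwise, from
  \<open>Function_Algebras\<close>). Since a word has only finitely many factorizations, the product
  \<open>wmult\<close> is defined for arbitrary such combinations. The algebra \<open>A\<close> consists of the finite
  ones; the completion is realised by infinite ones, see below.
\<close>

type_synonym 'b word = "('b \<times> complex) list"

definition monom_w :: "'b word \<Rightarrow> 'b word \<Rightarrow> 'k::field" where
  "monom_w w = (\<lambda>v. if v = w then 1 else 0)"

definition wscale :: "'k::field \<Rightarrow> ('b word \<Rightarrow> 'k) \<Rightarrow> 'b word \<Rightarrow> 'k" where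
  "wscale c f = (\<lambda>w. c * f w)"

definition wmult :: "('b word \<Rightarrow> 'k::field) \<Rightarrow> ('b word \<Rightarrow> 'k) \<Rightarrow> 'b word \<Rightarrow> 'k" where
  "wmult f g = (\<lambda>w. \<Sum>i\<le>length w. f (take i w) * g (drop i w))"

text \<open>
  The derivation with \<open>T(a(n)) = -n a(n-1)\<close>: the word \<open>w\<close> arises from the words in which one mode
  \<open>n\<close> of \<open>w\<close> is replaced by \<open>n + 1\<close>, with coefficient \<open>-(n + 1)\<close>.
\<close>

definition wderiv :: "(complex \<Rightarrow> 'k::field) \<Rightarrow> ('b word \<Rightarrow> 'k) \<Rightarrow> 'b word \<Rightarrow> 'k" where
  "wderiv emb f = (\<lambda>w. \<Sum>i<length w.
     emb (- (snd (w ! i) + 1)) * f (w[i := (fst (w ! i), snd (w ! i) + 1)]))"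

definition charge_w :: "'b word \<Rightarrow> 'b \<Rightarrow>\<^sub>0 int" where
  "charge_w w = sum_list (map (\<lambda>x. frag_of (fst x)) w)"

definition weight_w :: "'b word \<Rightarrow> complex" where
  "weight_w w = sum_list (map (\<lambda>x. - snd x - 1) w)"

definition words_of_degree :: "'b set \<Rightarrow> ('b \<Rightarrow>\<^sub>0 int) \<Rightarrow> complex \<Rightarrow> 'b word set" where
  "words_of_degree B \<alpha> d = {w \<in> lists (B \<times> UNIV). charge_w w = \<alpha> \<and> weight_w w = d}"

definition free_alg :: "'b set \<Rightarrow> ('b word \<Rightarrow> 'k::field) set" where
  "free_alg B = {f. finite {w. f w \<noteq> 0} \<and> {w. f w \<noteq> 0} \<subseteq> lists (B \<times> UNIV)}"

definition free_alg_comp :: "'b set \<Rightarrow> ('b \<Rightarrow>\<^sub>0 int) \<Rightarrow> complex \<Rightarrow> ('b word \<Rightarrow> 'k::field) set" where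
  "free_alg_comp B \<alpha> d = {f \<in> free_alg B. {w. f w \<noteq> 0} \<subseteq> words_of_degree B \<alpha> d}"

definition free_alg_filt :: "'b set \<Rightarrow> int \<Rightarrow> ('b word \<Rightarrow> 'k::field) set" where
  "free_alg_filt B p = {f \<in> free_alg B. \<forall>w. f w \<noteq> 0 \<longrightarrow> Re (weight_w w) \<le> of_int p}"

definition nbhd :: "'b set \<Rightarrow> nat \<Rightarrow> ('b \<Rightarrow>\<^sub>0 int) \<Rightarrow> complex \<Rightarrow> ('b word \<Rightarrow> 'k::field) set" where
  "nbhd B n \<alpha> d = free_alg_comp B \<alpha> d \<inter>
     Modules.module.span wscale
       {wmult x y | x y. x \<in> free_alg B \<and> y \<in> free_alg_filt B (- int n - 1)}"

text \<open>
  As \<open>nbhd B n \<alpha> d\<close> (that is, \<open>I\<^sub>n(A(\<alpha>,d))\<close>) is spanned by monomials, the inverse limit of the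
  quotients \<open>A(\<alpha>,d)/I\<^sub>n(A(\<alpha>,d))\<close> is the space of the infinite linear combinations of monomials of
  degree \<open>(\<alpha>,d)\<close> with, for every \<open>n\<close>, only finitely many terms outside \<open>I\<^sub>n(A(\<alpha>,d))\<close>. The theorem
  \<open>compl_comp_inverse_limit\<close> below verifies this. The subspace \<open>compl_nbhd B n \<alpha> d\<close> is the kernel of
  the projection to \<open>A(\<alpha>,d)/I\<^sub>n(A(\<alpha>,d))\<close>.
\<close>

definition compl_comp :: "'b set \<Rightarrow> ('b \<Rightarrow>\<^sub>0 int) \<Rightarrow> complex \<Rightarrow> ('b word \<Rightarrow> 'k::field) set" where
  "compl_comp B \<alpha> d = {f. {w. f w \<noteq> 0} \<subseteq> words_of_degree B \<alpha> d \<and>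
     (\<forall>n. finite {w. f w \<noteq> 0 \<and> (monom_w w :: 'b word \<Rightarrow> 'k) \<notin> nbhd B n \<alpha> d})}"

definition compl_nbhd :: "'b set \<Rightarrow> nat \<Rightarrow> ('b \<Rightarrow>\<^sub>0 int) \<Rightarrow> complex \<Rightarrow> ('b word \<Rightarrow> 'k::field) set" where
  "compl_nbhd B n \<alpha> d = {f \<in> compl_comp B \<alpha> d.
     \<forall>w. f w \<noteq> 0 \<longrightarrow> (monom_w w :: 'b word \<Rightarrow> 'k) \<in> nbhd B n \<alpha> d}"

definition inverse_limit ::
  "'b set \<Rightarrow> ('b \<Rightarrow>\<^sub>0 int) \<Rightarrow> complex \<Rightarrow> (nat \<Rightarrow> ('b word \<Rightarrow> 'k::field) set) set" where
  "inverse_limit B \<alpha> d = {x. \<forall>n. x n \<in> (\<lambda>g. g +o nbhd B n \<alpha> d) ` free_alg_comp B \<alpha> d \<and>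
     x (Suc n) \<subseteq> x n}"

definition bad_word :: "nat \<Rightarrow> 'b word \<Rightarrow> bool" where
  "bad_word n w \<longleftrightarrow> (\<exists>i\<le>length w. Re (weight_w (drop i w)) \<le> - real n - 1)"

lemma module_wscale: "Modules.module (wscale :: 'k::field \<Rightarrow> ('b word \<Rightarrow> 'k) \<Rightarrow> 'b word \<Rightarrow> 'k)"
  by unfold_locales (auto simp: wscale_def fun_eq_iff algebra_simps)

lemma subspace_bad:
  "Modules.module.subspace wscale {f :: 'b word \<Rightarrow> 'k::field. \<forall>w. f w \<noteq> 0 \<longrightarrow> bad_word n w}"
proof -
  have "f w \<noteq> 0 \<or> g w \<noteq> 0" if "f w + g w \<noteq> 0" for f g :: "'b word \<Rightarrow> 'k" and w
    using that by auto
  then show ?thesis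
    unfolding Modules.module.subspace_def[OF module_wscale] by (fastforce simp: wscale_def)
qed

lemma nbhd_support_bad:
  assumes "f \<in> (nbhd B n \<alpha> d :: ('b word \<Rightarrow> 'k::field) set)" "f w \<noteq> 0"
  shows "bad_word n w"
proof -
  let ?G = "{wmult x y | x y. x \<in> (free_alg B :: ('b word \<Rightarrow> 'k) set) \<and> y \<in> free_alg_filt B (- int n - 1)}"
  have "?G \<subseteq> {f. \<forall>w. f w \<noteq> 0 \<longrightarrow> bad_word n w}"
  proof clarify
    fix x y :: "'b word \<Rightarrow> 'k" and w
    assume y: "y \<in> free_alg_filt B (- int n - 1)" and nz: "wmult x y w \<noteq> 0"
    from nz obtain i where "i \<le> length w" "y (drop i w) \<noteq> 0"
      unfolding wmult_def by (metis (no_types, lifting) atMost_iff mult_zero_right sum.neutral)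
    then show "bad_word n w"
      using y unfolding free_alg_filt_def bad_word_def by force
  qed
  then have "Modules.module.span wscale ?G \<subseteq> {f. \<forall>w. f w \<noteq> 0 \<longrightarrow> bad_word n w}"
    using Modules.module.span_minimal[OF module_wscale _ subspace_bad] by blast
  then show ?thesis using assms unfolding nbhd_def by blast
qed

lemma wmult_monom:
  "wmult (monom_w u) (monom_w v) = (monom_w (u @ v) :: 'b word \<Rightarrow> 'k::field)"
proof
  fix w :: "'b word"
  have eq: "monom_w u (take i w) * monom_w v (drop i w)
      = (if i = length u then (if w = u @ v then 1 else 0) else (0::'k))" if "i \<le> length w" for i
  proof -
    have "take i w = u \<and> drop i w = v \<longleftrightarrow> i = length u \<and> w = u @ v"
      using that by (metis append_eq_conv_conj append_take_drop_id length_take min.absorb2)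
    moreover have "monom_w u (take i w) * monom_w v (drop i w)
        = (if take i w = u \<and> drop i w = v then 1 else (0::'k))"
      unfolding monom_w_def by (simp del: take_append drop_append)
    ultimately show ?thesis by presburger
  qed
  have "wmult (monom_w u) (monom_w v) w
      = (\<Sum>i\<le>length w. if i = length u then (if w = u @ v then 1 else 0) else (0::'k))"
    unfolding wmult_def by (rule sum.cong) (auto simp: eq)
  then show "wmult (monom_w u) (monom_w v) w = (monom_w (u @ v) w :: 'k)"
    by (auto simp: monom_w_def)
qed

lemma subspace_nbhd: "Modules.module.subspace wscale (nbhd B n \<alpha> d :: ('b word \<Rightarrow> 'k::field) set)"
proof -
  have "Modules.module.subspace wscale (free_alg_comp B \<alpha> d :: ('b word \<Rightarrow> 'k) set)"
    unfolding Modules.module.subspace_def[OF module_wscale]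
  proof (intro conjI ballI allI)
    show "0 \<in> (free_alg_comp B \<alpha> d :: ('b word \<Rightarrow> 'k) set)"
      by (auto simp: free_alg_comp_def free_alg_def)
  next
    fix x y :: "'b word \<Rightarrow> 'k"
    assume "x \<in> free_alg_comp B \<alpha> d" "y \<in> free_alg_comp B \<alpha> d"
    moreover have "{w. (x + y) w \<noteq> 0} \<subseteq> {w. x w \<noteq> 0} \<union> {w. y w \<noteq> 0}" by auto
    ultimately show "x + y \<in> free_alg_comp B \<alpha> d"
      unfolding free_alg_comp_def free_alg_def mem_Collect_eq
      by (meson Un_least finite_UnI finite_subset order_trans)
  next
    fix x :: "'b word \<Rightarrow> 'k" and c
    assume "x \<in> free_alg_comp B \<alpha> d"
    moreover have "{w. wscale c x w \<noteq> 0} \<subseteq> {w. x w \<noteq> 0}" by (auto simp: wscale_def)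
    ultimately show "wscale c x \<in> free_alg_comp B \<alpha> d"
      unfolding free_alg_comp_def free_alg_def mem_Collect_eq
      by (meson finite_subset order_trans)
  qed
  then show ?thesis
    unfolding nbhd_def
    by (intro Modules.module.subspace_inter[OF module_wscale] Modules.module.subspace_span[OF module_wscale])
qed

lemma monom_in_nbhd_iff:
  assumes w: "w \<in> words_of_degree B \<alpha> d"
  shows "(monom_w w :: 'b word \<Rightarrow> 'k::field) \<in> nbhd B n \<alpha> d \<longleftrightarrow> bad_word n w"
proof
  assume "(monom_w w :: 'b word \<Rightarrow> 'k) \<in> nbhd B n \<alpha> d"
  then show "bad_word n w" by (rule nbhd_support_bad) (simp add: monom_w_def)
next
  assume "bad_word n w"
  then obtain i where i: "Re (weight_w (drop i w)) \<le> - real n - 1" unfolding bad_word_def by auto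
  have supp: "{v. (monom_w u :: 'b word \<Rightarrow> 'k) v \<noteq> 0} = {u}" for u by (auto simp: monom_w_def)
  have l: "take i w \<in> lists (B \<times> UNIV)" "drop i w \<in> lists (B \<times> UNIV)" "w \<in> lists (B \<times> UNIV)"
    using w unfolding words_of_degree_def by (auto dest: in_set_takeD in_set_dropD)
  have "(monom_w (take i w) :: 'b word \<Rightarrow> 'k) \<in> free_alg B"
    "(monom_w (drop i w) :: 'b word \<Rightarrow> 'k) \<in> free_alg_filt B (- int n - 1)"
    "(monom_w w :: 'b word \<Rightarrow> 'k) \<in> free_alg_comp B \<alpha> d"
    using l i w unfolding free_alg_comp_def free_alg_filt_def free_alg_def
    by (auto simp: supp) (auto simp: monom_w_def split: if_splits)
  moreover have "monom_w w = wmult (monom_w (take i w)) (monom_w (drop i w) :: 'b word \<Rightarrow> 'k)"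
    by (simp add: wmult_monom)
  ultimately show "(monom_w w :: 'b word \<Rightarrow> 'k) \<in> nbhd B n \<alpha> d"
    unfolding nbhd_def by (auto intro!: Modules.module.span_base[OF module_wscale])
qed

lemma nbhd_iff:
  "f \<in> (nbhd B n \<alpha> d :: ('b word \<Rightarrow> 'k::field) set) \<longleftrightarrow>
     f \<in> free_alg_comp B \<alpha> d \<and> (\<forall>w. f w \<noteq> 0 \<longrightarrow> bad_word n w)"
proof
  assume "f \<in> nbhd B n \<alpha> d"
  then show "f \<in> free_alg_comp B \<alpha> d \<and> (\<forall>w. f w \<noteq> 0 \<longrightarrow> bad_word n w)"
    using nbhd_support_bad unfolding nbhd_def by blast
next
  assume f: "f \<in> free_alg_comp B \<alpha> d \<and> (\<forall>w. f w \<noteq> 0 \<longrightarrow> bad_word n w)"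
  then have fin: "finite {w. f w \<noteq> 0}" and sub: "{w. f w \<noteq> 0} \<subseteq> words_of_degree B \<alpha> d"
    unfolding free_alg_comp_def free_alg_def by auto
  have sum_apply: "(\<Sum>v\<in>A. g v) w = (\<Sum>v\<in>A. g v w)" if "finite A"
    for A and g :: "'b word \<Rightarrow> 'b word \<Rightarrow> 'k" and w
    using that by induction auto
  have "f = (\<Sum>v\<in>{v. f v \<noteq> 0}. wscale (f v) (monom_w v))"
  proof
    fix w
    have "(\<Sum>v\<in>{v. f v \<noteq> 0}. wscale (f v) (monom_w v)) w
        = (\<Sum>v\<in>{v. f v \<noteq> 0}. if v = w then f v else 0)"
      unfolding sum_apply[OF fin] by (rule sum.cong) (auto simp: wscale_def monom_w_def)
    then show "f w = (\<Sum>v\<in>{v. f v \<noteq> 0}. wscale (f v) (monom_w v)) w" using fin by simp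
  qed
  also have "\<dots> \<in> nbhd B n \<alpha> d"
    using f sub monom_in_nbhd_iff
    by (intro Modules.module.subspace_sum[OF module_wscale subspace_nbhd]
          Modules.module.subspace_scale[OF module_wscale subspace_nbhd]) blast
  finally show "f \<in> nbhd B n \<alpha> d" .
qed

lemma compl_comp_iff:
  "f \<in> (compl_comp B \<alpha> d :: ('b word \<Rightarrow> 'k::field) set) \<longleftrightarrow>
     {w. f w \<noteq> 0} \<subseteq> words_of_degree B \<alpha> d \<and> (\<forall>n. finite {w. f w \<noteq> 0 \<and> \<not> bad_word n w})"
proof -
  have "{w. f w \<noteq> 0 \<and> (monom_w w :: 'b word \<Rightarrow> 'k) \<notin> nbhd B n \<alpha> d} = {w. f w \<noteq> 0 \<and> \<not> bad_word n w}"
    if "{w. f w \<noteq> 0} \<subseteq> words_of_degree B \<alpha> d" for n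
    using that monom_in_nbhd_iff by blast
  then show ?thesis unfolding compl_comp_def by auto
qed

lemma compl_nbhd_iff:
  "f \<in> (compl_nbhd B n \<alpha> d :: ('b word \<Rightarrow> 'k::field) set) \<longleftrightarrow>
     f \<in> compl_comp B \<alpha> d \<and> (\<forall>w. f w \<noteq> 0 \<longrightarrow> bad_word n w)"
  unfolding compl_nbhd_def using compl_comp_iff[of f B \<alpha> d] monom_in_nbhd_iff[of _ B \<alpha> d n] by blast

lemma bad_word_mono: "bad_word (Suc n) w \<Longrightarrow> bad_word n w"
  unfolding bad_word_def by fastforce

lemma bad_word_bound: "\<exists>n. \<not> bad_word n w"
proof -
  obtain n :: nat where n: "\<forall>i\<in>{..length w}. \<bar>Re (weight_w (drop i w))\<bar> \<le> real n"
  proof -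
    let ?M = "\<Sum>i\<le>length w. \<bar>Re (weight_w (drop i w))\<bar>"
    have "\<forall>i\<in>{..length w}. \<bar>Re (weight_w (drop i w))\<bar> \<le> ?M"
      by (intro ballI member_le_sum) auto
    then show ?thesis using that[of "nat \<lceil>?M\<rceil>"] by (meson order_trans real_nat_ceiling_ge)
  qed
  have "\<not> Re (weight_w (drop i w)) \<le> - real n - 1" if "i \<le> length w" for i
    using bspec[OF n, of i] that by (auto simp: abs_le_iff)
  then have "\<not> bad_word n w" unfolding bad_word_def by blast
  then show ?thesis ..
qed

lemma free_alg_comp_subset: "free_alg_comp B \<alpha> d \<subseteq> (compl_comp B \<alpha> d :: ('b word \<Rightarrow> 'k::field) set)"
  unfolding compl_comp_iff subset_iff
  by (auto simp: free_alg_comp_def free_alg_def elim: rev_finite_subset)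

lemma compl_comp_diff:
  assumes "f \<in> (compl_comp B \<alpha> d :: ('b word \<Rightarrow> 'k::field) set)" "g \<in> compl_comp B \<alpha> d"
  shows "f - g \<in> compl_comp B \<alpha> d"
proof -
  have "{w. (f - g) w \<noteq> 0 \<and> \<not> bad_word n w}
      \<subseteq> {w. f w \<noteq> 0 \<and> \<not> bad_word n w} \<union> {w. g w \<noteq> 0 \<and> \<not> bad_word n w}" for n by auto
  moreover have "{w. (f - g) w \<noteq> 0} \<subseteq> {w. f w \<noteq> 0} \<union> {w. g w \<noteq> 0}" by auto
  ultimately show ?thesis
    using assms unfolding compl_comp_iff by (meson Un_least finite_UnI finite_subset order_trans)
qed

lemma free_alg_comp_truncate:
  assumes f: "f \<in> (compl_comp B \<alpha> d :: ('b word \<Rightarrow> 'k::field) set)"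
  shows "(\<lambda>w. if bad_word n w then 0 else f w) \<in> free_alg_comp B \<alpha> d"
proof -
  have "{w. (if bad_word n w then 0 else f w) \<noteq> 0} = {w. f w \<noteq> 0 \<and> \<not> bad_word n w}" by auto
  then show ?thesis
    using f unfolding free_alg_comp_def free_alg_def compl_comp_iff words_of_degree_def by auto
qed

text \<open>The map sending \<open>f\<close> to the family of its residues in \<open>A(\<alpha>,d)/I\<^sub>n(A(\<alpha>,d))\<close>.\<close>

theorem compl_comp_inverse_limit:
  "bij_betw (\<lambda>f n. {g \<in> free_alg_comp B \<alpha> d. f - g \<in> compl_nbhd B n \<alpha> d})
     (compl_comp B \<alpha> d :: ('b word \<Rightarrow> 'k::field) set) (inverse_limit B \<alpha> d)"
proof -
  let ?\<Phi> = "\<lambda>f n. {g \<in> free_alg_comp B \<alpha> d :: ('b word \<Rightarrow> 'k) set. f - g \<in> compl_nbhd B n \<alpha> d}"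
  let ?tr = "\<lambda>n f w. if bad_word n w then 0 else f w :: 'k"
  have \<Phi>: "?\<Phi> f n = {g \<in> free_alg_comp B \<alpha> d. \<forall>w. \<not> bad_word n w \<longrightarrow> g w = f w}"
    if "f \<in> compl_comp B \<alpha> d" for f n
  proof -
    have "f - g \<in> compl_comp B \<alpha> d" if "g \<in> free_alg_comp B \<alpha> d" for g
      using compl_comp_diff[OF \<open>f \<in> compl_comp B \<alpha> d\<close>] that free_alg_comp_subset by blast
    moreover have "(\<forall>w. (f - g) w \<noteq> 0 \<longrightarrow> bad_word n w) \<longleftrightarrow> (\<forall>w. \<not> bad_word n w \<longrightarrow> g w = f w)" for g
      by (metis eq_iff_diff_eq_0 minus_apply)
    ultimately show ?thesis unfolding compl_nbhd_iff by blast
  qed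
  have coset: "g +o nbhd B n \<alpha> d = {h \<in> free_alg_comp B \<alpha> d. \<forall>w. \<not> bad_word n w \<longrightarrow> h w = g w}"
    if g: "g \<in> free_alg_comp B \<alpha> d" for g :: "'b word \<Rightarrow> 'k" and n
  proof (intro equalityI subsetI)
    fix h assume "h \<in> g +o nbhd B n \<alpha> d"
    then obtain k where k: "k \<in> nbhd B n \<alpha> d" "h = g + k" by (auto simp: elt_set_plus_def)
    have "{w. h w \<noteq> 0} \<subseteq> {w. g w \<noteq> 0} \<union> {w. k w \<noteq> 0}" using k by auto
    moreover have "k \<in> free_alg_comp B \<alpha> d" using k nbhd_iff by blast
    ultimately have "h \<in> free_alg_comp B \<alpha> d"
      using g unfolding free_alg_comp_def free_alg_def mem_Collect_eq
      by (meson Un_least finite_UnI finite_subset order_trans)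
    then show "h \<in> {h \<in> free_alg_comp B \<alpha> d. \<forall>w. \<not> bad_word n w \<longrightarrow> h w = g w}"
      using k unfolding nbhd_iff by auto
  next
    fix h assume "h \<in> {h \<in> free_alg_comp B \<alpha> d. \<forall>w. \<not> bad_word n w \<longrightarrow> h w = g w}"
    then have h: "h \<in> free_alg_comp B \<alpha> d" "\<forall>w. \<not> bad_word n w \<longrightarrow> h w = g w" by auto
    have "{w. (h - g) w \<noteq> 0} \<subseteq> {w. h w \<noteq> 0} \<union> {w. g w \<noteq> 0}" by auto
    then have "h - g \<in> free_alg_comp B \<alpha> d"
      using g h unfolding free_alg_comp_def free_alg_def mem_Collect_eq
      by (meson Un_least finite_UnI finite_subset order_trans)
    then have "h - g \<in> nbhd B n \<alpha> d" using h unfolding nbhd_iff by auto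
    moreover have "h = g + (h - g)" by simp
    ultimately show "h \<in> g +o nbhd B n \<alpha> d" unfolding elt_set_plus_def by blast
  qed
  have "inj_on ?\<Phi> (compl_comp B \<alpha> d)"
  proof (rule inj_onI)
    fix f f' :: "'b word \<Rightarrow> 'k"
    assume f: "f \<in> compl_comp B \<alpha> d" "f' \<in> compl_comp B \<alpha> d" and eq: "?\<Phi> f = ?\<Phi> f'"
    show "f = f'"
    proof
      fix w :: "'b word"
      obtain n where n: "\<not> bad_word n w" using bad_word_bound by blast
      have "?tr n f \<in> ?\<Phi> f n" unfolding \<Phi>[OF f(1)] using free_alg_comp_truncate[OF f(1)] by auto
      then have "?tr n f \<in> ?\<Phi> f' n" using eq by (metis (no_types, lifting))
      then show "f w = f' w" unfolding \<Phi>[OF f(2)] using n by auto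
    qed
  qed
  moreover have "?\<Phi> f \<in> inverse_limit B \<alpha> d" if f: "f \<in> compl_comp B \<alpha> d" for f
  proof -
    have "?\<Phi> f n = ?tr n f +o nbhd B n \<alpha> d" for n
      unfolding \<Phi>[OF f] coset[OF free_alg_comp_truncate[OF f]] by auto
    moreover have "?\<Phi> f (Suc n) \<subseteq> ?\<Phi> f n" for n
      unfolding \<Phi>[OF f] using bad_word_mono by blast
    ultimately show ?thesis
      unfolding inverse_limit_def using free_alg_comp_truncate[OF f] by blast
  qed
  moreover have "\<exists>f\<in>compl_comp B \<alpha> d. x = ?\<Phi> f" if x: "x \<in> inverse_limit B \<alpha> d" for x
  proof -
    from x have "\<forall>n. \<exists>g. g \<in> free_alg_comp B \<alpha> d \<and> x n = g +o nbhd B n \<alpha> d"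
      unfolding inverse_limit_def by blast
    then obtain g where g: "\<And>n. g n \<in> free_alg_comp B \<alpha> d" "\<And>n. x n = g n +o nbhd B n \<alpha> d"
      by metis
    have xn: "x n = {h \<in> free_alg_comp B \<alpha> d. \<forall>w. \<not> bad_word n w \<longrightarrow> h w = g n w}" for n
      unfolding g(2)[of n] by (rule coset[OF g(1)])
    have dec: "x m \<subseteq> x n" if "n \<le> m" for n m
    proof -
      have "\<forall>k. x (Suc k) \<subseteq> x k" using x unfolding inverse_limit_def by blast
      then show ?thesis using lift_Suc_antimono_le[of x n m] that by blast
    qed
    have gg: "g m w = g n w" if "n \<le> m" "\<not> bad_word n w" for n m w
    proof -
      have "g m \<in> x m" using g(1) xn by blast
      then have "g m \<in> x n" using dec[OF that(1)] by blast
      then show ?thesis using xn that(2) by blast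
    qed
    define f where "f = (\<lambda>w. g (LEAST n. \<not> bad_word n w) w)"
    have fg: "f w = g n w" if "\<not> bad_word n w" for n w
      unfolding f_def using gg[of "LEAST n. \<not> bad_word n w" n w] that
      by (metis (mono_tags, lifting) LeastI Least_le)
    have "f \<in> compl_comp B \<alpha> d"
      unfolding compl_comp_iff
    proof (intro conjI allI subsetI)
      fix w assume "w \<in> {w. f w \<noteq> 0}"
      then show "w \<in> words_of_degree B \<alpha> d"
        using bad_word_bound[of w] fg g(1) unfolding free_alg_comp_def by fastforce
    next
      fix n
      have "{w. f w \<noteq> 0 \<and> \<not> bad_word n w} \<subseteq> {w. g n w \<noteq> 0}" using fg by auto
      then show "finite {w. f w \<noteq> 0 \<and> \<not> bad_word n w}"
        using g(1)[of n] unfolding free_alg_comp_def free_alg_def by (auto elim: finite_subset)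
    qed
    moreover from this have "x = ?\<Phi> f"
      unfolding fun_eq_iff xn using \<Phi> fg by auto
    ultimately show ?thesis by blast
  qed
  ultimately show ?thesis
    unfolding bij_betw_def by (intro conjI equalityI subsetI) auto
qed

definition homog_part ::
  "('b \<Rightarrow>\<^sub>0 int) \<Rightarrow> complex \<Rightarrow> ('b word \<Rightarrow> 'k::field) \<Rightarrow> 'b word \<Rightarrow> 'k" where
  "homog_part \<alpha> d f = (\<lambda>w. if charge_w w = \<alpha> \<and> weight_w w = d then f w else 0)"

text \<open>
  The direct sum of the \<open>compl_comp B \<alpha> d\<close>. On it, \<open>wmult\<close> and \<open>wderiv emb\<close> are the continuous
  extensions of the product and the derivation of \<open>A\<close>.
\<close>

definition compl_alg :: "'b set \<Rightarrow> ('b word \<Rightarrow> 'k::field) set" where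
  "compl_alg B = {f. finite {(\<alpha>, d). homog_part \<alpha> d f \<noteq> 0} \<and>
     (\<forall>\<alpha> d. homog_part \<alpha> d f \<in> compl_comp B \<alpha> d)}"

definition compl_closure ::
  "'b set \<Rightarrow> ('b \<Rightarrow>\<^sub>0 int) \<Rightarrow> complex \<Rightarrow> ('b word \<Rightarrow> 'k::field) set \<Rightarrow> ('b word \<Rightarrow> 'k) set" where
  "compl_closure B \<alpha> d S = {f \<in> compl_comp B \<alpha> d. \<forall>n. \<exists>g\<in>S. f - g \<in> compl_nbhd B n \<alpha> d}"

definition componentwise_closure ::
  "'b set \<Rightarrow> ('b word \<Rightarrow> 'k::field) set \<Rightarrow> ('b word \<Rightarrow> 'k) set" where
  "componentwise_closure B S = {f \<in> compl_alg B.
     \<forall>\<alpha> d. homog_part \<alpha> d f \<in> compl_closure B \<alpha> d (S \<inter> compl_comp B \<alpha> d)}"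

subsection \<open>The ideals\<close>

definition compl_left_ideal :: "'b set \<Rightarrow> ('b word \<Rightarrow> 'k::field) set \<Rightarrow> bool" where
  "compl_left_ideal B U \<longleftrightarrow> U \<subseteq> compl_alg B \<and> Modules.module.subspace wscale U \<and>
     (\<forall>x\<in>compl_alg B. \<forall>u\<in>U. wmult x u \<in> U)"

definition compl_ideal :: "'b set \<Rightarrow> ('b word \<Rightarrow> 'k::field) set \<Rightarrow> bool" where
  "compl_ideal B U \<longleftrightarrow> compl_left_ideal B U \<and> (\<forall>x\<in>compl_alg B. \<forall>u\<in>U. wmult u x \<in> U)"

text \<open>
  The element \<open>l(a,b,s,t)\<close>, written out as a function on words; each of the two index sets below has
  at most one element.
\<close>

definition local_rel ::
  "(complex \<Rightarrow> 'k::field) \<Rightarrow> ('b \<Rightarrow> 'b \<Rightarrow> complex) \<Rightarrow> (('b \<Rightarrow>\<^sub>0 int) \<Rightarrow> ('b \<Rightarrow>\<^sub>0 int) \<Rightarrow> complex) \<Rightarrow>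
   'b \<Rightarrow> 'b \<Rightarrow> complex \<Rightarrow> complex \<Rightarrow> 'b word \<Rightarrow> 'k" where
  "local_rel emb N \<eta> a b s t = (\<lambda>w.
     (\<Sum>j \<in> {j::nat. w = [(a, s + N a b - of_nat j), (b, t + of_nat j)]}.
        emb ((-1) ^ j * (N a b gchoose j)))
     - emb (\<eta> (frag_of a) (frag_of b) * exp (of_real pi * \<i> * N a b)) *
     (\<Sum>j \<in> {j::nat. w = [(b, t + N a b - of_nat j), (a, s + of_nat j)]}.
        emb ((-1) ^ j * (N a b gchoose j))))"

definition locality_ideal ::
  "(complex \<Rightarrow> 'k::field) \<Rightarrow> 'b set \<Rightarrow> ('b \<Rightarrow> 'b \<Rightarrow> complex) \<Rightarrow>
   (('b \<Rightarrow>\<^sub>0 int) \<Rightarrow> ('b \<Rightarrow>\<^sub>0 int) \<Rightarrow> complex) \<Rightarrow> ('b word \<Rightarrow> 'k) set" where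
  "locality_ideal emb B N \<eta> =
     compl_ideal B hull {local_rel emb N \<eta> a b s t | a b s t. a \<in> B \<and> b \<in> B}"

definition vacuum_ideal ::
  "'b set \<Rightarrow> ('b \<Rightarrow> 'b \<Rightarrow> complex) \<Rightarrow> ('b word \<Rightarrow> 'k::field) set" where
  "vacuum_ideal B N = compl_left_ideal B hull
     ({monom_w [(a, n)] | a n. a \<in> B \<and> (\<nexists>k::int. k < 0 \<and> n = of_int k)} \<union>
      {monom_w ((a, n) # w) | a n w. a \<in> B \<and> w \<in> lists (B \<times> UNIV) \<and> w \<noteq> [] \<and>
         n \<notin> biadd_ext N (frag_of a) (charge_w w) +o \<int>})"

definition free_relations ::
  "(complex \<Rightarrow> 'k::field) \<Rightarrow> 'b set \<Rightarrow> ('b \<Rightarrow> 'b \<Rightarrow> complex) \<Rightarrow>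
   (('b \<Rightarrow>\<^sub>0 int) \<Rightarrow> ('b \<Rightarrow>\<^sub>0 int) \<Rightarrow> complex) \<Rightarrow> ('b word \<Rightarrow> 'k) set" where
  "free_relations emb B N \<eta> =
     componentwise_closure B (locality_ideal emb B N \<eta>) + componentwise_closure B (vacuum_ideal B N)"

subsection \<open>The quotient\<close>

text \<open>
  Elements of the free GVA are cosets \<open>f +o W\<close>, where \<open>W = free_relations emb B N \<eta>\<close>; cosets are added
  elementwise. The record fields \<open>mult\<close> and \<open>one\<close> are not used. The state-field correspondence
  \<open>Y\<close> is a parameter here, and is pinned down by \<open>free_gva_structure\<close>.
\<close>

definition free_gva ::
  "(complex \<Rightarrow> 'k::field) \<Rightarrow> 'b set \<Rightarrow> ('b \<Rightarrow> 'b \<Rightarrow> complex) \<Rightarrow>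
   (('b \<Rightarrow>\<^sub>0 int) \<Rightarrow> ('b \<Rightarrow>\<^sub>0 int) \<Rightarrow> complex) \<Rightarrow>
   (('b word \<Rightarrow> 'k) set \<Rightarrow> complex \<Rightarrow> ('b word \<Rightarrow> 'k) set \<Rightarrow> ('b word \<Rightarrow> 'k) set) \<Rightarrow>
   ('k, ('b word \<Rightarrow> 'k) set) gva" where
  "free_gva emb B N \<eta> Y = (let W = free_relations emb B N \<eta> in
     \<lparr>carrier = (\<lambda>f. f +o W) ` compl_alg B, monoid.mult = undefined, one = undefined,
      ring.zero = W, add = (+), module.smult = (\<lambda>c S. wscale c ` S + W),
      vacuum = monom_w [] +o W, translation = (\<lambda>S. wderiv emb ` S + W), modes = Y\<rparr>)"

definition free_gen ::
  "(complex \<Rightarrow> 'k::field) \<Rightarrow> 'b set \<Rightarrow> ('b \<Rightarrow> 'b \<Rightarrow> complex) \<Rightarrow>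
   (('b \<Rightarrow>\<^sub>0 int) \<Rightarrow> ('b \<Rightarrow>\<^sub>0 int) \<Rightarrow> complex) \<Rightarrow> 'b \<Rightarrow> ('b word \<Rightarrow> 'k) set" where
  "free_gen emb B N \<eta> a = monom_w [(a, -1)] +o free_relations emb B N \<eta>"

text \<open>The operator \<open>a(n)\<close> on the quotient.\<close>

definition free_act ::
  "(complex \<Rightarrow> 'k::field) \<Rightarrow> 'b set \<Rightarrow> ('b \<Rightarrow> 'b \<Rightarrow> complex) \<Rightarrow>
   (('b \<Rightarrow>\<^sub>0 int) \<Rightarrow> ('b \<Rightarrow>\<^sub>0 int) \<Rightarrow> complex) \<Rightarrow> 'b \<Rightarrow> complex \<Rightarrow>
   ('b word \<Rightarrow> 'k) set \<Rightarrow> ('b word \<Rightarrow> 'k) set" where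
  "free_act emb B N \<eta> a n S = wmult (monom_w [(a, n)]) ` S + free_relations emb B N \<eta>"

definition free_grading ::
  "(complex \<Rightarrow> 'k::field) \<Rightarrow> 'b set \<Rightarrow> ('b \<Rightarrow> 'b \<Rightarrow> complex) \<Rightarrow>
   (('b \<Rightarrow>\<^sub>0 int) \<Rightarrow> ('b \<Rightarrow>\<^sub>0 int) \<Rightarrow> complex) \<Rightarrow> ('b \<Rightarrow>\<^sub>0 int) \<Rightarrow> ('b word \<Rightarrow> 'k) set set" where
  "free_grading emb B N \<eta> \<alpha> = (\<lambda>f. f +o free_relations emb B N \<eta>) `
     {f \<in> compl_alg B. \<forall>w. f w \<noteq> 0 \<longrightarrow> charge_w w = \<alpha>}"

text \<open>
  \<open>Y\<close> is the GVA structure of the free GVA: the one with the vacuum, translation operator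
  and charge factor given above and with \<open>Y(a,z) = a(z)\<close> for \<open>a \<in> B\<close>. It exists, and is unique up to
  its values outside the carrier.
\<close>

definition free_gva_structure ::
  "(complex \<Rightarrow> 'k::field) \<Rightarrow> 'b set \<Rightarrow> ('b \<Rightarrow> 'b \<Rightarrow> complex) \<Rightarrow>
   (('b \<Rightarrow>\<^sub>0 int) \<Rightarrow> ('b \<Rightarrow>\<^sub>0 int) \<Rightarrow> complex) \<Rightarrow>
   (('b word \<Rightarrow> 'k) set \<Rightarrow> complex \<Rightarrow> ('b word \<Rightarrow> 'k) set \<Rightarrow> ('b word \<Rightarrow> 'k) set) \<Rightarrow> bool" where
  "free_gva_structure emb B N \<eta> Y \<longleftrightarrow>
     gva_with_charge_factor emb (free_gva emb B N \<eta> Y) (free_Abelian_group B)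
       (\<lambda>\<alpha> \<beta>. biadd_ext N \<alpha> \<beta> +o \<int>) \<eta> (free_grading emb B N \<eta>) \<and>
     (\<forall>a\<in>B. \<forall>n. \<forall>x\<in>carrier (free_gva emb B N \<eta> Y).
        Y (free_gen emb B N \<eta> a) n x = free_act emb B N \<eta> a n x)"

end

theory Submission
  imports Defs
begin

text \<open>
  The map sends a word \<open>a\<^sub>1(n\<^sub>1)\<dots>a\<^sub>m(n\<^sub>m)\<close> to the corresponding iterated product of the vectors
  \<open>i(a\<^sub>j)\<close> applied to the vacuum of \<open>V'\<close>. It extends to infinite combinations because of a level
  bound: with weights shifted by the sum of the \<open>N(a\<^sub>i,a\<^sub>j)\<close> with \<open>i < j\<close>, words whose shifted weight
  (the level) is not a natural number vanish. This is a rewriting argument, in which locality swaps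
  the two leftmost letters of a word and lowers the level of its tail, until levels increase from
  right to left. The same argument inside the completion, where one has to check that the infinite
  sums that occur stay in the sum of the two closed ideals, shows that the free generalized vertex
  algebra is spanned by words; this gives uniqueness. Compatibility with all modes follows from that
  with the modes of the generating fields by Goddard's uniqueness argument.
\<close>

section \<open>The algebra of formal combinations of words\<close>

text \<open>The obstacle is that both the construction of the map and its uniqueness have to cope
  with infinite combinations, in a quotient by a sum of two closures that is not known in advance to
  be closed. One uniform statement settles both: for each charge there is a depth, the same for all
  weights, beyond which every combination of words is negligible. It holds because a charge fixes
  the letters, so that level and weight of a suffix differ by one of finitely many constants, and a
  suffix of very low weight has a level with negative real part. The rewriting is carried out for an
  abstract subspace \<open>Z\<close> and used twice, with \<open>Z\<close> the relations and with
  \<open>Z\<close> the kernel of evaluation. Locality is an infinite relation, so it can be solved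
  for one of its words only if the terms beyond some index already add up to an element of
  \<open>Z\<close>. This is the assumption \<open>swap_tail\<close>: immediate for the kernel, and
  the place where the topology enters for the relations.\<close>

interpretation WS: Modules.module wscale
  by (rule module_wscale)

lemma wmult_add_left: "wmult (f + g) h = wmult f h + wmult g h"
  by (simp add: wmult_def fun_eq_iff distrib_right sum.distrib)

lemma wmult_add_right: "wmult h (f + g) = wmult h f + wmult h g"
  by (simp add: wmult_def fun_eq_iff distrib_left sum.distrib)

lemma wmult_scale_left: "wmult (wscale c f) h = wscale c (wmult f h)"
  by (simp add: wmult_def wscale_def fun_eq_iff sum_distrib_left mult.assoc)

lemma wmult_scale_right: "wmult h (wscale c f) = wscale c (wmult h f)"
  by (simp add: wmult_def wscale_def fun_eq_iff sum_distrib_left mult.left_commute)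

lemma wmult_zero_left [simp]: "wmult 0 f = 0"
  by (simp add: wmult_def fun_eq_iff)

lemma wmult_zero_right [simp]: "wmult f 0 = 0"
  by (simp add: wmult_def fun_eq_iff)

text \<open>Both sides sum over the ways of cutting \<open>w\<close> at two places. On the left the
  second cut is chosen first; on the right it is counted from the first cut on.\<close>

lemma wmult_assoc: "wmult (wmult f g) h = wmult f (wmult g h)"
proof
  fix w
  have "wmult (wmult f g) h w =
      (\<Sum>i\<le>length w. \<Sum>j\<le>i. f (take j w) * g (drop j (take i w)) * h (drop i w))"
    unfolding wmult_def sum_distrib_right
    by (intro sum.cong) (auto simp: min_def)
  also have "\<dots> = (\<Sum>(i, j)\<in>(SIGMA i:{..length w}. {..i}). f (take j w) * g (drop j (take i w)) * h (drop i w))"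
    by (subst sum.Sigma) auto
  also have "\<dots> = (\<Sum>(j, k)\<in>(SIGMA j:{..length w}. {..length w - j}).
      f (take j w) * (g (take k (drop j w)) * h (drop k (drop j w))))"
    by (rule sum.reindex_bij_witness[where i = "\<lambda>(j, k). (j + k, j)" and j = "\<lambda>(i, j). (j, i - j)"])
      (auto simp: drop_take mult.assoc)
  also have "\<dots> = wmult f (wmult g h) w"
    unfolding wmult_def sum_distrib_left
    by (subst sum.Sigma[symmetric]) auto
  finally show "wmult (wmult f g) h w = wmult f (wmult g h) w" .
qed

lemma wmult_monom_left:
  "wmult (monom_w u) f w = (if take (length u) w = u then f (drop (length u) w) else 0)"
proof -
  have eq: "monom_w u (take i w) * f (drop i w)
      = (if i = length u then (if take (length u) w = u then f (drop (length u) w) else 0) else 0)"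
    if "i \<le> length w" for i
  proof (cases "i = length u")
    case False
    then have "take i w \<noteq> u" using that by auto
    then show ?thesis using False by (simp add: monom_w_def)
  qed (simp add: monom_w_def)
  have "wmult (monom_w u) f w = (\<Sum>i\<le>length w.
      if i = length u then (if take (length u) w = u then f (drop (length u) w) else 0) else 0)"
    unfolding wmult_def using eq by (intro sum.cong) auto
  also have "\<dots> = (if length u \<le> length w then (if take (length u) w = u then f (drop (length u) w) else 0) else 0)"
    by simp
  also have "\<dots> = (if take (length u) w = u then f (drop (length u) w) else 0)"
    by (metis length_take min.cobounded1)
  finally show ?thesis .
qed

lemma wmult_letter: "wmult (monom_w [x]) f w = (case w of [] \<Rightarrow> 0 | y # v \<Rightarrow> if y = x then f v else 0)"
  unfolding wmult_monom_left by (auto split: list.split)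

lemma wmult_monom_right:
  "wmult f (monom_w c) w =
     (if drop (length w - length c) w = c then f (take (length w - length c) w) else 0)"
proof -
  have eq: "f (take i w) * monom_w c (drop i w)
      = (if i = length w - length c
         then (if drop (length w - length c) w = c then f (take (length w - length c) w) else 0) else 0)"
    if "i \<le> length w" for i
  proof (cases "i = length w - length c")
    case False
    then have "drop i w \<noteq> c" using that by auto
    then show ?thesis using False by (simp add: monom_w_def)
  qed (simp add: monom_w_def)
  have "wmult f (monom_w c) w = (\<Sum>i\<le>length w. if i = length w - length c
      then (if drop (length w - length c) w = c then f (take (length w - length c) w) else 0) else 0)"
    unfolding wmult_def using eq by (intro sum.cong) auto
  then show ?thesis by simp
qed

lemma wmult_one_left [simp]: "wmult (monom_w []) f = f"
  by (simp add: fun_eq_iff wmult_monom_left)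

lemma wmult_one_right [simp]: "wmult f (monom_w []) = f"
  by (simp add: fun_eq_iff wmult_monom_right)

lemma wmult_nonzeroE:
  assumes "wmult f g w \<noteq> 0"
  obtains u v where "w = u @ v" "f u \<noteq> 0" "g v \<noteq> 0"
proof -
  from assms obtain i where "i \<le> length w" "f (take i w) * g (drop i w) \<noteq> 0"
    unfolding wmult_def by (metis (no_types, lifting) atMost_iff sum.neutral)
  then show ?thesis using that[of "take i w" "drop i w"] by auto
qed

lemma charge_w_append [simp]: "charge_w (u @ v) = charge_w u + charge_w v"
  by (simp add: charge_w_def)

lemma charge_w_Nil [simp]: "charge_w [] = 0"
  by (simp add: charge_w_def)

lemma charge_w_Cons [simp]: "charge_w (x # v) = frag_of (fst x) + charge_w v"
  by (simp add: charge_w_def)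

lemma weight_w_append [simp]: "weight_w (u @ v) = weight_w u + weight_w v"
  by (simp add: weight_w_def)

lemma weight_w_Nil [simp]: "weight_w [] = 0"
  by (simp add: weight_w_def)

lemma weight_w_Cons [simp]: "weight_w (x # v) = - snd x - 1 + weight_w v"
  by (simp add: weight_w_def)

lemma in_words_of_degree: "w \<in> lists (B \<times> UNIV) \<Longrightarrow> w \<in> words_of_degree B (charge_w w) (weight_w w)"
  by (simp add: words_of_degree_def)

lemma words_of_degree_append:
  "u \<in> words_of_degree B \<alpha> d \<Longrightarrow> v \<in> words_of_degree B \<beta> e \<Longrightarrow> u @ v \<in> words_of_degree B (\<alpha> + \<beta>) (d + e)"
  by (auto simp: words_of_degree_def)

lemma bad_word_appendI: "bad_word n v \<Longrightarrow> bad_word n (u @ v)"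
  unfolding bad_word_def
  by (metis add_diff_cancel_left' add_le_cancel_left drop_append drop_eq_Nil2 append_Nil le_add1 length_append)

text \<open>Appending \<open>v\<close> shifts the weight of every suffix of \<open>u\<close> by that
  of \<open>v\<close>. So multiplication on the right loses a bounded amount of depth, whereas
  multiplication on the left (\<open>bad_word_appendI\<close>) loses none.\<close>

lemma bad_word_append_left:
  assumes "bad_word m u" "Re (weight_w v) \<le> real m - real n"
  shows "bad_word n (u @ v)"
proof -
  from assms(1) obtain i where "i \<le> length u" "Re (weight_w (drop i u)) \<le> - real m - 1"
    unfolding bad_word_def by blast
  then show ?thesis using assms(2) unfolding bad_word_def
    by (intro exI[of _ i]) auto
qed

lemma bad_word_antimono: "bad_word n w \<Longrightarrow> m \<le> n \<Longrightarrow> bad_word m w"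
  unfolding bad_word_def by force

lemma sum_fun_apply: "(\<Sum>x\<in>A. g x) w = (\<Sum>x\<in>A. g x w)"
  for g :: "'i \<Rightarrow> 'c \<Rightarrow> 'd::comm_monoid_add"
  by (induction A rule: infinite_finite_induct) auto

lemma finite_support_expand:
  assumes "finite {w. f w \<noteq> 0}"
  shows "f = (\<Sum>v\<in>{v. f v \<noteq> 0}. wscale (f v) (monom_w v))"
proof
  fix w
  have "(\<Sum>v\<in>{v. f v \<noteq> 0}. wscale (f v) (monom_w v)) w = (\<Sum>v\<in>{v. f v \<noteq> 0}. if v = w then f v else 0)"
    unfolding sum_fun_apply by (rule sum.cong) (auto simp: wscale_def monom_w_def)
  then show "f w = (\<Sum>v\<in>{v. f v \<noteq> 0}. wscale (f v) (monom_w v)) w" using assms by simp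
qed

lemma finite_support_in_subspace:
  assumes "WS.subspace Z" "finite {w. f w \<noteq> 0}" "\<And>w. f w \<noteq> 0 \<Longrightarrow> monom_w w \<in> Z"
  shows "f \<in> Z"
  using assms
  by (subst finite_support_expand[OF assms(2)])
    (auto intro!: WS.subspace_sum WS.subspace_scale)

section \<open>Homogeneous components of the completion\<close>

lemma compl_compI:
  assumes "\<And>w. f w \<noteq> 0 \<Longrightarrow> w \<in> words_of_degree B \<alpha> d" "\<And>n. finite {w. f w \<noteq> 0 \<and> \<not> bad_word n w}"
  shows "f \<in> compl_comp B \<alpha> d"
  using assms by (auto simp: compl_comp_iff)

lemma compl_compD:
  assumes "f \<in> compl_comp B \<alpha> d"
  shows "f w \<noteq> 0 \<Longrightarrow> w \<in> words_of_degree B \<alpha> d" "finite {w. f w \<noteq> 0 \<and> \<not> bad_word n w}"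
  using assms by (auto simp: compl_comp_iff)

lemma subspace_compl_comp: "WS.subspace (compl_comp B \<alpha> d)"
proof (unfold WS.subspace_def, intro conjI ballI allI)
  show "0 \<in> compl_comp B \<alpha> d" by (rule compl_compI) auto
next
  fix x y :: "'b word \<Rightarrow> 'k::field"
  assume xy: "x \<in> compl_comp B \<alpha> d" "y \<in> compl_comp B \<alpha> d"
  show "x + y \<in> compl_comp B \<alpha> d"
  proof (rule compl_compI)
    fix n
    have "{w. (x + y) w \<noteq> 0 \<and> \<not> bad_word n w}
        \<subseteq> {w. x w \<noteq> 0 \<and> \<not> bad_word n w} \<union> {w. y w \<noteq> 0 \<and> \<not> bad_word n w}" by auto
    then show "finite {w. (x + y) w \<noteq> 0 \<and> \<not> bad_word n w}"
      by (rule finite_subset) (simp add: compl_compD(2)[OF xy(1)] compl_compD(2)[OF xy(2)])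
  next
    fix w assume "(x + y) w \<noteq> 0"
    then have "x w \<noteq> 0 \<or> y w \<noteq> 0" by auto
    then show "w \<in> words_of_degree B \<alpha> d" using xy compl_compD(1) by blast
  qed
next
  fix c and x :: "'b word \<Rightarrow> 'k::field"
  assume x: "x \<in> compl_comp B \<alpha> d"
  show "wscale c x \<in> compl_comp B \<alpha> d"
  proof (rule compl_compI)
    fix n
    show "finite {w. wscale c x w \<noteq> 0 \<and> \<not> bad_word n w}"
      by (rule finite_subset[OF _ compl_compD(2)[OF x, of n]]) (auto simp: wscale_def)
  qed (use compl_compD(1)[OF x] in \<open>auto simp: wscale_def\<close>)
qed

lemma subspace_compl_nbhd: "WS.subspace (compl_nbhd B n \<alpha> d)"
proof -
  have eq: "compl_nbhd B n \<alpha> d = compl_comp B \<alpha> d \<inter> {f. \<forall>w. f w \<noteq> 0 \<longrightarrow> bad_word n w}"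
    unfolding set_eq_iff by (auto simp: compl_nbhd_iff)
  show ?thesis
    unfolding eq by (intro WS.subspace_inter subspace_compl_comp subspace_bad)
qed

lemma compl_nbhd_antimono: "m \<le> n \<Longrightarrow> compl_nbhd B n \<alpha> d \<subseteq> compl_nbhd B m \<alpha> d"
  unfolding subset_iff compl_nbhd_iff using bad_word_antimono by blast

lemma monom_in_compl_comp: "w \<in> words_of_degree B \<alpha> d \<Longrightarrow> monom_w w \<in> compl_comp B \<alpha> d"
proof (rule compl_compI)
  fix n
  show "finite {v. monom_w w v \<noteq> 0 \<and> \<not> bad_word n v}"
    by (rule finite_subset[of _ "{w}"]) (auto simp: monom_w_def)
qed (simp add: monom_w_def split: if_splits)

text \<open>All words of \<open>y\<close> have the same weight \<open>e\<close>. Hence a product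
  word that is not bad at depth \<open>n\<close> comes from a left factor that is not bad at a fixed
  depth \<open>m\<close> and a right factor that is not bad at depth \<open>n\<close>, so from
  finitely many pairs.\<close>

lemma compl_comp_wmult:
  assumes x: "x \<in> compl_comp B \<alpha> d" and y: "y \<in> compl_comp B \<beta> e"
  shows "wmult x y \<in> compl_comp B (\<alpha> + \<beta>) (d + e)"
proof (rule compl_compI)
  fix w assume "wmult x y w \<noteq> 0"
  then show "w \<in> words_of_degree B (\<alpha> + \<beta>) (d + e)"
    by (elim wmult_nonzeroE) (use compl_compD(1)[OF x] compl_compD(1)[OF y] in \<open>auto intro: words_of_degree_append\<close>)
next
  fix n :: nat
  define m where "m = n + nat \<lceil>\<bar>Re e\<bar>\<rceil>"
  have m: "Re e \<le> real m - real n" unfolding m_def by simp linarith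
  have "{w. wmult x y w \<noteq> 0 \<and> \<not> bad_word n w}
      \<subseteq> (\<lambda>(u, v). u @ v) ` ({u. x u \<noteq> 0 \<and> \<not> bad_word m u} \<times> {v. y v \<noteq> 0 \<and> \<not> bad_word n v})"
  proof clarify
    fix w assume "wmult x y w \<noteq> 0" and good: "\<not> bad_word n w"
    then obtain u v where w: "w = u @ v" "x u \<noteq> 0" "y v \<noteq> 0" by (elim wmult_nonzeroE)
    have "Re (weight_w v) \<le> real m - real n"
      using compl_compD(1)[OF y w(3)] m by (simp add: words_of_degree_def)
    then have "\<not> bad_word m u" using good bad_word_append_left w(1) by blast
    moreover have "\<not> bad_word n v" using good bad_word_appendI w(1) by blast
    ultimately show "w \<in> (\<lambda>(u, v). u @ v) ` ({u. x u \<noteq> 0 \<and> \<not> bad_word m u} \<times> {v. y v \<noteq> 0 \<and> \<not> bad_word n v})"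
      using w by force
  qed
  then show "finite {w. wmult x y w \<noteq> 0 \<and> \<not> bad_word n w}"
    by (rule finite_subset) (simp add: compl_compD(2)[OF x] compl_compD(2)[OF y])
qed

lemma compl_nbhd_wmult_left:
  assumes x: "x \<in> compl_comp B \<alpha> d" and y: "y \<in> compl_nbhd B n \<beta> e"
  shows "wmult x y \<in> compl_nbhd B n (\<alpha> + \<beta>) (d + e)"
  unfolding compl_nbhd_iff
proof (intro conjI allI impI)
  show "wmult x y \<in> compl_comp B (\<alpha> + \<beta>) (d + e)"
    using x y by (auto simp: compl_nbhd_iff intro: compl_comp_wmult)
  show "bad_word n w" if "wmult x y w \<noteq> 0" for w
    using that by (elim wmult_nonzeroE) (use y in \<open>auto simp: compl_nbhd_iff intro: bad_word_appendI\<close>)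
qed

lemma compl_nbhd_wmult_right:
  assumes x: "x \<in> compl_nbhd B m \<alpha> d" and y: "y \<in> compl_comp B \<beta> e" and "Re e \<le> real m - real n"
  shows "wmult x y \<in> compl_nbhd B n (\<alpha> + \<beta>) (d + e)"
  unfolding compl_nbhd_iff
proof (intro conjI allI impI)
  show "wmult x y \<in> compl_comp B (\<alpha> + \<beta>) (d + e)"
    using x y by (auto simp: compl_nbhd_iff intro: compl_comp_wmult)
  show "bad_word n w" if "wmult x y w \<noteq> 0" for w
    using that
  proof (elim wmult_nonzeroE)
    fix u v assume w: "w = u @ v" "x u \<noteq> 0" "y v \<noteq> 0"
    then have "Re (weight_w v) \<le> real m - real n"
      using compl_compD(1)[OF y w(3)] assms(3) by (simp add: words_of_degree_def)
    moreover have "bad_word m u" using x w(2) by (simp add: compl_nbhd_iff)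
    ultimately show ?thesis using w(1) bad_word_append_left by blast
  qed
qed

text \<open>The word itself is a suffix of itself, so its weight alone makes it bad.\<close>

lemma low_weight_compl_nbhd:
  assumes "f \<in> compl_comp B \<alpha> d" "Re d \<le> - real n - 1"
  shows "f \<in> compl_nbhd B n \<alpha> d"
  unfolding compl_nbhd_iff
proof (intro conjI allI impI assms(1))
  fix w assume "f w \<noteq> 0"
  then have "weight_w w = d" using compl_compD(1)[OF assms(1)] by (simp add: words_of_degree_def)
  then show "bad_word n w" unfolding bad_word_def using assms(2) by (intro exI[of _ 0]) simp
qed

text \<open>Membership statements about the completion are proved through this splitting: word by
  word for the finite part \<open>g\<close>, by depth for the tail \<open>h\<close>.\<close>

lemma compl_comp_split:
  assumes f: "f \<in> compl_comp B \<alpha> d"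
  obtains g h where "f = g + h" "finite {w. g w \<noteq> 0}" "g \<in> compl_comp B \<alpha> d" "h \<in> compl_nbhd B n \<alpha> d"
    "\<And>w. g w \<noteq> 0 \<Longrightarrow> f w \<noteq> 0"
proof -
  define g where "g = (\<lambda>w. if bad_word n w then 0 else f w)"
  have g: "g \<in> free_alg_comp B \<alpha> d" unfolding g_def by (rule free_alg_comp_truncate[OF f])
  then have gc: "g \<in> compl_comp B \<alpha> d" using free_alg_comp_subset by blast
  have "f - g \<in> compl_nbhd B n \<alpha> d"
    unfolding compl_nbhd_iff using WS.subspace_diff[OF subspace_compl_comp f gc] by (auto simp: g_def)
  moreover have "finite {w. g w \<noteq> 0}" using g by (auto simp: free_alg_comp_def free_alg_def)
  moreover have "f = g + (f - g)" by simp
  moreover have "f w \<noteq> 0" if "g w \<noteq> 0" for w using that by (auto simp: g_def split: if_splits)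
  ultimately show ?thesis using gc that by metis
qed

lemma homog_part_add: "homog_part \<alpha> d (f + g) = homog_part \<alpha> d f + homog_part \<alpha> d g"
  by (auto simp: homog_part_def)

lemma homog_part_scale: "homog_part \<alpha> d (wscale c f) = wscale c (homog_part \<alpha> d f)"
  by (auto simp: homog_part_def wscale_def)

lemma homog_part_zero [simp]: "homog_part \<alpha> d 0 = 0"
  by (auto simp: homog_part_def)

lemma homog_part_comp:
  assumes "f \<in> compl_comp B \<beta> e"
  shows "homog_part \<alpha> d f = (if \<alpha> = \<beta> \<and> d = e then f else 0)"
  using compl_compD(1)[OF assms] by (fastforce simp: homog_part_def fun_eq_iff words_of_degree_def)

lemma compl_comp_subset_alg: "compl_comp B \<alpha> d \<subseteq> compl_alg B"
proof
  fix f assume f: "f \<in> compl_comp B \<alpha> d"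
  have "{(\<beta>, e). homog_part \<beta> e f \<noteq> 0} \<subseteq> {(\<alpha>, d)}" by (auto simp: homog_part_comp[OF f] split: if_splits)
  then have "finite {(\<beta>, e). homog_part \<beta> e f \<noteq> 0}" by (rule finite_subset) simp
  then show "f \<in> compl_alg B"
    unfolding compl_alg_def using f by (auto simp: homog_part_comp[OF f] intro: WS.subspace_0[OF subspace_compl_comp])
qed

lemma subspace_compl_alg: "WS.subspace (compl_alg B)"
proof (unfold WS.subspace_def, intro conjI ballI allI)
  show "0 \<in> compl_alg B" using WS.subspace_0[OF subspace_compl_comp] compl_comp_subset_alg by blast
next
  fix x y :: "'b word \<Rightarrow> 'k::field"
  assume xy: "x \<in> compl_alg B" "y \<in> compl_alg B"
  have "{(\<alpha>, d). homog_part \<alpha> d (x + y) \<noteq> 0}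
      \<subseteq> {(\<alpha>, d). homog_part \<alpha> d x \<noteq> 0} \<union> {(\<alpha>, d). homog_part \<alpha> d y \<noteq> 0}"
    by (auto simp: homog_part_add)
  then have "finite {(\<alpha>, d). homog_part \<alpha> d (x + y) \<noteq> 0}"
    by (rule finite_subset) (use xy in \<open>simp add: compl_alg_def\<close>)
  then show "x + y \<in> compl_alg B"
    using xy by (auto simp: compl_alg_def homog_part_add intro: WS.subspace_add[OF subspace_compl_comp])
next
  fix c and x :: "'b word \<Rightarrow> 'k::field"
  assume x: "x \<in> compl_alg B"
  have "{(\<alpha>, d). homog_part \<alpha> d (wscale c x) \<noteq> 0} \<subseteq> {(\<alpha>, d). homog_part \<alpha> d x \<noteq> 0}"
    by (auto simp: homog_part_scale)
  then have "finite {(\<alpha>, d). homog_part \<alpha> d (wscale c x) \<noteq> 0}"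
    by (rule finite_subset) (use x in \<open>simp add: compl_alg_def\<close>)
  then show "wscale c x \<in> compl_alg B"
    using x by (auto simp: compl_alg_def homog_part_scale intro: WS.subspace_scale[OF subspace_compl_comp])
qed

lemma sum_homog_parts:
  assumes "f \<in> compl_alg B"
  shows "f = (\<Sum>(\<alpha>, d)\<in>{(\<alpha>, d). homog_part \<alpha> d f \<noteq> 0}. homog_part \<alpha> d f)"
proof
  fix w
  let ?D = "{(\<alpha>, d). homog_part \<alpha> d f \<noteq> 0}"
  have fin: "finite ?D" using assms by (simp add: compl_alg_def)
  have "(\<Sum>(\<alpha>, d)\<in>?D. homog_part \<alpha> d f) w
      = (\<Sum>x\<in>?D. if x = (charge_w w, weight_w w) then f w else 0)"
    unfolding sum_fun_apply by (intro sum.cong) (auto simp: homog_part_def)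
  also have "\<dots> = f w"
    using fin by (auto simp: homog_part_def fun_eq_iff)
  finally show "f w = (\<Sum>(\<alpha>, d)\<in>?D. homog_part \<alpha> d f) w" ..
qed

lemma compl_alg_in_subspace:
  assumes f: "f \<in> compl_alg B" and "WS.subspace Z" "\<And>\<alpha> d. homog_part \<alpha> d f \<in> Z"
  shows "f \<in> Z"
  by (subst sum_homog_parts[OF f]) (use assms in \<open>auto intro!: WS.subspace_sum\<close>)

lemma compl_alg_homog: "f \<in> compl_alg B \<Longrightarrow> homog_part \<alpha> d f \<in> compl_comp B \<alpha> d"
  by (simp add: compl_alg_def)

lemma compl_alg_induct [consumes 1, case_names add comp]:
  assumes "f \<in> compl_alg B"
    and add: "\<And>f g. f \<in> compl_alg B \<Longrightarrow> g \<in> compl_alg B \<Longrightarrow> P f \<Longrightarrow> P g \<Longrightarrow> P (f + g)"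
    and comp: "\<And>f \<alpha> d. f \<in> compl_comp B \<alpha> d \<Longrightarrow> P f"
  shows "P f"
proof -
  have "(\<Sum>(\<alpha>, d)\<in>D. homog_part \<alpha> d f) \<in> compl_alg B \<and> P (\<Sum>(\<alpha>, d)\<in>D. homog_part \<alpha> d f)"
    if "finite D" for D
    using that
  proof induction
    case empty
    have "0 \<in> compl_comp B 0 0" by (rule WS.subspace_0[OF subspace_compl_comp])
    then have "0 \<in> compl_alg B" "P 0" by (blast intro: subsetD[OF compl_comp_subset_alg], rule comp)
    then show ?case unfolding sum.empty by (rule conjI)
  next
    case (insert x D)
    obtain \<alpha> d where x: "x = (\<alpha>, d)" by (cases x)
    have "homog_part \<alpha> d f \<in> compl_comp B \<alpha> d" by (rule compl_alg_homog[OF assms(1)])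
    then have hp: "homog_part \<alpha> d f \<in> compl_alg B" "P (homog_part \<alpha> d f)"
      by (blast intro: subsetD[OF compl_comp_subset_alg], rule comp)
    note IH = insert(3)[THEN conjunct1] insert(3)[THEN conjunct2]
    show ?case
      unfolding x sum.insert[OF insert(1,2)[unfolded x]] prod.case
      by (rule conjI[OF WS.subspace_add[OF subspace_compl_alg hp(1) IH(1)] add[OF hp(1) IH(1) hp(2) IH(2)]])
  qed
  moreover have "finite {(\<alpha>, d). homog_part \<alpha> d f \<noteq> 0}" using assms(1) by (simp add: compl_alg_def)
  ultimately show ?thesis using sum_homog_parts[OF assms(1)] by metis
qed

lemma compl_alg_wmult:
  assumes "x \<in> compl_alg B" "y \<in> compl_alg B"
  shows "wmult x y \<in> compl_alg B"
  using assms(1)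
proof (induction rule: compl_alg_induct)
  case (add f g)
  then show ?case unfolding wmult_add_left by (intro WS.subspace_add[OF subspace_compl_alg])
next
  case (comp x \<alpha> d)
  show ?case using assms(2)
  proof (induction rule: compl_alg_induct)
    case (add f g)
    then show ?case unfolding wmult_add_right by (intro WS.subspace_add[OF subspace_compl_alg])
  next
    case (comp y \<beta> e)
    then show ?case using compl_comp_wmult[OF \<open>x \<in> compl_comp B \<alpha> d\<close>] compl_comp_subset_alg by blast
  qed
qed

lemma monom_in_compl_alg: "w \<in> lists (B \<times> UNIV) \<Longrightarrow> monom_w w \<in> compl_alg B"
  using monom_in_compl_comp[OF in_words_of_degree] compl_comp_subset_alg by blast

section \<open>Closures\<close>

lemma compl_closureI:
  assumes "f \<in> compl_comp B \<alpha> d" "f \<in> S"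
  shows "f \<in> compl_closure B \<alpha> d S"
  unfolding compl_closure_def
  using assms WS.subspace_0[OF subspace_compl_nbhd] by force

lemma subspace_compl_closure:
  assumes S: "WS.subspace S"
  shows "WS.subspace (compl_closure B \<alpha> d S)"
proof (unfold WS.subspace_def, intro conjI ballI allI)
  show "0 \<in> compl_closure B \<alpha> d S"
    by (intro compl_closureI WS.subspace_0[OF subspace_compl_comp] WS.subspace_0[OF S])
next
  fix x y assume xy: "x \<in> compl_closure B \<alpha> d S" "y \<in> compl_closure B \<alpha> d S"
  have "\<exists>g\<in>S. x + y - g \<in> compl_nbhd B n \<alpha> d" for n
  proof -
    obtain g h where g: "g \<in> S" "x - g \<in> compl_nbhd B n \<alpha> d" "h \<in> S" "y - h \<in> compl_nbhd B n \<alpha> d"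
      using xy unfolding compl_closure_def by blast
    have "x + y - (g + h) = (x - g) + (y - h)" by simp
    then show ?thesis using g WS.subspace_add[OF S] WS.subspace_add[OF subspace_compl_nbhd] by metis
  qed
  then show "x + y \<in> compl_closure B \<alpha> d S"
    using xy WS.subspace_add[OF subspace_compl_comp] unfolding compl_closure_def by blast
next
  fix c x assume x: "x \<in> compl_closure B \<alpha> d S"
  have "\<exists>g\<in>S. wscale c x - g \<in> compl_nbhd B n \<alpha> d" for n
  proof -
    obtain g where g: "g \<in> S" "x - g \<in> compl_nbhd B n \<alpha> d"
      using x unfolding compl_closure_def by blast
    have "wscale c x - wscale c g = wscale c (x - g)" by (simp add: WS.scale_right_diff_distrib)
    then show ?thesis using g WS.subspace_scale[OF S] WS.subspace_scale[OF subspace_compl_nbhd] by metis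
  qed
  then show "wscale c x \<in> compl_closure B \<alpha> d S"
    using x WS.subspace_scale[OF subspace_compl_comp] unfolding compl_closure_def by blast
qed

text \<open>Every word fails to be bad at some depth, so it receives only finitely many
  contributions. Up to depth \<open>n\<close> the whole series agrees with a finite partial sum, and
  that sum can be approximated from \<open>S\<close>.\<close>

lemma compl_closure_convergent_sum:
  fixes g :: "'i \<Rightarrow> 'b word \<Rightarrow> 'k::field"
  assumes S: "WS.subspace S" and g: "\<And>x. x \<in> K \<Longrightarrow> g x \<in> compl_closure B \<alpha> d S"
    and conv: "\<And>n. finite {x. x \<in> K \<and> g x \<notin> compl_nbhd B n \<alpha> d}"
  shows "finite {x. x \<in> K \<and> g x w \<noteq> 0}"
    and "(\<lambda>w. \<Sum>x\<in>{x. x \<in> K \<and> g x w \<noteq> 0}. g x w) \<in> compl_closure B \<alpha> d S"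
proof -
  show fin: "finite {x. x \<in> K \<and> g x w \<noteq> 0}" for w
  proof -
    obtain n where n: "\<not> bad_word n w" using bad_word_bound by blast
    have "{x. x \<in> K \<and> g x w \<noteq> 0} \<subseteq> {x. x \<in> K \<and> g x \<notin> compl_nbhd B n \<alpha> d}"
      using n by (auto simp: compl_nbhd_iff)
    then show ?thesis using conv finite_subset by blast
  qed
  let ?G = "\<lambda>w. \<Sum>x\<in>{x. x \<in> K \<and> g x w \<noteq> 0}. g x w"
  have gc: "g x \<in> compl_comp B \<alpha> d" if "x \<in> K" for x using g[OF that] by (simp add: compl_closure_def)
  let ?A = "\<lambda>n. {x. x \<in> K \<and> g x \<notin> compl_nbhd B n \<alpha> d}"
  have part: "?G w = (\<Sum>x\<in>?A n. g x) w" if "\<not> bad_word n w" for n w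
  proof -
    have "(\<Sum>x\<in>?A n. g x) w = (\<Sum>x\<in>?A n. g x w)" by (rule sum_fun_apply)
    also have "\<dots> = ?G w"
      by (rule sum.mono_neutral_right) (use that conv gc in \<open>auto simp: compl_nbhd_iff\<close>)
    finally show ?thesis by simp
  qed
  have sc: "(\<Sum>x\<in>?A n. g x) \<in> compl_closure B \<alpha> d S" for n
    by (rule WS.subspace_sum[OF subspace_compl_closure[OF S]]) (use g in auto)
  then have scc: "(\<Sum>x\<in>?A n. g x) \<in> compl_comp B \<alpha> d" for n by (simp add: compl_closure_def)
  have Gc: "?G \<in> compl_comp B \<alpha> d"
  proof (rule compl_compI)
    fix w assume "?G w \<noteq> 0"
    then obtain x where "x \<in> K" "g x w \<noteq> 0" by (metis (mono_tags, lifting) mem_Collect_eq sum.neutral)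
    then show "w \<in> words_of_degree B \<alpha> d" using gc compl_compD(1) by blast
  next
    fix n
    have "{w. ?G w \<noteq> 0 \<and> \<not> bad_word n w} \<subseteq> {w. (\<Sum>x\<in>?A n. g x) w \<noteq> 0 \<and> \<not> bad_word n w}"
      using part by auto
    then show "finite {w. ?G w \<noteq> 0 \<and> \<not> bad_word n w}"
      using compl_compD(2)[OF scc] finite_subset by blast
  qed
  have "\<exists>h\<in>S. ?G - h \<in> compl_nbhd B n \<alpha> d" for n
  proof -
    obtain h where h: "h \<in> S" "(\<Sum>x\<in>?A n. g x) - h \<in> compl_nbhd B n \<alpha> d"
      using sc[of n] unfolding compl_closure_def by blast
    have "?G - (\<Sum>x\<in>?A n. g x) \<in> compl_nbhd B n \<alpha> d"
    proof (rule compl_nbhd_iff[THEN iffD2], intro conjI allI impI)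
      show "?G - (\<Sum>x\<in>?A n. g x) \<in> compl_comp B \<alpha> d"
        by (rule WS.subspace_diff[OF subspace_compl_comp Gc scc])
      fix w assume "(?G - (\<Sum>x\<in>?A n. g x)) w \<noteq> 0"
      then have "?G w \<noteq> (\<Sum>x\<in>?A n. g x) w" unfolding minus_apply right_minus_eq .
      then show "bad_word n w" using part by blast
    qed
    then have "?G - (\<Sum>x\<in>?A n. g x) + ((\<Sum>x\<in>?A n. g x) - h) \<in> compl_nbhd B n \<alpha> d"
      using WS.subspace_add[OF subspace_compl_nbhd] h(2) by blast
    then show ?thesis using h(1) by (intro bexI[of _ h]) simp_all
  qed
  then show "?G \<in> compl_closure B \<alpha> d S" using Gc by (simp add: compl_closure_def)
qed

lemma subspace_componentwise_closure:
  assumes S: "WS.subspace S"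
  shows "WS.subspace (componentwise_closure B S)"
proof -
  have "WS.subspace (compl_closure B \<alpha> d (S \<inter> compl_comp B \<alpha> d))" for \<alpha> d
    by (intro subspace_compl_closure WS.subspace_inter[OF S] subspace_compl_comp)
  then show ?thesis
    using subspace_compl_alg[of B]
    unfolding WS.subspace_def componentwise_closure_def by (auto simp: homog_part_add homog_part_scale)
qed

lemma componentwise_closure_comp:
  assumes "WS.subspace S" "f \<in> compl_comp B \<alpha> d"
  shows "f \<in> componentwise_closure B S \<longleftrightarrow> f \<in> compl_closure B \<alpha> d (S \<inter> compl_comp B \<alpha> d)"
proof -
  have "0 \<in> compl_closure B \<beta> e (S \<inter> compl_comp B \<beta> e)" for \<beta> e
    using subspace_compl_closure[OF WS.subspace_inter[OF assms(1) subspace_compl_comp]] WS.subspace_0 by blast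
  moreover have "f \<in> compl_alg B" using assms(2) compl_comp_subset_alg by blast
  ultimately show ?thesis
    unfolding componentwise_closure_def
    by (auto simp: homog_part_comp[OF assms(2)])
qed

lemma componentwise_closure_homog:
  "f \<in> componentwise_closure B S \<Longrightarrow> homog_part \<alpha> d f \<in> compl_closure B \<alpha> d (S \<inter> compl_comp B \<alpha> d)"
  by (simp add: componentwise_closure_def)

lemma compl_closure_wmult_left:
  assumes S: "\<And>x u. x \<in> compl_alg B \<Longrightarrow> u \<in> S \<Longrightarrow> wmult x u \<in> S"
    and x: "x \<in> compl_comp B \<alpha> d" and f: "f \<in> compl_closure B \<beta> e (S \<inter> compl_comp B \<beta> e)"
  shows "wmult x f \<in> compl_closure B (\<alpha> + \<beta>) (d + e) (S \<inter> compl_comp B (\<alpha> + \<beta>) (d + e))"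
  unfolding compl_closure_def
proof (intro CollectI conjI allI)
  show "wmult x f \<in> compl_comp B (\<alpha> + \<beta>) (d + e)"
    using f compl_comp_wmult[OF x] by (auto simp: compl_closure_def)
  fix n
  obtain g where g: "g \<in> S" "g \<in> compl_comp B \<beta> e" "f - g \<in> compl_nbhd B n \<beta> e"
    using f by (auto simp: compl_closure_def)
  have "wmult x f = wmult x (f - g) + wmult x g"
    by (simp flip: wmult_add_right)
  then have "wmult x f - wmult x g \<in> compl_nbhd B n (\<alpha> + \<beta>) (d + e)"
    using compl_nbhd_wmult_left[OF x g(3)] by simp
  moreover have "wmult x g \<in> S \<inter> compl_comp B (\<alpha> + \<beta>) (d + e)"
    using S x g compl_comp_subset_alg compl_comp_wmult[OF x] by blast
  ultimately show "\<exists>g\<in>S \<inter> compl_comp B (\<alpha> + \<beta>) (d + e). wmult x f - g \<in> compl_nbhd B n (\<alpha> + \<beta>) (d + e)"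
    by blast
qed

lemma componentwise_closure_wmult_left:
  assumes S: "WS.subspace S" "\<And>x u. x \<in> compl_alg B \<Longrightarrow> u \<in> S \<Longrightarrow> wmult x u \<in> S"
    and x: "x \<in> compl_comp B \<alpha> d" and f: "f \<in> componentwise_closure B S"
  shows "wmult x f \<in> componentwise_closure B S"
proof -
  have "f \<in> {f. wmult x f \<in> componentwise_closure B S}"
  proof (rule compl_alg_in_subspace)
    show "f \<in> compl_alg B" using f by (simp add: componentwise_closure_def)
    show "WS.subspace {f. wmult x f \<in> componentwise_closure B S}"
      using subspace_componentwise_closure[OF S(1), of B]
      unfolding WS.subspace_def by (auto simp: wmult_add_right wmult_scale_right)
    fix \<beta> e
    have "wmult x (homog_part \<beta> e f) \<in> compl_closure B (\<alpha> + \<beta>) (d + e) (S \<inter> compl_comp B (\<alpha> + \<beta>) (d + e))"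
      by (intro compl_closure_wmult_left[OF S(2) x] componentwise_closure_homog[OF f])
    then show "homog_part \<beta> e f \<in> {f. wmult x f \<in> componentwise_closure B S}"
      using componentwise_closure_comp[OF S(1)] by (fastforce simp: compl_closure_def)
  qed
  then show ?thesis by simp
qed

section \<open>Rewriting words by locality\<close>

text \<open>This is the biadditive extension of \<open>N\<close> at \<open>a\<close> and the charge
  of \<open>w\<close> (\<open>biadd_ext_charge_w\<close>), written so that it can be computed along
  the word.\<close>

definition pair_sum :: "('b \<Rightarrow> 'b \<Rightarrow> complex) \<Rightarrow> 'b \<Rightarrow> 'b word \<Rightarrow> complex" where
  "pair_sum N a w = (\<Sum>x\<leftarrow>w. N a (fst x))"

text \<open>
  The vector \<open>a\<^sub>1(n\<^sub>1)\<dots>a\<^sub>m(n\<^sub>m)|0>\<close> is a coefficient of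
  \<open>\<Prod> (z\<^sub>i - z\<^sub>j)^(- N a\<^sub>i a\<^sub>j)\<close> (over \<open>i < j\<close>) times a power series; the level is the total degree
  in that power series to which the mode numbers correspond.
\<close>

fun level :: "('b \<Rightarrow> 'b \<Rightarrow> complex) \<Rightarrow> 'b word \<Rightarrow> complex" where
  "level N [] = 0"
| "level N (x # w) = level N w - snd x - 1 + pair_sum N (fst x) w"

text \<open>The normal forms. Successive suffixes may have equal level; that the increments are
  natural numbers, and not just integers, forces the level of the whole word to be natural.\<close>

fun monotone_word :: "('b \<Rightarrow> 'b \<Rightarrow> complex) \<Rightarrow> 'b word \<Rightarrow> bool" where
  "monotone_word N [] \<longleftrightarrow> True"
| "monotone_word N (x # w) \<longleftrightarrow> monotone_word N w \<and> level N (x # w) - level N w \<in> \<nat>"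

lemma pair_sum_Nil [simp]: "pair_sum N a [] = 0"
  by (simp add: pair_sum_def)

lemma pair_sum_Cons [simp]: "pair_sum N a (x # w) = N a (fst x) + pair_sum N a w"
  by (simp add: pair_sum_def)

lemma pair_sum_mset: "pair_sum N a w = (\<Sum>b\<in>#mset (map fst w). N a b)"
  by (induction w) auto

lemma monotone_word_level: "monotone_word N w \<Longrightarrow> level N w \<in> \<nat>"
proof (induction w)
  case (Cons x w)
  then have "(level N (x # w) - level N w) + level N w \<in> \<nat>"
    by (intro Nats_add) (auto simp only: monotone_word.simps)
  then show ?case by (simp only: diff_add_cancel)
qed simp

text \<open>
  The terms with \<open>j \<ge> J\<close> of the series \<open>l(a,b,s,t) \<cdot> c\<close>, where \<open>M\<close> stands for \<open>N a b\<close> and \<open>p\<close> for the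
  factor in front of the second half.
\<close>

definition swap_rel ::
  "(complex \<Rightarrow> 'k::field) \<Rightarrow> complex \<Rightarrow> 'k \<Rightarrow> 'b \<Rightarrow> 'b \<Rightarrow> complex \<Rightarrow> complex \<Rightarrow> 'b word \<Rightarrow> nat \<Rightarrow> 'b word \<Rightarrow> 'k" where
  "swap_rel emb M p a b s t c J = (\<lambda>w.
     (\<Sum>j \<in> {j. J \<le> j \<and> w = (a, s + M - of_nat j) # (b, t + of_nat j) # c}. emb ((-1) ^ j * (M gchoose j)))
     - p * (\<Sum>j \<in> {j. J \<le> j \<and> w = (b, t + M - of_nat j) # (a, s + of_nat j) # c}. emb ((-1) ^ j * (M gchoose j))))"

text \<open>Injectivity leaves at most one index in the fibre, so removing the index
  \<open>J\<close> amounts to asking whether it is that one.\<close>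

lemma sum_fibre_step:
  assumes "inj W"
  shows "(\<Sum>j\<in>{j::nat. J \<le> j \<and> w = W j}. \<kappa> j)
    = (if w = W J then \<kappa> J else 0) + (\<Sum>j\<in>{j. Suc J \<le> j \<and> w = W j}. \<kappa> j :: 'a::comm_monoid_add)"
proof (cases "w = W J")
  case True
  then have sets: "{j. J \<le> j \<and> w = W j} = {J}" "{j. Suc J \<le> j \<and> w = W j} = {}"
    using injD[OF assms] by force+
  show ?thesis unfolding sets using True by simp
next
  case False
  then have "J \<le> j \<and> w = W j \<longleftrightarrow> Suc J \<le> j \<and> w = W j" for j
    by (cases "j = J") auto
  then have "{j. J \<le> j \<and> w = W j} = {j. Suc J \<le> j \<and> w = W j}" by simp
  then show ?thesis using False by simp
qed

lemma swap_rel_step: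
  fixes emb :: "complex \<Rightarrow> 'k::field" and a b :: 'b
  shows "swap_rel emb M p a b s t c J =
     wscale (emb ((-1) ^ J * (M gchoose J))) (monom_w ((a, s + M - of_nat J) # (b, t + of_nat J) # c))
     - wscale (p * emb ((-1) ^ J * (M gchoose J))) (monom_w ((b, t + M - of_nat J) # (a, s + of_nat J) # c))
     + swap_rel emb M p a b s t c (Suc J)"
proof
  fix w :: "'b word"
  have inj: "inj (\<lambda>j::nat. (a, s + M - of_nat j) # (b, t + of_nat j) # c)" for a b s t
    by (rule injI) simp
  have scale_monom: "wscale x (monom_w u) w = x * (if w = u then 1 else 0)" for x :: 'k and u :: "'b word"
    by (simp add: wscale_def monom_w_def)
  have if_mult: "(if Q then x else 0) = x * (if Q then 1 else 0)" for x :: 'k and Q by simp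
  have ring: "x * u + S1 - p * (x * v + S2) = x * u - p * x * v + (S1 - p * S2)" for x u v S1 S2 :: 'k
    by (simp add: algebra_simps)
  show "swap_rel emb M p a b s t c J w =
    (wscale (emb ((-1) ^ J * (M gchoose J))) (monom_w ((a, s + M - of_nat J) # (b, t + of_nat J) # c))
     - wscale (p * emb ((-1) ^ J * (M gchoose J))) (monom_w ((b, t + M - of_nat J) # (a, s + of_nat J) # c))
     + swap_rel emb M p a b s t c (Suc J)) w"
    unfolding swap_rel_def sum_fibre_step[where J = J, OF inj[of a s b t]]
      sum_fibre_step[where J = J, OF inj[of b t a s]]
    unfolding plus_fun_apply minus_apply scale_monom
    by (subst (1 2) if_mult) (rule ring)
qed

lemma swap_rel_sum:
  "swap_rel emb M p a b s t c 0 = (\<Sum>j<J.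
     wscale (emb ((-1) ^ j * (M gchoose j))) (monom_w ((a, s + M - of_nat j) # (b, t + of_nat j) # c))
     - wscale (p * emb ((-1) ^ j * (M gchoose j))) (monom_w ((b, t + M - of_nat j) # (a, s + of_nat j) # c)))
     + swap_rel emb M p a b s t c J"
proof (induction J)
  case (Suc J)
  show ?case unfolding sum.lessThan_Suc Suc.IH by (subst swap_rel_step) (simp only: add.assoc)
qed (simp only: lessThan_0 sum.empty add_0)

lemma swap_rel_nonzero:
  assumes "swap_rel emb M p a b s t c J w \<noteq> 0"
  shows "\<exists>j\<ge>J. w = (a, s + M - of_nat j) # (b, t + of_nat j) # c
    \<or> w = (b, t + M - of_nat j) # (a, s + of_nat j) # c"
proof (rule ccontr)
  assume "\<not> ?thesis"
  then have *: "{j. J \<le> j \<and> w = (a, s + M - of_nat j) # (b, t + of_nat j) # c} = {}"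
    "{j. J \<le> j \<and> w = (b, t + M - of_nat j) # (a, s + of_nat j) # c} = {}" by auto
  show False using assms unfolding swap_rel_def * by simp
qed

text \<open>The relation in the context \<open>c\<close> is a right multiple of the relation without
  context; this is how it enters the two-sided ideal of locality.\<close>

lemma swap_rel_wmult:
  "swap_rel emb M p a b s t c J = wmult (swap_rel emb M p a b s t [] J) (monom_w c)"
proof
  fix w
  have eq: "w = x # y # c \<longleftrightarrow> drop (length w - length c) w = c \<and> take (length w - length c) w = [x, y]" for x y
    by (metis append_Cons append_Nil append_eq_conv_conj append_take_drop_id diff_add_inverse2 length_append)
  show "swap_rel emb M p a b s t c J w = wmult (swap_rel emb M p a b s t [] J) (monom_w c) w"
    unfolding wmult_monom_right swap_rel_def eq by auto
qed

text \<open>The closure properties common to the relations of the free algebra and the kernel of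
  evaluation. The series in \<open>swap_tail\<close> is infinite, so its membership does not follow
  from \<open>subspace\<close> and \<open>letter\<close>, although every single word in it lies in
  \<open>Z\<close>. The factor \<open>p\<close> is arbitrary, because only the shape of the swap
  matters for the rewriting.\<close>

locale word_rewriting =
  fixes emb :: "complex \<Rightarrow> 'k::field" and N :: "'b \<Rightarrow> 'b \<Rightarrow> complex" and p :: "'b \<Rightarrow> 'b \<Rightarrow> 'k"
    and B :: "'b set" and Z :: "('b word \<Rightarrow> 'k) set"
  assumes emb_one: "emb 1 = 1"
    and N_sym: "\<And>a b. a \<in> B \<Longrightarrow> b \<in> B \<Longrightarrow> N a b = N b a"
    and subspace: "WS.subspace Z"
    and letter: "\<And>a n f. a \<in> B \<Longrightarrow> f \<in> Z \<Longrightarrow> wmult (monom_w [(a, n)]) f \<in> Z"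
    and vacuum: "\<And>a n. a \<in> B \<Longrightarrow> - n - 1 \<notin> \<nat> \<Longrightarrow> monom_w [(a, n)] \<in> Z"
    and charge: "\<And>a n w. a \<in> B \<Longrightarrow> w \<in> lists (B \<times> UNIV) \<Longrightarrow> w \<noteq> [] \<Longrightarrow> pair_sum N a w - n \<notin> \<int>
      \<Longrightarrow> monom_w ((a, n) # w) \<in> Z"
    and swap: "\<And>a b s t c. a \<in> B \<Longrightarrow> b \<in> B \<Longrightarrow> c \<in> lists (B \<times> UNIV)
      \<Longrightarrow> swap_rel emb (N a b) (p a b) a b s t c 0 \<in> Z"
    and swap_tail: "\<And>a b s t c J. a \<in> B \<Longrightarrow> b \<in> B \<Longrightarrow> c \<in> lists (B \<times> UNIV)
      \<Longrightarrow> (\<And>j. J \<le> j \<Longrightarrow> monom_w ((b, t + of_nat j) # c) \<in> Z)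
      \<Longrightarrow> (\<And>j. J \<le> j \<Longrightarrow> monom_w ((a, s + of_nat j) # c) \<in> Z)
      \<Longrightarrow> swap_rel emb (N a b) (p a b) a b s t c J \<in> Z"
begin

text \<open>A swap permutes the letters and, \<open>N\<close> being symmetric, keeps the level.
  These two invariants tie a word to its normal forms.\<close>

definition normal_words :: "'b word \<Rightarrow> 'b word set" where
  "normal_words w = {v \<in> lists (B \<times> UNIV). monotone_word N v \<and>
     mset (map fst v) = mset (map fst w) \<and> level N v = level N w}"

definition reducible :: "'b word \<Rightarrow> bool" where
  "reducible w \<longleftrightarrow> monom_w w \<in> WS.span (monom_w ` normal_words w \<union> Z)"

lemma normal_words_eq:
  "mset (map fst v) = mset (map fst w) \<Longrightarrow> level N v = level N w \<Longrightarrow> normal_words v = normal_words w"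
  by (simp add: normal_words_def)

lemma normal_wordsD:
  assumes "v \<in> normal_words w"
  shows "v \<in> lists (B \<times> UNIV)" "monotone_word N v" "length v = length w" "level N v = level N w"
    "\<exists>k. level N v = of_nat k"
proof -
  show "v \<in> lists (B \<times> UNIV)" and mono: "monotone_word N v" and "level N v = level N w"
    using assms by (auto simp: normal_words_def)
  have "mset (map fst v) = mset (map fst w)" using assms by (simp add: normal_words_def)
  then have "length (map fst v) = length (map fst w)" by (rule mset_eq_length)
  then show "length v = length w" by simp
  show "\<exists>k. level N v = of_nat k" using monotone_word_level[OF mono] by (auto elim: Nats_cases)
qed

lemma reducible_Z: "monom_w w \<in> Z \<Longrightarrow> reducible w"
  unfolding reducible_def by (rule WS.span_base) blast

lemma reducible_monotone: "w \<in> lists (B \<times> UNIV) \<Longrightarrow> monotone_word N w \<Longrightarrow> reducible w"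
  unfolding reducible_def by (rule WS.span_base) (simp add: normal_words_def)

text \<open>Normal forms have natural level, so a word of any other level has nothing to reduce to
  outside \<open>Z\<close>.\<close>

lemma reducible_level:
  assumes "reducible w" "level N w \<notin> \<nat>"
  shows "monom_w w \<in> Z"
proof -
  have "normal_words w = {}"
    using assms(2) monotone_word_level by (fastforce simp: normal_words_def)
  then have "monom_w w \<in> WS.span Z" using assms(1) by (simp add: reducible_def)
  then show ?thesis using WS.span_minimal[OF subset_refl subspace] by blast
qed

text \<open>Left multiplication by a letter preserves \<open>Z\<close> and sends normal forms of
  \<open>u\<close> to words with the same letters and level as the target. Therefore only tails in
  normal form have to be treated.\<close>

lemma reducible_Cons:
  assumes a: "a \<in> B" and red: "reducible u"
    and words: "\<And>v. v \<in> normal_words u \<Longrightarrow> reducible ((a, n) # v)"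
  shows "reducible ((a, n) # u)"
proof -
  let ?H = "WS.span (monom_w ` normal_words ((a, n) # u) \<union> Z)"
  let ?S = "{f. wmult (monom_w [(a, n)]) f \<in> ?H}"
  have "WS.subspace ?S"
    using WS.subspace_span unfolding WS.subspace_def
    by (auto simp: wmult_add_right wmult_scale_right)
  moreover have "monom_w v \<in> ?S" if v: "v \<in> normal_words u" for v
  proof -
    have "normal_words ((a, n) # v) = normal_words ((a, n) # u)"
      using v by (intro normal_words_eq) (auto simp: normal_words_def pair_sum_mset)
    then show ?thesis using words[OF v] by (simp add: reducible_def wmult_monom)
  qed
  moreover have "Z \<subseteq> ?S" using letter[OF a] by (auto intro!: WS.span_base)
  ultimately have "WS.span (monom_w ` normal_words u \<union> Z) \<subseteq> ?S"
    by (intro WS.span_minimal) auto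
  then have "monom_w u \<in> ?S" using red unfolding reducible_def by blast
  then show ?thesis by (simp add: reducible_def wmult_monom)
qed

text \<open>
  If the level of \<open>(a, n) # (b, t) # c\<close> is below that of \<open>(b, t) # c\<close>, locality replaces the word by
  words whose tails all have smaller level than \<open>(b, t) # c\<close>.
\<close>

lemma reducible_Cons_monotone:
  assumes short: "\<And>u. u \<in> lists (B \<times> UNIV) \<Longrightarrow> length u = m \<Longrightarrow> reducible u"
  shows "a \<in> B \<Longrightarrow> v \<in> lists (B \<times> UNIV) \<Longrightarrow> length v = m \<Longrightarrow> monotone_word N v \<Longrightarrow> level N v = of_nat k
    \<Longrightarrow> reducible ((a, n) # v)"
proof (induction k arbitrary: a n v rule: less_induct)
  case (less k a n v)
  show ?case
  proof (cases v)
    case Nil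
    then show ?thesis
      using less.prems vacuum[of a n] reducible_Z reducible_monotone[of "[(a, n)]"]
      by (cases "- n - 1 \<in> \<nat>") auto
  next
    case (Cons x c)
    obtain b t where x: "x = (b, t)" by (cases x)
    have v: "v = (b, t) # c" using Cons x by simp
    have b: "b \<in> B" and c: "c \<in> lists (B \<times> UNIV)" using less.prems(2) v by auto
    \<comment> \<open>\<open>?D\<close> is the increment of level caused by the first letter. If it
      is natural, the word is already normal; if it is not an integer, the word lies in
      \<open>Z\<close> by \<open>charge\<close>; what remains is a negative integer.\<close>
    let ?D = "level N ((a, n) # v) - level N v"
    consider "?D \<in> \<nat>" | "pair_sum N a v - n \<notin> \<int>" | "?D \<notin> \<nat>" "pair_sum N a v - n \<in> \<int>" by blast
    then show ?thesis
    proof cases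
      case 1
      then show ?thesis using less.prems by (intro reducible_monotone) auto
    next
      case 2
      then show ?thesis using less.prems v by (intro reducible_Z charge) auto
    next
      case 3
      have "?D = (pair_sum N a v - n) - 1" by simp
      then have "?D \<in> \<int>" using 3(2) by (metis Ints_1 Ints_diff)
      then obtain D where D: "?D = of_int D" by (elim Ints_cases)
      have "D < 0"
      proof (rule ccontr)
        assume "\<not> D < 0"
        then have "?D = of_nat (nat D)" using D by simp
        then show False using 3(1) by simp
      qed
      \<comment> \<open>With this \<open>s\<close> the term \<open>j = 0\<close> in the first half
        of the relation is the given word.\<close>
      define s where "s = n - N a b"
      let ?W1 = "\<lambda>j. (a, s + N a b - of_nat j) # (b, t + of_nat j) # c"
      let ?W2 = "\<lambda>j. (b, t + N a b - of_nat j) # (a, s + of_nat j) # c"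
      let ?w = "(a, n) # v"
      let ?H = "WS.span (monom_w ` normal_words ?w \<union> Z)"
      have W10: "?W1 0 = ?w" by (simp add: s_def v)
      have "monotone_word N c" "level N v - level N c \<in> \<nat>" using less.prems(4) v by auto
      then obtain i i' where i: "level N c = of_nat i" "level N v - level N c = of_nat i'"
        unfolding Nats_def using monotone_word_level[of N c, unfolded Nats_def] by blast
      have "(of_nat (i + i') :: complex) = of_nat k" using i less.prems(5) by (simp add: algebra_simps)
      then have ik: "i \<le> k" unfolding of_nat_eq_iff by simp
      \<comment> \<open>The levels of the tails in the two halves are \<open>k - j\<close> and
        \<open>i + D - j\<close>. As \<open>i \<le> k\<close> and \<open>D < 0\<close>, all are
        below \<open>k\<close>, except in the first half at \<open>j = 0\<close>, which is the word
        to be reduced.\<close>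
      have lev1: "level N ((b, t + of_nat j) # c) = of_nat k - of_nat j" for j
        using less.prems(5) v by (simp add: algebra_simps)
      have lev2: "level N ((a, s + of_nat j) # c) = of_nat i + of_int D - of_nat j" for j
        using D v by (simp add: s_def i(1)[symmetric] algebra_simps)
      have red1: "reducible ((b, t + of_nat j) # c)" for j
        using short b c less.prems(3) v by simp
      have red2: "reducible ((a, s + of_nat j) # c)" for j
        using short less.prems(1) c less.prems(3) v by simp
      have nw1: "normal_words (?W1 j) = normal_words ?w" for j
        by (rule normal_words_eq) (auto simp: v s_def algebra_simps)
      have nw2: "normal_words (?W2 j) = normal_words ?w" for j
        by (rule normal_words_eq) (auto simp: v s_def algebra_simps N_sym[OF b less.prems(1)])
      have H1: "monom_w (?W1 j) \<in> ?H" if j: "1 \<le> j" for j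
      proof -
        have "reducible (?W1 j)"
        proof (rule reducible_Cons[OF less.prems(1) red1])
          fix v' assume v': "v' \<in> normal_words ((b, t + of_nat j) # c)"
          have "length v' = m" using normal_wordsD(3)[OF v'] less.prems(3) v by simp
          moreover obtain k' where k': "level N v' = of_nat k'" using normal_wordsD(5)[OF v'] by blast
          then have "of_nat (k' + j) = (of_nat k :: complex)"
            using normal_wordsD(4)[OF v'] lev1[of j] by simp
          then have "k' + j = k" unfolding of_nat_eq_iff .
          then have "k' < k" using j by simp
          ultimately show "reducible ((a, s + N a b - of_nat j) # v')"
            using less.IH[of k' a v'] less.prems(1) normal_wordsD(1,2)[OF v'] k' by blast
        qed
        then show ?thesis unfolding reducible_def nw1 .
      qed
      have H2: "monom_w (?W2 j) \<in> ?H" for j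
      proof -
        have "reducible (?W2 j)"
        proof (rule reducible_Cons[OF b red2])
          fix v' assume v': "v' \<in> normal_words ((a, s + of_nat j) # c)"
          have "length v' = m" using normal_wordsD(3)[OF v'] less.prems(3) v by simp
          moreover obtain k' where k': "level N v' = of_nat k'" using normal_wordsD(5)[OF v'] by blast
          then have "(of_int (int k' + int j) :: complex) = of_int (int i + D)"
            using normal_wordsD(4)[OF v'] lev2[of j] by simp
          then have "int k' + int j = int i + D" by (simp only: of_int_eq_iff)
          then have "k' < k" using \<open>D < 0\<close> ik by linarith
          ultimately show "reducible ((b, t + N a b - of_nat j) # v')"
            using less.IH[of k' b v'] b normal_wordsD(1,2)[OF v'] k' by blast
        qed
        then show ?thesis unfolding reducible_def nw2 .
      qed
      \<comment> \<open>Tails past the index \<open>k\<close> have negative level, so they lie in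
        \<open>Z\<close> by the hypothesis on shorter words. This is what \<open>swap_tail\<close>
        asks for.\<close>
      have Z1: "monom_w ((b, t + of_nat j) # c) \<in> Z" if "Suc k \<le> j" for j
      proof (rule reducible_level[OF red1])
        show "level N ((b, t + of_nat j) # c) \<notin> \<nat>"
        proof
          assume "level N ((b, t + of_nat j) # c) \<in> \<nat>"
          then obtain l where "level N ((b, t + of_nat j) # c) = of_nat l" by (elim Nats_cases)
          then have "of_nat (l + j) = (of_nat k :: complex)" unfolding lev1 by (simp add: algebra_simps)
          then have "l + j = k" unfolding of_nat_eq_iff .
          then show False using that by simp
        qed
      qed
      have Z2: "monom_w ((a, s + of_nat j) # c) \<in> Z" if "Suc k \<le> j" for j
      proof (rule reducible_level[OF red2])
        show "level N ((a, s + of_nat j) # c) \<notin> \<nat>"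
        proof
          assume "level N ((a, s + of_nat j) # c) \<in> \<nat>"
          then obtain l where "level N ((a, s + of_nat j) # c) = of_nat l" by (elim Nats_cases)
          then have "(of_int (int l + int j) :: complex) = of_int (int i + D)"
            unfolding lev2 by (simp add: algebra_simps)
          then have "int l + int j = int i + D" by (simp only: of_int_eq_iff)
          then show False using that ik \<open>D < 0\<close> by linarith
        qed
      qed
      let ?R = "swap_rel emb (N a b) (p a b) a b s t c"
      let ?t = "\<lambda>j. wscale (emb ((-1) ^ j * (N a b gchoose j))) (monom_w (?W1 j))
        - wscale (p a b * emb ((-1) ^ j * (N a b gchoose j))) (monom_w (?W2 j))"
      have sub: "WS.subspace ?H" by (rule WS.subspace_span)
      have ZH: "Z \<subseteq> ?H" by (auto intro!: WS.span_base)
      have "?R 0 \<in> ?H" using swap[OF less.prems(1) b c] ZH by blast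
      moreover have "?R (Suc k) \<in> ?H" using swap_tail[OF less.prems(1) b c Z1 Z2] ZH by blast
      moreover have tj: "?t j \<in> ?H" if "1 \<le> j" for j
        using H1[OF that] H2 by (intro WS.subspace_diff[OF sub] WS.subspace_scale[OF sub])
      then have "(\<Sum>j<k. ?t (Suc j)) \<in> ?H" by (intro WS.subspace_sum[OF sub] tj) simp
      moreover have "?t 0 = monom_w ?w - wscale (p a b) (monom_w (?W2 0))"
        using emb_one by (simp add: s_def v)
      \<comment> \<open>The relation, cut off after the index \<open>k\<close>, is solved for its
        leading word, whose coefficient is the binomial coefficient 1 at
        \<open>j = 0\<close>.\<close>
      then have "monom_w ?w = ?R 0 - ?R (Suc k) - (\<Sum>j<k. ?t (Suc j)) + wscale (p a b) (monom_w (?W2 0))"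
        unfolding swap_rel_sum[of emb "N a b" "p a b" a b s t c "Suc k"] sum.lessThan_Suc_shift
        by (simp add: algebra_simps)
      ultimately have "monom_w ?w \<in> ?H"
        using WS.subspace_add[OF sub WS.subspace_diff[OF sub WS.subspace_diff[OF sub]] WS.subspace_scale[OF sub H2[of 0]]]
        by (simp only:)
      then show ?thesis by (simp add: reducible_def)
    qed
  qed
qed

text \<open>Two nested inductions: here on the length, which turns the tail into normal forms, and
  inside \<open>reducible_Cons_monotone\<close> on the level of such a tail.\<close>

lemma reducible_word: "w \<in> lists (B \<times> UNIV) \<Longrightarrow> reducible w"
proof (induction "length w" arbitrary: w rule: less_induct)
  case (less w)
  show ?case
  proof (cases w)
    case Nil
    then show ?thesis by (intro reducible_monotone) auto
  next
    case (Cons x u)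
    obtain a n where x: "x = (a, n)" by (cases x)
    have a: "a \<in> B" and u: "u \<in> lists (B \<times> UNIV)" using less.prems Cons x by auto
    have "reducible ((a, n) # u)"
    proof (rule reducible_Cons[OF a])
      show "reducible u" using less.hyps[of u] Cons u by simp
      fix v assume v: "v \<in> normal_words u"
      then obtain k where "level N v = of_nat k" using normal_wordsD(5) by blast
      then show "reducible ((a, n) # v)"
        using less.hyps Cons a normal_wordsD(1-3)[OF v]
        by (intro reducible_Cons_monotone[where m = "length u" and k = k]) auto
    qed
    then show ?thesis using Cons x by simp
  qed
qed

theorem level_not_nat: "w \<in> lists (B \<times> UNIV) \<Longrightarrow> level N w \<notin> \<nat> \<Longrightarrow> monom_w w \<in> Z"
  by (intro reducible_level reducible_word)

end

section \<open>Words of very negative weight\<close>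

lemma lookup_charge_w: "Poly_Mapping.lookup (charge_w w) a = int (count (mset (map fst w)) a)"
  by (induction w) (auto simp: lookup_add)

text \<open>A letter with mode -1 has weight 0, so the word with all modes set to -1 has as its
  level just the sum of \<open>N\<close> over pairs of letters. Level minus weight thus depends only
  on the letters and their order.\<close>

lemma level_weight: "level N w = weight_w w + level N (map (\<lambda>x. (fst x, -1)) w)"
proof -
  have "pair_sum N a (map (\<lambda>x. (fst x, -1)) w) = pair_sum N a w" for a and w :: "'a word"
    by (simp add: pair_sum_def o_def)
  then show ?thesis by (induction w) (auto simp: algebra_simps)
qed

text \<open>
  A charge determines the letters of a word up to order, hence leaves only finitely many
  differences between level and weight.
\<close>

lemma low_weight_level:
  "\<exists>n. \<forall>(w :: 'b word) i. charge_w w = \<alpha> \<longrightarrow> Re (weight_w (drop i w)) \<le> - real n - 1 \<longrightarrow> level N (drop i w) \<notin> \<nat>"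
proof (cases "\<exists>w :: 'b word. charge_w w = \<alpha>")
  case True
  then obtain w0 :: "'b word" where w0: "charge_w w0 = \<alpha>" by blast
  let ?u = "\<lambda>w :: 'b word. map (\<lambda>x. (fst x, -1 :: complex)) w"
  \<comment> \<open>A finite set containing the letter sequence of every word of this charge; its
    members need not all be rearrangements of the letters of \<open>w0\<close>.\<close>
  let ?L = "{l. set l \<subseteq> set (map fst w0) \<and> length l = length w0}"
  let ?Q = "(\<lambda>(l, i). norm (level N (drop i (map (\<lambda>a. (a, -1)) l)))) ` (?L \<times> {..length w0})"
  have fin: "finite ?Q" by (intro finite_imageI finite_cartesian_product finite_lists_length_eq) auto
  define n where "n = nat \<lceil>Max (insert 0 ?Q)\<rceil>"
  have n: "q \<le> real n" if "q \<in> ?Q" for q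
  proof -
    have "q \<le> Max (insert 0 ?Q)" by (rule Max_ge) (use fin that in auto)
    then show ?thesis unfolding n_def by linarith
  qed
  have "level N (drop i w) \<notin> \<nat>" if w: "charge_w w = \<alpha>" "Re (weight_w (drop i w)) \<le> - real n - 1" for w i
  proof -
    have "mset (map fst w) = mset (map fst w0)"
    proof (rule multiset_eqI)
      fix a
      have "int (count (mset (map fst w)) a) = int (count (mset (map fst w0)) a)"
        unfolding lookup_charge_w[symmetric] w(1) w0 ..
      then show "count (mset (map fst w)) a = count (mset (map fst w0)) a" by simp
    qed
    then have "set (map fst w) = set (map fst w0)" "length (map fst w) = length w0"
      by (rule mset_eq_setD, metis length_map mset_eq_length)
    then have L: "map fst w \<in> ?L" and len: "length w = length w0" by auto
    define i' where "i' = min i (length w)"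
    have di: "drop i w = drop i' w" by (simp add: i'_def min_def)
    have "norm (level N (drop i' (map (\<lambda>a. (a, -1)) (map fst w)))) \<in> ?Q"
      using L len by (intro image_eqI[where x = "(map fst w, i')"]) (auto simp: i'_def)
    then have "norm (level N (?u (drop i w))) \<le> real n"
      using n unfolding di by (simp add: drop_map o_def)
    then have "Re (level N (?u (drop i w))) \<le> real n" using complex_Re_le_cmod order_trans by blast
    then have "Re (level N (drop i w)) < 0"
      unfolding level_weight[of N "drop i w"] using w(2) by simp
    then show ?thesis by (auto elim!: Nats_cases)
  qed
  then show ?thesis by blast
qed simp

section \<open>The relations of the free generalized vertex algebra\<close>

lemma complex_subfieldD:
  assumes "complex_subfield emb"
  shows "emb 1 = 1" "emb (x + y) = emb x + emb y" "emb (x * y) = emb x * emb y" "emb 0 = 0"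
    "emb (- x) = - emb x" "emb x = 0 \<longleftrightarrow> x = 0"
proof -
  show one: "emb 1 = 1" and add: "emb (x + y) = emb x + emb y" and mult: "emb (x * y) = emb x * emb y" for x y
    using assms by (simp_all add: complex_subfield_def ring_hom_def ring_of_type_algebra_def)
  have "emb 0 + emb 0 = emb 0 + 0" by (simp flip: add)
  then show zero: "emb 0 = 0" by (rule add_left_imp_eq)
  have "emb x + emb (- x) = 0" by (simp add: zero flip: add)
  then show "emb (- x) = - emb x" by (simp add: eq_neg_iff_add_eq_0 add.commute)
  show "emb x = 0 \<longleftrightarrow> x = 0"
  proof
    assume "emb x = 0"
    show "x = 0"
    proof (rule ccontr)
      assume "x \<noteq> 0"
      then have "emb x * emb (inverse x) = 1" by (simp add: one flip: mult)
      then show False using \<open>emb x = 0\<close> by simp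
    qed
  qed (simp add: zero)
qed

lemma biadd_ext_frag_of:
  assumes "finite K" "Poly_Mapping.keys \<beta> \<subseteq> K"
  shows "biadd_ext N (frag_of a) \<beta> = (\<Sum>b\<in>K. of_int (Poly_Mapping.lookup \<beta> b) * N a b)"
  unfolding biadd_ext_def
  using assms by (auto simp: not_in_keys_iff_lookup_eq_zero intro!: sum.mono_neutral_left)

lemma biadd_ext_charge_w: "biadd_ext N (frag_of a) (charge_w w) = pair_sum N a w"
proof (induction w)
  case (Cons x w)
  let ?K = "insert (fst x) (Poly_Mapping.keys (charge_w w) \<union> Poly_Mapping.keys (charge_w (x # w)))"
  have "biadd_ext N (frag_of a) (charge_w (x # w))
      = (\<Sum>b\<in>?K. of_int (Poly_Mapping.lookup (charge_w (x # w)) b) * N a b)"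
    by (rule biadd_ext_frag_of) auto
  also have "\<dots> = (\<Sum>b\<in>?K. if b = fst x then N a b else 0) + (\<Sum>b\<in>?K. of_int (Poly_Mapping.lookup (charge_w w) b) * N a b)"
    unfolding sum.distrib[symmetric]
    by (rule sum.cong) (auto simp: lookup_add algebra_simps)
  also have "(\<Sum>b\<in>?K. of_int (Poly_Mapping.lookup (charge_w w) b) * N a b) = biadd_ext N (frag_of a) (charge_w w)"
    by (rule biadd_ext_frag_of[symmetric]) auto
  also have "(\<Sum>b\<in>?K. if b = fst x then N a b else 0) = N a (fst x)"
    by (subst sum.delta) auto
  finally show ?case using Cons.IH by simp
qed (simp add: biadd_ext_def)

lemma not_in_coset_iff: "n \<notin> c +o \<int> \<longleftrightarrow> c - n \<notin> \<int>" for n c :: complex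
proof -
  have "n \<in> c +o \<int> \<longleftrightarrow> n - c \<in> \<int>" by (auto simp: elt_set_plus_def intro: bexI[of _ "n - c"])
  then show ?thesis by (metis Ints_minus minus_diff_eq)
qed

lemma finite_low_weight_tails:
  assumes "inj W" "\<And>j. Re (weight_w (drop 1 (W j))) = r - real j"
  shows "finite {j. \<not> Re (weight_w (drop 1 (W j))) \<le> - real n - 1}"
proof (rule finite_subset)
  show "{j. \<not> Re (weight_w (drop 1 (W j))) \<le> - real n - 1} \<subseteq> {..nat \<lceil>r + real n + 1\<rceil>}"
    using assms(2) by (auto simp: le_nat_iff) linarith
qed simp

text \<open>Convergence is measured on the suffix after the first letter: it carries the growing
  mode, and it is the suffix known to be a relation when \<open>free_relations_convergent\<close> is
  applied.\<close>

lemma swap_rel_tails: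
  "finite {w. swap_rel emb M p a b s t c J w \<noteq> 0 \<and> \<not> Re (weight_w (drop 1 w)) \<le> - real n - 1}"
proof -
  let ?W1 = "\<lambda>j::nat. (a, s + M - of_nat j) # (b, t + of_nat j) # c"
  let ?W2 = "\<lambda>j::nat. (b, t + M - of_nat j) # (a, s + of_nat j) # c"
  let ?A = "\<lambda>W. {j::nat. \<not> Re (weight_w (drop 1 (W j))) \<le> - real n - 1}"
  have inj: "inj ?W1" "inj ?W2" by (auto intro!: injI)
  have "finite (?A ?W1)"
    by (rule finite_low_weight_tails[OF inj(1), where r = "- Re t - 1 + Re (weight_w c)"]) simp
  moreover have "finite (?A ?W2)"
    by (rule finite_low_weight_tails[OF inj(2), where r = "- Re s - 1 + Re (weight_w c)"]) simp
  moreover have "{w. swap_rel emb M p a b s t c J w \<noteq> 0 \<and> \<not> Re (weight_w (drop 1 w)) \<le> - real n - 1}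
      \<subseteq> ?W1 ` ?A ?W1 \<union> ?W2 ` ?A ?W2"
    using swap_rel_nonzero[of emb M p a b s t c J] by blast
  ultimately show ?thesis by (meson finite_UnI finite_imageI finite_subset)
qed

lemma swap_rel_comp:
  fixes a b :: 'a
  assumes "a \<in> B" "b \<in> B" "c \<in> lists (B \<times> UNIV)"
  shows "swap_rel emb M p a b s t c J
    \<in> compl_comp B (frag_of a + frag_of b + charge_w c) (- s - t - M - 2 + weight_w c)"
proof (rule compl_compI)
  fix w assume "swap_rel emb M p a b s t c J w \<noteq> 0"
  then obtain j where "w = (a, s + M - of_nat j) # (b, t + of_nat j) # c \<or> w = (b, t + M - of_nat j) # (a, s + of_nat j) # c"
    using swap_rel_nonzero[OF \<open>swap_rel emb M p a b s t c J w \<noteq> 0\<close>] by auto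
  then show "w \<in> words_of_degree B (frag_of a + frag_of b + charge_w c) (- s - t - M - 2 + weight_w c)"
    using assms by (elim disjE) (simp_all add: words_of_degree_def algebra_simps)
next
  fix n
  have bad: "bad_word n w" if "w \<noteq> []" "Re (weight_w (drop 1 w)) \<le> - real n - 1" for w :: "'a word"
    using that unfolding bad_word_def by (intro exI[of _ 1]) (auto simp: Suc_le_eq)
  have nonempty: "w \<noteq> []" if "swap_rel emb M p a b s t c J w \<noteq> 0" for w
    using swap_rel_nonzero[OF that] by (metis list.distinct(1))
  have "{w. swap_rel emb M p a b s t c J w \<noteq> 0 \<and> \<not> bad_word n w}
      \<subseteq> {w. swap_rel emb M p a b s t c J w \<noteq> 0 \<and> \<not> Re (weight_w (drop 1 w)) \<le> - real n - 1}"
    using bad nonempty by blast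
  then show "finite {w. swap_rel emb M p a b s t c J w \<noteq> 0 \<and> \<not> bad_word n w}"
    by (rule finite_subset[OF _ swap_rel_tails])
qed

section \<open>The ideals of locality and vacuum relations\<close>

abbreviation local_factor ::
  "(complex \<Rightarrow> 'k::field) \<Rightarrow> ('b \<Rightarrow> 'b \<Rightarrow> complex) \<Rightarrow> (('b \<Rightarrow>\<^sub>0 int) \<Rightarrow> ('b \<Rightarrow>\<^sub>0 int) \<Rightarrow> complex) \<Rightarrow> 'b \<Rightarrow> 'b \<Rightarrow> 'k" where
  "local_factor emb N \<eta> a b \<equiv> emb (\<eta> (frag_of a) (frag_of b) * exp (of_real pi * \<i> * N a b))"

lemma local_rel_swap_rel: "local_rel emb N \<eta> a b s t = swap_rel emb (N a b) (local_factor emb N \<eta> a b) a b s t [] 0"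
  unfolding local_rel_def swap_rel_def by simp

text \<open>Left ideals are required to lie in the completion, so the intersection defining the hull
  is one only because at least one ideal contains \<open>S\<close>; the whole completion
  does.\<close>

lemma compl_left_ideal_hull:
  assumes "S \<subseteq> compl_alg B"
  shows "compl_left_ideal B (compl_left_ideal B hull S)"
proof -
  have "compl_left_ideal B (compl_alg B)"
    by (simp add: compl_left_ideal_def subspace_compl_alg compl_alg_wmult)
  then have "compl_left_ideal B hull S \<subseteq> compl_alg B" by (intro hull_minimal assms)
  then show ?thesis
    unfolding compl_left_ideal_def WS.subspace_def by (auto simp: hull_def)
qed

lemma compl_ideal_hull:
  assumes "S \<subseteq> compl_alg B"
  shows "compl_ideal B (compl_ideal B hull S)"
proof -
  have "compl_ideal B (compl_alg B)"
    by (simp add: compl_ideal_def compl_left_ideal_def subspace_compl_alg compl_alg_wmult)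
  then have "compl_ideal B hull S \<subseteq> compl_alg B" by (intro hull_minimal assms)
  then show ?thesis
    unfolding compl_ideal_def compl_left_ideal_def WS.subspace_def by (auto simp: hull_def)
qed

lemma local_rels_in_compl_alg: "{local_rel emb N \<eta> a b s t |a b s t. a \<in> B \<and> b \<in> B} \<subseteq> compl_alg B"
  unfolding local_rel_swap_rel
  by (clarify, rule subsetD[OF compl_comp_subset_alg swap_rel_comp]) auto

lemma compl_ideal_locality: "compl_ideal B (locality_ideal emb B N \<eta>)"
  unfolding locality_ideal_def by (rule compl_ideal_hull[OF local_rels_in_compl_alg])

text \<open>The generators of the vacuum ideal, restated to match the assumptions
  \<open>vacuum\<close> and \<open>charge\<close> of \<open>word_rewriting\<close>.\<close>

definition vacuum_words :: "'b set \<Rightarrow> ('b \<Rightarrow> 'b \<Rightarrow> complex) \<Rightarrow> 'b word set" where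
  "vacuum_words B N = {[(a, n)] | a n. a \<in> B \<and> - n - 1 \<notin> \<nat>} \<union>
     {(a, n) # w | a n w. a \<in> B \<and> w \<in> lists (B \<times> UNIV) \<and> w \<noteq> [] \<and> pair_sum N a w - n \<notin> \<int>}"

lemma vacuum_words_in_lists: "vacuum_words B N \<subseteq> lists (B \<times> UNIV)"
  by (auto simp: vacuum_words_def)

lemma negative_int_iff: "(\<exists>k::int. k < 0 \<and> n = of_int k) \<longleftrightarrow> - n - 1 \<in> \<nat>" for n :: complex
proof
  assume "\<exists>k::int. k < 0 \<and> n = of_int k"
  then obtain k :: int where "k < 0" "n = of_int k" by blast
  then have "- n - 1 = of_nat (nat (- k - 1))" by simp
  then show "- n - 1 \<in> \<nat>" by (metis of_nat_in_Nats)
next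
  assume "- n - 1 \<in> \<nat>"
  then obtain k where "- n - 1 = of_nat k" by (elim Nats_cases)
  then have "- n = of_nat k + 1" by (simp add: diff_eq_eq)
  then have "n = of_int (- int k - 1)" unfolding minus_equation_iff[of n] by simp
  then show "\<exists>k::int. k < 0 \<and> n = of_int k" by (intro exI[of _ "- int k - 1"]) simp
qed

lemma vacuum_ideal_words: "vacuum_ideal B N = compl_left_ideal B hull (monom_w ` vacuum_words B N)"
proof -
  have "{monom_w [(a, n)] | a n. a \<in> B \<and> (\<nexists>k::int. k < 0 \<and> n = of_int k)} \<union>
      {monom_w ((a, n) # w) | a n w. a \<in> B \<and> w \<in> lists (B \<times> UNIV) \<and> w \<noteq> [] \<and>
         n \<notin> biadd_ext N (frag_of a) (charge_w w) +o \<int>} = monom_w ` vacuum_words B N"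
    unfolding negative_int_iff not_in_coset_iff biadd_ext_charge_w vacuum_words_def by blast
  then show ?thesis unfolding vacuum_ideal_def by (rule arg_cong)
qed

lemma compl_left_ideal_vacuum: "compl_left_ideal B (vacuum_ideal B N)"
  unfolding vacuum_ideal_words
  by (rule compl_left_ideal_hull) (use vacuum_words_in_lists[of B N] in \<open>blast intro: monom_in_compl_alg\<close>)

lemma free_relations_alt:
  "f \<in> free_relations emb B N \<eta> \<longleftrightarrow>
     (\<exists>g\<in>componentwise_closure B (locality_ideal emb B N \<eta>). \<exists>h\<in>componentwise_closure B (vacuum_ideal B N). f = g + h)"
  by (simp add: free_relations_def set_plus_def)

lemma free_relationsI:
  "g \<in> componentwise_closure B (locality_ideal emb B N \<eta>) \<Longrightarrow>
   h \<in> componentwise_closure B (vacuum_ideal B N) \<Longrightarrow> g + h \<in> free_relations emb B N \<eta>"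
  unfolding free_relations_alt by blast

lemma subspace_locality: "WS.subspace (locality_ideal emb B N \<eta>)"
  using compl_ideal_locality unfolding compl_ideal_def compl_left_ideal_def by blast

lemma subspace_vacuum: "WS.subspace (vacuum_ideal B N)"
  using compl_left_ideal_vacuum unfolding compl_left_ideal_def by blast

lemma subspace_free_relations: "WS.subspace (free_relations emb B N \<eta>)"
proof (unfold WS.subspace_def, intro conjI ballI allI)
  note I = subspace_componentwise_closure[OF subspace_locality]
  note J = subspace_componentwise_closure[OF subspace_vacuum]
  have "0 + 0 \<in> free_relations emb B N \<eta>"
    by (intro free_relationsI WS.subspace_0 I J)
  then show "0 \<in> free_relations emb B N \<eta>" unfolding add_0_left .
  fix x y :: "'b word \<Rightarrow> 'a" and c
  assume "x \<in> free_relations emb B N \<eta>"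
  then obtain g h where gh: "g \<in> componentwise_closure B (locality_ideal emb B N \<eta>)"
    "h \<in> componentwise_closure B (vacuum_ideal B N)" "x = g + h"
    unfolding free_relations_alt by blast
  show "wscale c x \<in> free_relations emb B N \<eta>"
    unfolding gh(3) WS.scale_right_distrib
    by (intro free_relationsI WS.subspace_scale[OF I] WS.subspace_scale[OF J] gh)
  assume "y \<in> free_relations emb B N \<eta>"
  then obtain g' h' where gh': "g' \<in> componentwise_closure B (locality_ideal emb B N \<eta>)"
    "h' \<in> componentwise_closure B (vacuum_ideal B N)" "y = g' + h'"
    unfolding free_relations_alt by blast
  have "(g + g') + (h + h') \<in> free_relations emb B N \<eta>"
    by (intro free_relationsI WS.subspace_add[OF I] WS.subspace_add[OF J] gh gh')
  also have "(g + g') + (h + h') = x + y" unfolding gh(3) gh'(3) by (simp only: ac_simps)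
  finally show "x + y \<in> free_relations emb B N \<eta>" .
qed

lemma free_relations_subset: "free_relations emb B N \<eta> \<subseteq> compl_alg B"
  using WS.subspace_add[OF subspace_compl_alg]
  by (auto simp: free_relations_alt componentwise_closure_def)

lemma free_relations_letter:
  assumes "a \<in> B" "f \<in> free_relations emb B N \<eta>"
  shows "wmult (monom_w [(a, n)]) f \<in> free_relations emb B N \<eta>"
proof -
  obtain g h where gh: "g \<in> componentwise_closure B (locality_ideal emb B N \<eta>)"
    "h \<in> componentwise_closure B (vacuum_ideal B N)" "f = g + h"
    using assms(2) unfolding free_relations_alt by blast
  have l: "monom_w [(a, n)] \<in> compl_comp B (frag_of a) (- n - 1)"
    using assms(1) monom_in_compl_comp[OF in_words_of_degree[of "[(a, n)]" B]] by simp
  have "wmult (monom_w [(a, n)]) g \<in> componentwise_closure B (locality_ideal emb B N \<eta>)"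
    by (rule componentwise_closure_wmult_left[OF subspace_locality _ l gh(1)])
      (use compl_ideal_locality in \<open>unfold compl_ideal_def compl_left_ideal_def, blast\<close>)
  moreover have "wmult (monom_w [(a, n)]) h \<in> componentwise_closure B (vacuum_ideal B N)"
    by (rule componentwise_closure_wmult_left[OF subspace_vacuum _ l gh(2)])
      (use compl_left_ideal_vacuum in \<open>unfold compl_left_ideal_def, blast\<close>)
  ultimately show ?thesis unfolding free_relations_alt gh(3) wmult_add_right by blast
qed

lemma vacuum_word_in_free_relations:
  assumes "w \<in> vacuum_words B N"
  shows "monom_w w \<in> free_relations emb B N \<eta>"
proof -
  have "monom_w w \<in> vacuum_ideal B N"
    unfolding vacuum_ideal_words using assms by (intro hull_inc) blast
  moreover have "monom_w w \<in> compl_comp B (charge_w w) (weight_w w)"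
    using assms vacuum_words_in_lists by (intro monom_in_compl_comp in_words_of_degree) blast
  ultimately have "monom_w w \<in> componentwise_closure B (vacuum_ideal B N)"
    unfolding componentwise_closure_comp[OF subspace_vacuum \<open>monom_w w \<in> compl_comp B _ _\<close>]
    by (intro compl_closureI IntI)
  moreover have "0 \<in> componentwise_closure B (locality_ideal emb B N \<eta>)"
    by (intro WS.subspace_0 subspace_componentwise_closure subspace_locality)
  ultimately have "0 + monom_w w \<in> free_relations emb B N \<eta>" by (intro free_relationsI)
  then show ?thesis unfolding add_0_left .
qed

lemma swap_rel_in_free_relations:
  assumes "a \<in> B" "b \<in> B" "c \<in> lists (B \<times> UNIV)"
  shows "swap_rel emb (N a b) (local_factor emb N \<eta> a b) a b s t c 0 \<in> free_relations emb B N \<eta>"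
proof -
  have "local_rel emb N \<eta> a b s t \<in> locality_ideal emb B N \<eta>"
    unfolding locality_ideal_def using assms by (intro hull_inc) blast
  \<comment> \<open>Here the ideal has to be two-sided: the relation is multiplied by
    \<open>c\<close> on the right.\<close>
  then have "swap_rel emb (N a b) (local_factor emb N \<eta> a b) a b s t c 0 \<in> locality_ideal emb B N \<eta>"
    unfolding swap_rel_wmult[where c = c] local_rel_swap_rel[symmetric]
    using compl_ideal_locality monom_in_compl_alg[OF assms(3)] unfolding compl_ideal_def by blast
  then have "swap_rel emb (N a b) (local_factor emb N \<eta> a b) a b s t c 0 \<in> componentwise_closure B (locality_ideal emb B N \<eta>)"
    unfolding componentwise_closure_comp[OF subspace_locality swap_rel_comp[OF assms]]
    by (intro compl_closureI IntI swap_rel_comp[OF assms])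
  moreover have "0 \<in> componentwise_closure B (vacuum_ideal B N)"
    by (intro WS.subspace_0 subspace_componentwise_closure subspace_vacuum)
  ultimately have "swap_rel emb (N a b) (local_factor emb N \<eta> a b) a b s t c 0 + 0 \<in> free_relations emb B N \<eta>"
    by (intro free_relationsI)
  then show ?thesis unfolding add_0_right .
qed

text \<open>
  A sum of two closed subspaces need not be closed. The series below lies in the sum because its
  words tend to \<open>0\<close> by the weights of suffixes that are themselves relations: both parts of a
  suffix can be taken in its degree, so they tend to \<open>0\<close> as well.
\<close>

lemma free_relations_convergent:
  fixes f :: "'b word \<Rightarrow> 'k::field"
  assumes f: "f \<in> compl_comp B \<alpha> d"
    and suffix: "\<And>w. f w \<noteq> 0 \<Longrightarrow> monom_w (drop (s w) w) \<in> free_relations emb B N \<eta>"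
    and conv: "\<And>n. finite {w. f w \<noteq> 0 \<and> \<not> Re (weight_w (drop (s w) w)) \<le> - real n - 1}"
  shows "f \<in> free_relations emb B N \<eta>"
proof -
  let ?I = "locality_ideal emb B N \<eta> :: ('b word \<Rightarrow> 'k) set"
  let ?J = "vacuum_ideal B N :: ('b word \<Rightarrow> 'k) set"
  let ?K = "{w. f w \<noteq> 0}"
  let ?cl = "\<lambda>S w. compl_closure B (charge_w w) (weight_w w) (S \<inter> compl_comp B (charge_w w) (weight_w w))"
  have "\<exists>g h. g \<in> ?cl ?I (drop (s w) w) \<and> h \<in> ?cl ?J (drop (s w) w) \<and> monom_w (drop (s w) w) = g + h"
    if w: "f w \<noteq> 0" for w
  proof -
    let ?v = "drop (s w) w"
    obtain g h where gh: "g \<in> componentwise_closure B ?I" "h \<in> componentwise_closure B ?J" "monom_w ?v = g + h"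
      using suffix[OF w] unfolding free_relations_alt by blast
    have "monom_w ?v = homog_part (charge_w ?v) (weight_w ?v) (monom_w ?v)"
      by (auto simp: homog_part_def monom_w_def)
    also have "\<dots> = homog_part (charge_w ?v) (weight_w ?v) g + homog_part (charge_w ?v) (weight_w ?v) h"
      unfolding gh(3) by (rule homog_part_add)
    finally show ?thesis using componentwise_closure_homog gh(1,2) by blast
  qed
  then obtain g h where gh: "\<And>w. f w \<noteq> 0 \<Longrightarrow> g w \<in> ?cl ?I (drop (s w) w)"
    "\<And>w. f w \<noteq> 0 \<Longrightarrow> h w \<in> ?cl ?J (drop (s w) w)"
    "\<And>w. f w \<noteq> 0 \<Longrightarrow> monom_w (drop (s w) w) = g w + h w"
    by metis
  let ?part = "\<lambda>g w. wscale (f w) (wmult (monom_w (take (s w) w)) (g w))"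
  have part: "?part g w \<in> compl_closure B \<alpha> d (S \<inter> compl_comp B \<alpha> d)"
      "Re (weight_w (drop (s w) w)) \<le> - real n - 1 \<Longrightarrow> ?part g w \<in> compl_nbhd B n \<alpha> d"
    if w: "f w \<noteq> 0" and g: "g w \<in> ?cl S (drop (s w) w)" and S: "compl_left_ideal B S" for S g w n
  proof -
    have ad: "w \<in> words_of_degree B \<alpha> d" by (rule compl_compD(1)[OF f w])
    then have deg: "charge_w (take (s w) w) + charge_w (drop (s w) w) = \<alpha>"
      "weight_w (take (s w) w) + weight_w (drop (s w) w) = d"
      unfolding charge_w_append[symmetric] weight_w_append[symmetric] append_take_drop_id
      by (auto simp: words_of_degree_def)
    have "take (s w) w \<in> lists (B \<times> UNIV)" using ad by (auto simp: words_of_degree_def dest: in_set_takeD)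
    then have m: "monom_w (take (s w) w) \<in> compl_comp B (charge_w (take (s w) w)) (weight_w (take (s w) w))"
      by (intro monom_in_compl_comp in_words_of_degree)
    have sub: "WS.subspace S" using S by (simp add: compl_left_ideal_def)
    have "wmult (monom_w (take (s w) w)) (g w) \<in> compl_closure B \<alpha> d (S \<inter> compl_comp B \<alpha> d)"
      using compl_closure_wmult_left[OF _ m g] S unfolding deg by (auto simp: compl_left_ideal_def)
    then show "?part g w \<in> compl_closure B \<alpha> d (S \<inter> compl_comp B \<alpha> d)"
      by (intro WS.subspace_scale subspace_compl_closure WS.subspace_inter sub subspace_compl_comp)
    assume "Re (weight_w (drop (s w) w)) \<le> - real n - 1"
    then have "g w \<in> compl_nbhd B n (charge_w (drop (s w) w)) (weight_w (drop (s w) w))"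
      using g by (intro low_weight_compl_nbhd) (auto simp: compl_closure_def)
    from compl_nbhd_wmult_left[OF m this]
    have "wmult (monom_w (take (s w) w)) (g w) \<in> compl_nbhd B n \<alpha> d" unfolding deg .
    then show "?part g w \<in> compl_nbhd B n \<alpha> d" by (intro WS.subspace_scale subspace_compl_nbhd)
  qed
  have I: "compl_left_ideal B ?I" using compl_ideal_locality by (auto simp: compl_ideal_def)
  note J = compl_left_ideal_vacuum[where B = B and N = N]
  have sum_part: "finite {w. w \<in> ?K \<and> ?part g w w' \<noteq> 0}"
      "(\<lambda>w'. \<Sum>w\<in>{w. w \<in> ?K \<and> ?part g w w' \<noteq> 0}. ?part g w w') \<in> compl_closure B \<alpha> d (S \<inter> compl_comp B \<alpha> d)"
    if g: "\<And>w. f w \<noteq> 0 \<Longrightarrow> g w \<in> ?cl S (drop (s w) w)" and S: "compl_left_ideal B S" for S g w'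
  proof -
    have sub: "WS.subspace (S \<inter> compl_comp B \<alpha> d)"
      using S by (intro WS.subspace_inter subspace_compl_comp) (simp add: compl_left_ideal_def)
    have mem: "?part g w \<in> compl_closure B \<alpha> d (S \<inter> compl_comp B \<alpha> d)" if "w \<in> ?K" for w
      using that by (intro part(1)[OF _ g S]) simp_all
    have "?part g w \<in> compl_nbhd B n \<alpha> d"
      if "f w \<noteq> 0" "Re (weight_w (drop (s w) w)) \<le> - real n - 1" for n w
      using that by (intro part(2)[OF _ g S]) simp_all
    then have fin: "finite {w. w \<in> ?K \<and> ?part g w \<notin> compl_nbhd B n \<alpha> d}" for n
      by (intro finite_subset[OF _ conv[of n]]) blast
    show "finite {w. w \<in> ?K \<and> ?part g w w' \<noteq> 0}"
      by (rule compl_closure_convergent_sum(1)[OF sub mem fin])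
    show "(\<lambda>w'. \<Sum>w\<in>{w. w \<in> ?K \<and> ?part g w w' \<noteq> 0}. ?part g w w') \<in> compl_closure B \<alpha> d (S \<inter> compl_comp B \<alpha> d)"
      by (rule compl_closure_convergent_sum(2)[OF sub mem fin])
  qed
  let ?G = "\<lambda>g w'. \<Sum>w\<in>{w. w \<in> ?K \<and> ?part g w w' \<noteq> 0}. ?part g w w'"
  note Gg = sum_part[OF gh(1) I] and Gh = sum_part[OF gh(2) J]
  have sum_eq: "f w' = ?G g w' + ?G h w'" for w'
  proof -
    let ?U = "{w. w \<in> ?K \<and> ?part g w w' \<noteq> 0} \<union> {w. w \<in> ?K \<and> ?part h w w' \<noteq> 0}"
    have U: "finite ?U" using Gg(1) Gh(1) by simp
    have gh_sum: "?part g w w' + ?part h w w' = (if w = w' then f w' else 0)" if "w \<in> ?K" for w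
    proof -
      have "?part g w + ?part h w = wscale (f w) (monom_w w)"
        unfolding WS.scale_right_distrib[symmetric] wmult_add_right[symmetric]
        using gh(3)[of w] that by (simp add: wmult_monom flip: gh(3))
      then have "(?part g w + ?part h w) w' = wscale (f w) (monom_w w) w'" by (rule fun_cong)
      then show ?thesis by (auto simp: wscale_def monom_w_def)
    qed
    have "?G g w' = (\<Sum>w\<in>?U. ?part g w w')" "?G h w' = (\<Sum>w\<in>?U. ?part h w w')"
      using U by (intro sum.mono_neutral_left; auto)+
    then have "?G g w' + ?G h w' = (\<Sum>w\<in>?U. if w = w' then f w' else 0)"
      by (simp only: sum.distrib[symmetric]) (intro sum.cong refl gh_sum, auto)
    also have "\<dots> = (if w' \<in> ?U then f w' else 0)" using U by simp
    \<comment> \<open>If \<open>w'\<close> is outside \<open>?U\<close>, both parts with index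
      \<open>w'\<close> vanish at \<open>w'\<close>; they add up to \<open>f w'\<close>, which is
      then 0.\<close>
    also have "\<dots> = f w'" using gh_sum[of w'] by (cases "f w' = 0") auto
    finally show ?thesis by simp
  qed
  have "f = ?G g + ?G h" by (rule ext) (unfold plus_fun_apply, rule sum_eq)
  moreover have "?G g \<in> compl_comp B \<alpha> d" "?G h \<in> compl_comp B \<alpha> d"
    using Gg(2) Gh(2) by (auto simp: compl_closure_def)
  then have "?G g \<in> componentwise_closure B ?I" "?G h \<in> componentwise_closure B ?J"
    using Gg(2) Gh(2) by (auto simp: componentwise_closure_comp[OF subspace_locality] componentwise_closure_comp[OF subspace_vacuum])
  ultimately show ?thesis unfolding free_relations_alt by blast
qed

text \<open>The remainder of a swap stays among the relations because each of its words becomes a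
  relation after removal of its first letter, and the weights of these tails tend to minus
  infinity.\<close>

lemma word_rewriting_free_relations:
  fixes N :: "'b \<Rightarrow> 'b \<Rightarrow> complex"
  assumes emb: "complex_subfield emb" and N_sym: "\<And>a b. a \<in> B \<Longrightarrow> b \<in> B \<Longrightarrow> N a b = N b a"
  shows "word_rewriting emb N (local_factor emb N \<eta>) B (free_relations emb B N \<eta>)"
proof
  show "emb 1 = 1" by (rule complex_subfieldD(1)[OF emb])
  show "WS.subspace (free_relations emb B N \<eta>)" by (rule subspace_free_relations)
  show "monom_w [(a, n)] \<in> free_relations emb B N \<eta>" if "a \<in> B" "- n - 1 \<notin> \<nat>" for a n
    using that by (intro vacuum_word_in_free_relations) (auto simp: vacuum_words_def)
  show "monom_w ((a, n) # w) \<in> free_relations emb B N \<eta>"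
    if "a \<in> B" "w \<in> lists (B \<times> UNIV)" "w \<noteq> []" "pair_sum N a w - n \<notin> \<int>" for a n w
    using that by (intro vacuum_word_in_free_relations) (auto simp: vacuum_words_def)
  fix a b s t and c :: "'b word" and J :: nat
  assume ab: "a \<in> B" "b \<in> B" "c \<in> lists (B \<times> UNIV)"
  show "swap_rel emb (N a b) (local_factor emb N \<eta> a b) a b s t c 0 \<in> free_relations emb B N \<eta>"
    by (rule swap_rel_in_free_relations[OF ab])
  assume tails: "\<And>j. J \<le> j \<Longrightarrow> monom_w ((b, t + of_nat j) # c) \<in> free_relations emb B N \<eta>"
    "\<And>j. J \<le> j \<Longrightarrow> monom_w ((a, s + of_nat j) # c) \<in> free_relations emb B N \<eta>"
  show "swap_rel emb (N a b) (local_factor emb N \<eta> a b) a b s t c J \<in> free_relations emb B N \<eta>"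
  proof (rule free_relations_convergent[OF swap_rel_comp[OF ab], where s = "\<lambda>_. 1"])
    fix w assume "swap_rel emb (N a b) (local_factor emb N \<eta> a b) a b s t c J w \<noteq> 0"
    then show "monom_w (drop 1 w) \<in> free_relations emb B N \<eta>"
      using tails by (auto dest!: swap_rel_nonzero)
  qed (rule swap_rel_tails)
qed (auto simp: N_sym intro: free_relations_letter)

text \<open>A deep word has a suffix of low weight, whose level is not natural; by
  \<open>level_not_nat\<close> that suffix is a relation. The depth depends on the charge alone
  because the bound in \<open>low_weight_level\<close> does.\<close>

lemma compl_nbhd_in_free_relations:
  assumes emb: "complex_subfield emb" and N_sym: "\<And>a b. a \<in> B \<Longrightarrow> b \<in> B \<Longrightarrow> N a b = N b a"
  shows "\<exists>n. \<forall>d. compl_nbhd B n \<alpha> d \<subseteq> (free_relations emb B N \<eta> :: ('b word \<Rightarrow> 'k::field) set)"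
proof -
  interpret word_rewriting emb N "local_factor emb N \<eta>" B "free_relations emb B N \<eta>"
    by (rule word_rewriting_free_relations[OF emb N_sym])
  obtain n where n: "\<And>(w :: 'b word) i. charge_w w = \<alpha> \<Longrightarrow> Re (weight_w (drop i w)) \<le> - real n - 1 \<Longrightarrow> level N (drop i w) \<notin> \<nat>"
    using low_weight_level[of \<alpha> N] by blast
  \<comment> \<open>The suffix of least real weight turns badness at depth \<open>m\<close> into a
    condition on this one suffix for all \<open>m\<close> at once, so convergence in the completion
    becomes convergence along these suffixes.\<close>
  define s :: "'b word \<Rightarrow> nat" where "s w = arg_min_on (\<lambda>i. Re (weight_w (drop i w))) {..length w}" for w
  have s: "bad_word m w \<longleftrightarrow> Re (weight_w (drop (s w) w)) \<le> - real m - 1" for m w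
  proof -
    have "s w \<in> {..length w}" unfolding s_def by (rule arg_min_if_finite) auto
    moreover have "Re (weight_w (drop (s w) w)) \<le> Re (weight_w (drop i w))" if "i \<le> length w" for i
      unfolding s_def by (rule arg_min_least) (use that in auto)
    ultimately show ?thesis unfolding bad_word_def by (meson atMost_iff order_trans)
  qed
  have "f \<in> free_relations emb B N \<eta>" if f: "f \<in> (compl_nbhd B n \<alpha> d :: ('b word \<Rightarrow> 'k) set)" for d f
  proof -
    have fc: "f \<in> compl_comp B \<alpha> d" using f by (simp add: compl_nbhd_iff)
    show ?thesis
    proof (rule free_relations_convergent[OF fc])
      fix w assume w: "f w \<noteq> 0"
      then have deg: "w \<in> words_of_degree B \<alpha> d" by (rule compl_compD(1)[OF fc])
      then have "drop (s w) w \<in> lists (B \<times> UNIV)" by (auto simp: words_of_degree_def dest: in_set_dropD)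
      moreover have "level N (drop (s w) w) \<notin> \<nat>"
        using n[of w "s w"] deg s[of n w] f w by (auto simp: words_of_degree_def compl_nbhd_iff)
      ultimately show "monom_w (drop (s w) w) \<in> free_relations emb B N \<eta>" by (rule level_not_nat)
    next
      show "finite {w. f w \<noteq> 0 \<and> \<not> Re (weight_w (drop (s w) w)) \<le> - real m - 1}" for m
        using compl_compD(2)[OF fc, of m] unfolding s .
    qed
  qed
  then show ?thesis by blast
qed

section \<open>Subspaces containing all relations\<close>

context word_rewriting
begin

lemma word_wmult: "w \<in> lists (B \<times> UNIV) \<Longrightarrow> f \<in> Z \<Longrightarrow> wmult (monom_w w) f \<in> Z"
proof (induction w)
  case (Cons x w)
  have "wmult (monom_w (x # w)) f = wmult (monom_w [x]) (wmult (monom_w w) f)"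
    by (simp add: wmult_monom flip: wmult_assoc)
  then show ?case using Cons letter by (cases x) auto
qed simp

text \<open>Closure under letters extends to the completion as soon as \<open>Z\<close> contains all
  deep elements: the finite part of \<open>x\<close> acts letter by letter, and its tail times
  \<open>f\<close> is deep, since multiplying by \<open>f\<close> on the right costs a bounded
  depth.\<close>

lemma wmult_mem:
  assumes deep: "\<And>\<alpha>. \<exists>n. \<forall>d. compl_nbhd B n \<alpha> d \<subseteq> Z"
    and x: "x \<in> compl_alg B" and f: "f \<in> compl_alg B" "f \<in> Z"
  shows "wmult x f \<in> Z"
  using x
proof (induction rule: compl_alg_induct)
  case (add x y)
  then show ?case unfolding wmult_add_left by (intro WS.subspace_add[OF subspace])
next
  case (comp x \<alpha> d)
  \<comment> \<open>The depth at which \<open>x\<close> is cut depends on \<open>f\<close>, hence is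
    found first; sums of components of \<open>f\<close> are handled by taking the maximum.\<close>
  have "\<exists>m. \<forall>h\<in>compl_nbhd B m \<alpha> d. wmult h f \<in> Z" using f(1)
  proof (induction rule: compl_alg_induct)
    case (add f g)
    then obtain m m' where "\<forall>h\<in>compl_nbhd B m \<alpha> d. wmult h f \<in> Z" "\<forall>h\<in>compl_nbhd B m' \<alpha> d. wmult h g \<in> Z" by blast
    then have "\<forall>h\<in>compl_nbhd B (max m m') \<alpha> d. wmult h (f + g) \<in> Z"
      unfolding wmult_add_right using compl_nbhd_antimono WS.subspace_add[OF subspace]
      by (meson max.cobounded1 max.cobounded2 subsetD)
    then show ?case ..
  next
    case (comp f \<beta> e)
    obtain n where n: "\<And>d. compl_nbhd B n (\<alpha> + \<beta>) d \<subseteq> Z" using deep by blast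
    have "Re e \<le> real (n + nat \<lceil>\<bar>Re e\<bar>\<rceil>) - real n" by simp linarith
    then show ?case using compl_nbhd_wmult_right[OF _ comp] n by blast
  qed
  then obtain m where m: "\<And>h. h \<in> compl_nbhd B m \<alpha> d \<Longrightarrow> wmult h f \<in> Z" by blast
  obtain g h where gh: "x = g + h" "finite {w. g w \<noteq> 0}" "g \<in> compl_comp B \<alpha> d" "h \<in> compl_nbhd B m \<alpha> d"
    by (rule compl_comp_split[OF comp])
  have sub: "WS.subspace {x. wmult x f \<in> Z}"
    using subspace unfolding WS.subspace_def by (auto simp: wmult_add_left wmult_scale_left)
  have "g \<in> {x. wmult x f \<in> Z}"
  proof (rule finite_support_in_subspace[OF sub gh(2)])
    fix w assume "g w \<noteq> 0"
    then have "w \<in> lists (B \<times> UNIV)" using compl_compD(1)[OF gh(3)] by (simp add: words_of_degree_def)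
    then show "monom_w w \<in> {x. wmult x f \<in> Z}" using word_wmult f(2) by simp
  qed
  then have "wmult g f \<in> Z" by simp
  then show ?case unfolding gh(1) wmult_add_left by (rule WS.subspace_add[OF subspace _ m[OF gh(4)]])
qed

text \<open>A subspace that contains a neighbourhood of 0 in every degree is closed, so
  approximation by \<open>S\<close> to that one depth suffices.\<close>

lemma componentwise_closure_mem:
  assumes deep: "\<And>\<alpha>. \<exists>n. \<forall>d. compl_nbhd B n \<alpha> d \<subseteq> Z"
    and S: "S \<subseteq> Z" and f: "f \<in> componentwise_closure B S"
  shows "f \<in> Z"
proof (rule compl_alg_in_subspace[OF _ subspace])
  show "f \<in> compl_alg B" using f by (simp add: componentwise_closure_def)
  fix \<alpha> d
  obtain n where n: "compl_nbhd B n \<alpha> d \<subseteq> Z" using deep by blast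
  obtain g where g: "g \<in> S" "homog_part \<alpha> d f - g \<in> compl_nbhd B n \<alpha> d"
    using componentwise_closure_homog[OF f, of \<alpha> d] unfolding compl_closure_def by blast
  have "homog_part \<alpha> d f - g + g \<in> Z" using g n S by (intro WS.subspace_add[OF subspace]) auto
  then show "homog_part \<alpha> d f \<in> Z" by simp
qed

lemma free_relations_mem:
  assumes deep: "\<And>\<alpha>. \<exists>n. \<forall>d. compl_nbhd B n \<alpha> d \<subseteq> Z"
    and p: "p = local_factor emb N \<eta>"
  shows "free_relations emb B N \<eta> \<subseteq> Z"
proof -
  have J: "vacuum_ideal B N \<subseteq> compl_alg B \<inter> Z"
    unfolding vacuum_ideal_words
  proof (rule hull_minimal)
    show "monom_w ` vacuum_words B N \<subseteq> compl_alg B \<inter> Z"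
    proof (intro image_subsetI IntI)
      fix w assume w: "w \<in> vacuum_words B N"
      then show "monom_w w \<in> compl_alg B" using vacuum_words_in_lists[of B N] by (intro monom_in_compl_alg) blast
      show "monom_w w \<in> Z" using w vacuum charge unfolding vacuum_words_def by blast
    qed
    show "compl_left_ideal B (compl_alg B \<inter> Z)"
      unfolding compl_left_ideal_def
      using WS.subspace_inter[OF subspace_compl_alg subspace] compl_alg_wmult wmult_mem[OF deep] by blast
  qed
  \<comment> \<open>\<open>Z\<close> is stable only under left multiplication, so the two-sided
    ideal is compared with the elements all of whose right multiples lie in \<open>Z\<close>; these
    do form a two-sided ideal.\<close>
  let ?K = "{f \<in> compl_alg B. \<forall>x\<in>compl_alg B. wmult f x \<in> Z}"
  have "locality_ideal emb B N \<eta> \<subseteq> ?K"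
    unfolding locality_ideal_def
  proof (rule hull_minimal)
    show "{local_rel emb N \<eta> a b s t |a b s t. a \<in> B \<and> b \<in> B} \<subseteq> ?K"
    proof clarify
      fix a b s t assume ab: "a \<in> B" "b \<in> B"
      let ?l = "local_rel emb N \<eta> a b s t"
      obtain \<alpha> d where l: "?l \<in> compl_comp B \<alpha> d"
        using swap_rel_comp[OF ab] unfolding local_rel_swap_rel by blast
      have "wmult ?l x \<in> Z" if "x \<in> compl_alg B" for x using that
      proof (induction rule: compl_alg_induct)
        case (add f g)
        then show ?case unfolding wmult_add_right by (intro WS.subspace_add[OF subspace])
      next
        case (comp x \<beta> e)
        obtain n where n: "\<And>d. compl_nbhd B n (\<alpha> + \<beta>) d \<subseteq> Z" using deep by blast
        \<comment> \<open>\<open>swap\<close> speaks of single words \<open>c\<close> on the right.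
          A general \<open>x\<close> is cut so deep that its tail remains in \<open>Z\<close> after
          left multiplication by \<open>?l\<close>.\<close>
        obtain g h where gh: "x = g + h" "finite {w. g w \<noteq> 0}" "g \<in> compl_comp B \<beta> e" "h \<in> compl_nbhd B n \<beta> e"
          by (rule compl_comp_split[OF comp])
        have sub: "WS.subspace {x. wmult ?l x \<in> Z}"
          using subspace unfolding WS.subspace_def by (auto simp: wmult_add_right wmult_scale_right)
        have "g \<in> {x. wmult ?l x \<in> Z}"
        proof (rule finite_support_in_subspace[OF sub gh(2)])
          fix c assume "g c \<noteq> 0"
          then have "c \<in> lists (B \<times> UNIV)" using compl_compD(1)[OF gh(3)] by (simp add: words_of_degree_def)
          then have "swap_rel emb (N a b) (p a b) a b s t c 0 \<in> Z" by (rule swap[OF ab])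
          then have "wmult ?l (monom_w c) \<in> Z"
            unfolding local_rel_swap_rel p swap_rel_wmult[where c = c] .
          then show "monom_w c \<in> {x. wmult ?l x \<in> Z}" by simp
        qed
        then have "wmult ?l g \<in> Z" by simp
        moreover have "wmult ?l h \<in> Z" by (rule subsetD[OF n compl_nbhd_wmult_left[OF l gh(4)]])
        ultimately show ?case unfolding gh(1) wmult_add_right by (rule WS.subspace_add[OF subspace])
      qed
      moreover have "?l \<in> compl_alg B" using l compl_comp_subset_alg by blast
      ultimately show "?l \<in> compl_alg B \<and> (\<forall>x\<in>compl_alg B. wmult ?l x \<in> Z)" by blast
    qed
    have sub: "WS.subspace ?K"
      using subspace_compl_alg[of B] subspace unfolding WS.subspace_def
      by (auto simp: wmult_add_left wmult_scale_left)
    show "compl_ideal B ?K"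
      unfolding compl_ideal_def compl_left_ideal_def
    proof (intro conjI ballI sub)
      show "?K \<subseteq> compl_alg B" by blast
      fix x u :: "'b word \<Rightarrow> 'k" assume x: "x \<in> compl_alg B" and u: "u \<in> ?K"
      then show "wmult x u \<in> ?K" using wmult_mem[OF deep x] by (simp add: wmult_assoc compl_alg_wmult)
      show "wmult u x \<in> ?K" using x u by (simp add: wmult_assoc compl_alg_wmult)
    qed
  qed
  moreover have "?K \<subseteq> Z" using monom_in_compl_alg[of "[]" B] by fastforce
  ultimately have I: "locality_ideal emb B N \<eta> \<subseteq> Z" by blast
  show ?thesis
  proof
    fix f assume "f \<in> free_relations emb B N \<eta>"
    then obtain g h where gh: "g \<in> componentwise_closure B (locality_ideal emb B N \<eta>)"
      "h \<in> componentwise_closure B (vacuum_ideal B N)" "f = g + h"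
      unfolding free_relations_alt by blast
    have "vacuum_ideal B N \<subseteq> Z" using J by blast
    then show "f \<in> Z"
      unfolding gh(3)
      by (intro WS.subspace_add[OF subspace] componentwise_closure_mem[OF deep I gh(1)]
          componentwise_closure_mem[OF deep _ gh(2)])
  qed
qed

end

section \<open>Linear algebra in vector spaces with a carrier\<close>

lemma ring_of_type_algebra_simps [simp]:
  "carrier ring_of_type_algebra = UNIV" "\<one>\<^bsub>ring_of_type_algebra\<^esub> = 1" "\<zero>\<^bsub>ring_of_type_algebra\<^esub> = 0"
  "x \<oplus>\<^bsub>ring_of_type_algebra\<^esub> y = x + y" "x \<otimes>\<^bsub>ring_of_type_algebra\<^esub> y = x * y"
  by (simp_all add: ring_of_type_algebra_def)

locale complex_space =
  fixes emb :: "complex \<Rightarrow> 'k::field" and V :: "('k, 'v, 'm) module_scheme"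
  assumes emb: "complex_subfield emb"
    and is_module: "Module.module (ring_of_type_algebra :: 'k ring) V"

sublocale complex_space \<subseteq> V: Module.module "ring_of_type_algebra :: 'k ring" V
  by (rule is_module)

lemma (in complex_space) smult_closed [simp, intro]: "x \<in> carrier V \<Longrightarrow> c \<odot>\<^bsub>V\<^esub> x \<in> carrier V"
  by (rule V.smult_closed) auto

lemma (in complex_space) smult_add_left: "x \<in> carrier V \<Longrightarrow> (c + d) \<odot>\<^bsub>V\<^esub> x = c \<odot>\<^bsub>V\<^esub> x \<oplus>\<^bsub>V\<^esub> d \<odot>\<^bsub>V\<^esub> x"
  using V.smult_l_distr[of c d x] by simp

lemma (in complex_space) smult_add_right:
  "x \<in> carrier V \<Longrightarrow> y \<in> carrier V \<Longrightarrow> c \<odot>\<^bsub>V\<^esub> (x \<oplus>\<^bsub>V\<^esub> y) = c \<odot>\<^bsub>V\<^esub> x \<oplus>\<^bsub>V\<^esub> c \<odot>\<^bsub>V\<^esub> y"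
  using V.smult_r_distr[of c x y] by simp

lemma (in complex_space) smult_mult: "x \<in> carrier V \<Longrightarrow> (c * d) \<odot>\<^bsub>V\<^esub> x = c \<odot>\<^bsub>V\<^esub> (d \<odot>\<^bsub>V\<^esub> x)"
  using V.smult_assoc1[of c d x] by simp

lemma (in complex_space) smult_one [simp]: "x \<in> carrier V \<Longrightarrow> 1 \<odot>\<^bsub>V\<^esub> x = x"
  using V.smult_one[of x] by simp

lemma (in complex_space) smult_zero [simp]: "x \<in> carrier V \<Longrightarrow> 0 \<odot>\<^bsub>V\<^esub> x = \<zero>\<^bsub>V\<^esub>"
  using V.smult_l_null[of x] by simp

lemma (in complex_space) smult_zero_right [simp]: "c \<odot>\<^bsub>V\<^esub> \<zero>\<^bsub>V\<^esub> = \<zero>\<^bsub>V\<^esub>"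
  by (rule V.smult_r_null) simp

lemma (in complex_space) smult_uminus: "x \<in> carrier V \<Longrightarrow> (- c) \<odot>\<^bsub>V\<^esub> x = \<ominus>\<^bsub>V\<^esub> (c \<odot>\<^bsub>V\<^esub> x)"
  by (rule V.minus_equality[symmetric]) (simp_all flip: smult_add_left)

lemma (in complex_space) smult_uminus_right: "x \<in> carrier V \<Longrightarrow> c \<odot>\<^bsub>V\<^esub> (\<ominus>\<^bsub>V\<^esub> x) = \<ominus>\<^bsub>V\<^esub> (c \<odot>\<^bsub>V\<^esub> x)"
  by (rule V.smult_r_minus) auto

lemma (in complex_space) smult_cancel:
  assumes "c \<noteq> 0" "x \<in> carrier V" "y \<in> carrier V" "c \<odot>\<^bsub>V\<^esub> x = c \<odot>\<^bsub>V\<^esub> y"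
  shows "x = y"
proof -
  have "inverse c \<odot>\<^bsub>V\<^esub> (c \<odot>\<^bsub>V\<^esub> x) = inverse c \<odot>\<^bsub>V\<^esub> (c \<odot>\<^bsub>V\<^esub> y)" using assms(4) by simp
  then show ?thesis using assms(1-3) unfolding smult_mult[symmetric, OF assms(2)] smult_mult[symmetric, OF assms(3)] by simp
qed

lemma (in complex_space) finsum_extend:
  assumes "finite A" "\<And>j. j \<in> A \<Longrightarrow> f j \<in> carrier V" "\<And>j. f j \<noteq> \<zero>\<^bsub>V\<^esub> \<Longrightarrow> j \<in> A"
  shows "(\<Oplus>\<^bsub>V\<^esub>j\<in>{j. f j \<noteq> \<zero>\<^bsub>V\<^esub>}. f j) = (\<Oplus>\<^bsub>V\<^esub>j\<in>A. f j)"
  by (rule V.add.finprod_mono_neutral_cong_left) (use assms in auto)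

lemma (in complex_space) support_sum_eq:
  assumes "\<And>j. f j \<in> carrier V" "\<And>j. J \<le> j \<Longrightarrow> f j = \<zero>\<^bsub>V\<^esub>"
  shows "support_sum V f = (\<Oplus>\<^bsub>V\<^esub>j\<in>{..J}. f j)"
  unfolding support_sum_def
  by (rule finsum_extend) (use assms nat_le_linear in auto)

lemma (in complex_space) finsum_uminus:
  "finite A \<Longrightarrow> (\<And>j. j \<in> A \<Longrightarrow> f j \<in> carrier V) \<Longrightarrow> (\<Oplus>\<^bsub>V\<^esub>j\<in>A. \<ominus>\<^bsub>V\<^esub> f j) = \<ominus>\<^bsub>V\<^esub> (\<Oplus>\<^bsub>V\<^esub>j\<in>A. f j)"
proof (induction A rule: finite_induct)
  case (insert x A)
  then show ?case by (simp add: V.finsum_insert V.minus_add V.finsum_closed Pi_def)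
next
  case empty
  have "\<ominus>\<^bsub>V\<^esub> \<zero>\<^bsub>V\<^esub> = \<zero>\<^bsub>V\<^esub>" by (rule V.minus_equality) simp_all
  then show ?case unfolding V.finsum_empty by (rule sym)
qed

lemma (in complex_space) submoduleD:
  assumes "submodule U (ring_of_type_algebra :: 'k ring) V"
  shows "U \<subseteq> carrier V" "\<zero>\<^bsub>V\<^esub> \<in> U" "x \<in> U \<Longrightarrow> y \<in> U \<Longrightarrow> x \<oplus>\<^bsub>V\<^esub> y \<in> U" "x \<in> U \<Longrightarrow> c \<odot>\<^bsub>V\<^esub> x \<in> U"
proof -
  show sub: "U \<subseteq> carrier V" and scale: "x \<in> U \<Longrightarrow> c \<odot>\<^bsub>V\<^esub> x \<in> U" for x c
    using V.submoduleE[OF assms] by auto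
  show "x \<in> U \<Longrightarrow> y \<in> U \<Longrightarrow> x \<oplus>\<^bsub>V\<^esub> y \<in> U" using V.submoduleE(5)[OF assms] by blast
  obtain x where "x \<in> U" using V.submoduleE(2)[OF assms] by blast
  then show "\<zero>\<^bsub>V\<^esub> \<in> U" using scale[of x 0] sub by auto
qed

lemma linear_map_zero:
  assumes "complex_space emb V" "complex_space emb W" "linear_map V W f"
  shows "f \<zero>\<^bsub>V\<^esub> = \<zero>\<^bsub>W\<^esub>"
proof -
  interpret V: complex_space emb V by fact
  interpret W: complex_space emb W by fact
  have "f (0 \<odot>\<^bsub>V\<^esub> \<zero>\<^bsub>V\<^esub>) = 0 \<odot>\<^bsub>W\<^esub> f \<zero>\<^bsub>V\<^esub>" "f \<zero>\<^bsub>V\<^esub> \<in> carrier W"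
    using assms(3) V.V.zero_closed unfolding linear_map_def by blast+
  then show ?thesis by simp
qed

lemma linear_map_uminus:
  assumes "complex_space emb V" "complex_space emb W" "linear_map V W f" "x \<in> carrier V"
  shows "f (\<ominus>\<^bsub>V\<^esub> x) = \<ominus>\<^bsub>W\<^esub> f x"
proof -
  interpret V: complex_space emb V by fact
  interpret W: complex_space emb W by fact
  have "f ((- 1) \<odot>\<^bsub>V\<^esub> x) = (- 1) \<odot>\<^bsub>W\<^esub> f x" "f x \<in> carrier W"
    using assms(3,4) unfolding linear_map_def by blast+
  then show ?thesis using assms(4) by (simp add: V.smult_uminus W.smult_uminus)
qed

lemma linear_map_finsum:
  assumes "complex_space emb V" "complex_space emb W" "linear_map V W f" "finite A" "\<And>j. j \<in> A \<Longrightarrow> g j \<in> carrier V"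
  shows "f (\<Oplus>\<^bsub>V\<^esub>j\<in>A. g j) = (\<Oplus>\<^bsub>W\<^esub>j\<in>A. f (g j))"
proof -
  interpret V: complex_space emb V by fact
  interpret W: complex_space emb W by fact
  note lin = assms(3)[unfolded linear_map_def]
  show ?thesis using assms(4,5)
  proof (induction A rule: finite_induct)
    case empty
    then show ?case using linear_map_zero[OF assms(1-3)] by simp
  next
    case (insert x A)
    then have "g x \<in> carrier V" "(\<Oplus>\<^bsub>V\<^esub>j\<in>A. g j) \<in> carrier V" by (auto intro: V.V.finsum_closed)
    then have "f (g x \<oplus>\<^bsub>V\<^esub> (\<Oplus>\<^bsub>V\<^esub>j\<in>A. g j)) = f (g x) \<oplus>\<^bsub>W\<^esub> f (\<Oplus>\<^bsub>V\<^esub>j\<in>A. g j)" using lin by blast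
    moreover have "(\<lambda>j. f (g j)) \<in> A \<rightarrow> carrier W" "f (g x) \<in> carrier W" using insert.prems lin by auto
    ultimately show ?case using insert by (simp add: V.V.finsum_insert W.V.finsum_insert Pi_def)
  qed
qed

section \<open>Locality as a relation between double sequences\<close>

context complex_space
begin

text \<open>
  \<open>L s t\<close> stands for the coefficient of a series at \<open>z^(-s-1) w^(-t-1)\<close>, and \<open>local_sum M L\<close> for its
  product with \<open>(z - w)^M\<close>, expanded in \<open>w/z\<close>. The series is truncated if it is bounded below in \<open>w\<close>.
\<close>

definition local_sum :: "complex \<Rightarrow> (complex \<Rightarrow> complex \<Rightarrow> 'v) \<Rightarrow> complex \<Rightarrow> complex \<Rightarrow> 'v" where
  "local_sum M L s t = support_sum V (\<lambda>j. emb ((-1) ^ j * (M gchoose j)) \<odot>\<^bsub>V\<^esub> L (s + M - of_nat j) (t + of_nat j))"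

definition truncated :: "(complex \<Rightarrow> complex \<Rightarrow> 'v) \<Rightarrow> bool" where
  "truncated L \<longleftrightarrow> (\<forall>s t. L s t \<in> carrier V) \<and> (\<forall>t. \<exists>J. \<forall>j\<ge>J. \<forall>s. L s (t + of_nat j) = \<zero>\<^bsub>V\<^esub>)"

text \<open>\<open>R\<close> takes the mode of the second field first, so
  \<open>local_sum M R t s\<close> uses the expansion in \<open>z/w\<close>; the exponential is the
  factor that comes with this opposite expansion of \<open>(z - w)^M\<close>.\<close>

definition local_pair :: "complex \<Rightarrow> complex \<Rightarrow> (complex \<Rightarrow> complex \<Rightarrow> 'v) \<Rightarrow> (complex \<Rightarrow> complex \<Rightarrow> 'v) \<Rightarrow> bool" where
  "local_pair p M L R \<longleftrightarrow> (\<forall>s t. local_sum M L s t = emb (p * exp (of_real pi * \<i> * M)) \<odot>\<^bsub>V\<^esub> local_sum M R t s)"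

lemma truncated_closed [simp]: "truncated L \<Longrightarrow> L s t \<in> carrier V"
  by (simp add: truncated_def)

lemma local_sum_eq:
  assumes "truncated L" "\<And>j s. J \<le> j \<Longrightarrow> L s (t + of_nat j) = \<zero>\<^bsub>V\<^esub>"
  shows "local_sum M L s t = (\<Oplus>\<^bsub>V\<^esub>j\<in>{..J}. emb ((-1) ^ j * (M gchoose j)) \<odot>\<^bsub>V\<^esub> L (s + M - of_nat j) (t + of_nat j))"
  unfolding local_sum_def by (rule support_sum_eq) (use assms in auto)

lemma local_sum_closed [simp]:
  assumes "truncated L"
  shows "local_sum M L s t \<in> carrier V"
proof -
  obtain J where "\<And>j s. J \<le> j \<Longrightarrow> L s (t + of_nat j) = \<zero>\<^bsub>V\<^esub>" using assms unfolding truncated_def by blast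
  from local_sum_eq[OF assms this] show ?thesis using assms by (auto intro: V.finsum_closed)
qed

text \<open>Pascal's rule is multiplication by \<open>z - w\<close>: the factor \<open>z\<close>
  raises \<open>s\<close> by one, the factor \<open>w\<close> raises \<open>t\<close> by
  one.\<close>

lemma local_sum_Suc:
  assumes L: "truncated L"
  shows "local_sum (M + 1) L s t = local_sum M L (s + 1) t \<ominus>\<^bsub>V\<^esub> local_sum M L s (t + 1)"
proof -
  obtain J where J: "\<And>j s. J \<le> j \<Longrightarrow> L s (t + of_nat j) = \<zero>\<^bsub>V\<^esub>" using L unfolding truncated_def by blast
  then have J1: "L s (t + of_nat j) = \<zero>\<^bsub>V\<^esub>" if "Suc J \<le> j" for j s using that by simp
  have J2: "L s (t + 1 + of_nat j) = \<zero>\<^bsub>V\<^esub>" if "J \<le> j" for j s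
    using J[of "Suc j" s] that by (simp add: algebra_simps)
  let ?A = "\<lambda>j. emb ((-1) ^ j * ((M + 1) gchoose j)) \<odot>\<^bsub>V\<^esub> L (s + (M + 1) - of_nat j) (t + of_nat j)"
  let ?U = "\<lambda>j. emb ((-1) ^ j * (M gchoose j)) \<odot>\<^bsub>V\<^esub> L (s + 1 + M - of_nat j) (t + of_nat j)"
  let ?W = "\<lambda>j. emb ((-1) ^ j * (M gchoose j)) \<odot>\<^bsub>V\<^esub> L (s + M - of_nat j) (t + 1 + of_nat j)"
  have Cl: "?A j \<in> carrier V" "?U j \<in> carrier V" "?W j \<in> carrier V" for j using L by simp_all
  have A0: "?A 0 = ?U 0" by (simp add: algebra_simps)
  have AS: "?A (Suc j) = ?U (Suc j) \<oplus>\<^bsub>V\<^esub> (\<ominus>\<^bsub>V\<^esub> ?W j)" for j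
  proof -
    have args: "s + (M + 1) - of_nat (Suc j) = s + M - of_nat j" "s + 1 + M - of_nat (Suc j) = s + M - of_nat j"
      "t + of_nat (Suc j) = t + 1 + of_nat j" by simp_all
    have pascal: "(M + 1) gchoose Suc j = (M gchoose j) + (M gchoose Suc j)" by (rule gbinomial_Suc_Suc)
    have coeff: "(-1) ^ Suc j * ((M + 1) gchoose Suc j) = (-1) ^ Suc j * (M gchoose Suc j) + - ((-1) ^ j * (M gchoose j))"
      unfolding pascal by (simp add: algebra_simps)
    show ?thesis
      unfolding args coeff complex_subfieldD(2,5)[OF emb] smult_uminus[OF truncated_closed[OF L], symmetric]
      by (rule smult_add_left) (use L in simp)
  qed
  have "local_sum (M + 1) L s t = (\<Oplus>\<^bsub>V\<^esub>j\<in>{..Suc J}. ?A j)" by (rule local_sum_eq[OF L J1])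
  also have "\<dots> = (\<Oplus>\<^bsub>V\<^esub>j\<in>{..J}. ?A (Suc j)) \<oplus>\<^bsub>V\<^esub> ?A 0" by (rule V.finsum_Suc2) (intro Pi_I Cl)
  also have "(\<Oplus>\<^bsub>V\<^esub>j\<in>{..J}. ?A (Suc j)) = (\<Oplus>\<^bsub>V\<^esub>j\<in>{..J}. ?U (Suc j) \<oplus>\<^bsub>V\<^esub> (\<ominus>\<^bsub>V\<^esub> ?W j))"
    unfolding AS ..
  also have "\<dots> = (\<Oplus>\<^bsub>V\<^esub>j\<in>{..J}. ?U (Suc j)) \<oplus>\<^bsub>V\<^esub> (\<Oplus>\<^bsub>V\<^esub>j\<in>{..J}. \<ominus>\<^bsub>V\<^esub> ?W j)"
    by (rule V.finsum_addf) (intro Pi_I V.a_inv_closed Cl)+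
  also have "(\<Oplus>\<^bsub>V\<^esub>j\<in>{..J}. \<ominus>\<^bsub>V\<^esub> ?W j) = \<ominus>\<^bsub>V\<^esub> (\<Oplus>\<^bsub>V\<^esub>j\<in>{..J}. ?W j)"
    by (rule finsum_uminus) (simp, rule Cl)
  also have "(\<Oplus>\<^bsub>V\<^esub>j\<in>{..J}. ?W j) = local_sum M L s (t + 1)" by (rule local_sum_eq[OF L J2, symmetric])
  finally have "local_sum (M + 1) L s t
      = (\<Oplus>\<^bsub>V\<^esub>j\<in>{..J}. ?U (Suc j)) \<oplus>\<^bsub>V\<^esub> (\<ominus>\<^bsub>V\<^esub> local_sum M L s (t + 1)) \<oplus>\<^bsub>V\<^esub> ?U 0"
    unfolding A0 .
  also have "\<dots> = (\<Oplus>\<^bsub>V\<^esub>j\<in>{..J}. ?U (Suc j)) \<oplus>\<^bsub>V\<^esub> ?U 0 \<oplus>\<^bsub>V\<^esub> (\<ominus>\<^bsub>V\<^esub> local_sum M L s (t + 1))"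
    by (simp only: V.a_ac V.finsum_closed Pi_I Cl local_sum_closed[OF L] V.a_inv_closed V.a_closed)
  also have "(\<Oplus>\<^bsub>V\<^esub>j\<in>{..J}. ?U (Suc j)) \<oplus>\<^bsub>V\<^esub> ?U 0 = (\<Oplus>\<^bsub>V\<^esub>j\<in>{..Suc J}. ?U j)"
    by (rule V.finsum_Suc2[symmetric]) (intro Pi_I Cl)
  also have "\<dots> = local_sum M L (s + 1) t" by (rule local_sum_eq[OF L J1, symmetric])
  finally show ?thesis by (simp add: a_minus_def)
qed

text \<open>Locality can be multiplied by \<open>z - w\<close>. With the variables exchanged this
  factor reads \<open>w - z\<close>, and the sign is what the exponential acquires when
  \<open>M\<close> grows by 1.\<close>

lemma local_pair_Suc:
  assumes L: "truncated L" and R: "truncated R" and pair: "local_pair p M L R"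
  shows "local_pair p (M + 1) L R"
  unfolding local_pair_def
proof (intro allI)
  fix s t
  let ?q = "emb (p * exp (of_real pi * \<i> * M))"
  have q: "emb (p * exp (of_real pi * \<i> * (M + 1))) = - ?q"
    by (simp add: distrib_left exp_add complex_subfieldD(5)[OF emb] exp_pi_i')
  have eq: "local_sum M L s t = ?q \<odot>\<^bsub>V\<^esub> local_sum M R t s" for s t
    using pair unfolding local_pair_def by blast
  have "local_sum (M + 1) L s t = ?q \<odot>\<^bsub>V\<^esub> local_sum M R t (s + 1) \<ominus>\<^bsub>V\<^esub> ?q \<odot>\<^bsub>V\<^esub> local_sum M R (t + 1) s"
    unfolding local_sum_Suc[OF L] eq ..
  also have "\<dots> = \<ominus>\<^bsub>V\<^esub> (?q \<odot>\<^bsub>V\<^esub> (local_sum M R (t + 1) s \<ominus>\<^bsub>V\<^esub> local_sum M R t (s + 1)))"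
    using R by (simp add: a_minus_def smult_add_right smult_uminus_right V.minus_add V.a_comm)
  also have "\<dots> = (- ?q) \<odot>\<^bsub>V\<^esub> local_sum (M + 1) R t s"
    unfolding local_sum_Suc[OF R] using R by (intro smult_uminus[symmetric]) simp
  finally show "local_sum (M + 1) L s t = emb (p * exp (of_real pi * \<i> * (M + 1))) \<odot>\<^bsub>V\<^esub> local_sum (M + 1) R t s"
    unfolding q .
qed

lemma local_pair_add:
  assumes "truncated L" "truncated R" "local_pair p M L R"
  shows "local_pair p (M + of_nat k) L R"
proof (induction k)
  case (Suc k)
  then show ?case using local_pair_Suc[OF assms(1,2)] by (fastforce simp: algebra_simps)
qed (use assms in simp)

text \<open>The expansion of \<open>(z - w)^M\<close> in \<open>w/z\<close> has leading coefficient
  1 and its other terms involve only larger \<open>t\<close>. So a truncated series is recovered by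
  descending recursion from the bound \<open>J\<close> beyond which it vanishes.\<close>

lemma local_sum_inj:
  assumes L: "truncated L" and L': "truncated L'" and eq: "\<And>s t. local_sum M L s t = local_sum M L' s t"
  shows "L = L'"
proof (intro ext)
  fix s t
  obtain J1 J2 where "\<And>j s. J1 \<le> j \<Longrightarrow> L s (t + of_nat j) = \<zero>\<^bsub>V\<^esub>" "\<And>j s. J2 \<le> j \<Longrightarrow> L' s (t + of_nat j) = \<zero>\<^bsub>V\<^esub>"
    using L L' unfolding truncated_def by meson
  then obtain J where J: "\<And>j s. J \<le> j \<Longrightarrow> L s (t + of_nat j) = \<zero>\<^bsub>V\<^esub>" "\<And>j s. J \<le> j \<Longrightarrow> L' s (t + of_nat j) = \<zero>\<^bsub>V\<^esub>"
    by (metis max.bounded_iff)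
  have "\<forall>s. L s (t + of_nat i) = L' s (t + of_nat i)" for i
  proof (induction "J - i" arbitrary: i rule: less_induct)
    case less
    show ?case
    proof (cases "J \<le> i")
      case True
      then show ?thesis using J by simp
    next
      case False
      then have IH: "L s (t + of_nat i + of_nat (Suc j)) = L' s (t + of_nat i + of_nat (Suc j))" for s j
        using less.hyps[of "i + Suc j"] by (simp add: algebra_simps)
      have Ji: "L s (t + of_nat i + of_nat j) = \<zero>\<^bsub>V\<^esub>" "L' s (t + of_nat i + of_nat j) = \<zero>\<^bsub>V\<^esub>" if "Suc J \<le> j" for s j
        using J[of "i + j" s] that by (simp_all add: algebra_simps)
      show ?thesis
      proof
        fix x
        \<comment> \<open>Evaluating at \<open>x - M\<close> makes the first argument of the term
          \<open>j = 0\<close> equal to \<open>x\<close>.\<close>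
        let ?f = "\<lambda>L j. emb ((-1) ^ j * (M gchoose j)) \<odot>\<^bsub>V\<^esub> L (x - M + M - of_nat j) (t + of_nat i + of_nat j)"
        have sum: "local_sum M L (x - M) (t + of_nat i) = (\<Oplus>\<^bsub>V\<^esub>j\<in>{..J}. ?f L (Suc j)) \<oplus>\<^bsub>V\<^esub> L x (t + of_nat i)"
          if "truncated L" "\<And>j s. Suc J \<le> j \<Longrightarrow> L s (t + of_nat i + of_nat j) = \<zero>\<^bsub>V\<^esub>" for L
        proof -
          have "local_sum M L (x - M) (t + of_nat i) = (\<Oplus>\<^bsub>V\<^esub>j\<in>{..Suc J}. ?f L j)"
            by (rule local_sum_eq[OF that])
          also have "\<dots> = (\<Oplus>\<^bsub>V\<^esub>j\<in>{..J}. ?f L (Suc j)) \<oplus>\<^bsub>V\<^esub> ?f L 0"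
            by (rule V.finsum_Suc2) (use that(1) in auto)
          finally show ?thesis using that(1) complex_subfieldD(1)[OF emb] by simp
        qed
        have "?f L (Suc j) = ?f L' (Suc j)" for j using IH by simp
        then have "(\<Oplus>\<^bsub>V\<^esub>j\<in>{..J}. ?f L (Suc j)) \<oplus>\<^bsub>V\<^esub> L x (t + of_nat i)
            = (\<Oplus>\<^bsub>V\<^esub>j\<in>{..J}. ?f L (Suc j)) \<oplus>\<^bsub>V\<^esub> L' x (t + of_nat i)"
          using sum[OF L Ji(1)] sum[OF L' Ji(2)] eq by simp
        moreover have "(\<Oplus>\<^bsub>V\<^esub>j\<in>{..J}. ?f L (Suc j)) \<in> carrier V" by (rule V.finsum_closed) (use L in auto)
        ultimately show "L x (t + of_nat i) = L' x (t + of_nat i)" using L L' by simp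
      qed
    qed
  qed
  from this[of 0] show "L s t = L' s t" by simp
qed

text \<open>Bounds that differ by an integer can be raised to a common value. There \<open>L\<close>
  and \<open>L'\<close> have the same product with the power of \<open>z - w\<close>, both being
  determined by \<open>R\<close>, and this power can be cancelled.\<close>

lemma local_pair_unique:
  assumes trunc: "truncated L" "truncated L'" "truncated R"
    and pair: "local_pair p M L R" "local_pair p M' L' R" and int: "M - M' \<in> \<int>"
  shows "L = L'"
proof -
  obtain i where i: "M - M' = of_int i" using int by (elim Ints_cases)
  obtain k k' :: nat where "int k - int k' = - i" by (metis diff_0_right diff_0 int_cases2 of_nat_0 minus_minus)
  then have "(of_int (int k - int k') :: complex) = of_int (- i)" by simp
  then have kk: "M + of_nat k = M' + of_nat k'" using i by (simp add: algebra_simps)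
  have "local_pair p (M + of_nat k) L R" "local_pair p (M + of_nat k) L' R"
    using local_pair_add[OF trunc(1,3) pair(1), of k] local_pair_add[OF trunc(2,3) pair(2), of k'] kk by simp_all
  then show ?thesis
    by (intro local_sum_inj[OF trunc(1,2), where M = "M + of_nat k"]) (simp add: local_pair_def)
qed

end

section \<open>Generalized vertex algebras with a charge factor\<close>

locale charged_gva =
  fixes emb :: "complex \<Rightarrow> 'k::field" and V :: "('k, 'v) gva" and Q :: "'q monoid"
    and \<Delta> :: "'q \<Rightarrow> 'q \<Rightarrow> complex set" and \<eta>Q :: "'q \<Rightarrow> 'q \<Rightarrow> complex" and G :: "'q \<Rightarrow> 'v set"
  assumes emb_subfield: "complex_subfield emb"
    and gva: "gva_with_charge_factor emb V Q \<Delta> \<eta>Q G"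

sublocale charged_gva \<subseteq> complex_space emb V
  by (rule complex_space.intro) (use emb_subfield gva in \<open>simp_all add: gva_with_charge_factor_def weak_gva_def\<close>)

context charged_gva
begin

lemma weak_gva: "weak_gva emb V" and charge_factor: "charge_factor emb V Q \<Delta> \<eta>Q G"
  using gva by (simp_all add: gva_with_charge_factor_def)

lemma vacuum_closed [simp]: "vacuum V \<in> carrier V"
  using weak_gva by (simp add: weak_gva_def)

lemma modes_linear: "a \<in> carrier V \<Longrightarrow> linear_map V V (modes V a n)"
  using weak_gva by (simp add: weak_gva_def)

lemma modes_linear_left: "b \<in> carrier V \<Longrightarrow> linear_map V V (\<lambda>a. modes V a n b)"
  using weak_gva by (simp add: weak_gva_def)

lemma translation_linear: "linear_map V V (translation V)"
  using weak_gva by (simp add: weak_gva_def)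

lemma modes_closed [simp]: "a \<in> carrier V \<Longrightarrow> b \<in> carrier V \<Longrightarrow> modes V a n b \<in> carrier V"
  using modes_linear[of a n] by (auto simp: linear_map_def)

lemma translation_closed [simp]: "a \<in> carrier V \<Longrightarrow> translation V a \<in> carrier V"
  using translation_linear by (auto simp: linear_map_def)

lemma space: "complex_space emb V" ..

lemma modes_zero [simp]: "a \<in> carrier V \<Longrightarrow> modes V a n \<zero>\<^bsub>V\<^esub> = \<zero>\<^bsub>V\<^esub>"
  by (rule linear_map_zero[OF space space modes_linear])

lemma translation_modes:
  assumes "a \<in> carrier V" "b \<in> carrier V"
  shows "translation V (modes V a n b) = modes V a n (translation V b) \<oplus>\<^bsub>V\<^esub> emb (- n) \<odot>\<^bsub>V\<^esub> modes V a (n - 1) b"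
proof -
  let ?x = "translation V (modes V a n b)" and ?y = "modes V a n (translation V b)"
  have "?x \<ominus>\<^bsub>V\<^esub> ?y = emb (- n) \<odot>\<^bsub>V\<^esub> modes V a (n - 1) b"
    using weak_gva assms by (simp add: weak_gva_def)
  moreover have "?y \<oplus>\<^bsub>V\<^esub> (?x \<ominus>\<^bsub>V\<^esub> ?y) = ?x"
    using assms V.a_lcomm[of ?y ?x "\<ominus>\<^bsub>V\<^esub> ?y"] by (simp add: a_minus_def V.r_neg)
  ultimately show ?thesis by simp
qed

lemma modes_vacuum:
  assumes "a \<in> carrier V"
  shows "modes V a (-1) (vacuum V) = a" "- n - 1 \<notin> \<nat> \<Longrightarrow> modes V a n (vacuum V) = \<zero>\<^bsub>V\<^esub>"
proof -
  have *: "\<forall>a\<in>carrier V. modes V a (-1) (vacuum V) = a \<and>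
      (\<forall>n. (\<nexists>k::nat. - n - 1 = of_nat k) \<longrightarrow> modes V a n (vacuum V) = \<zero>\<^bsub>V\<^esub>)"
    using weak_gva unfolding weak_gva_def by blast
  show "modes V a (-1) (vacuum V) = a" using * assms by blast
  show "modes V a n (vacuum V) = \<zero>\<^bsub>V\<^esub>" if "- n - 1 \<notin> \<nat>"
    using * assms that by (metis of_nat_in_Nats)
qed

lemma translation_vacuum: "translation V (vacuum V) = \<zero>\<^bsub>V\<^esub>"
  using weak_gva by (simp add: weak_gva_def)

text \<open>This recursion is the coefficient form of Y(a,z)|0> = exp(zT)a. It determines all the
  vectors a(n)|0> with \<open>n\<close> a negative integer from \<open>a\<close> and the translation
  operator.\<close>

lemma modes_vacuum_Suc:
  assumes "a \<in> carrier V"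
  shows "emb (of_nat (Suc k)) \<odot>\<^bsub>V\<^esub> modes V a (- of_nat (Suc k) - 1) (vacuum V)
    = translation V (modes V a (- of_nat k - 1) (vacuum V))"
  using assms translation_modes[OF assms vacuum_closed, of "- of_nat k - 1"]
  by (simp add: translation_vacuum algebra_simps)

lemma group: "comm_group Q"
  using charge_factor by (simp add: charge_factor_def)

lemma submodule_G: "\<alpha> \<in> carrier Q \<Longrightarrow> submodule (G \<alpha>) (ring_of_type_algebra :: 'k ring) V"
  using charge_factor by (simp add: charge_factor_def is_grading_def)

lemma G_closed: "\<alpha> \<in> carrier Q \<Longrightarrow> a \<in> G \<alpha> \<Longrightarrow> a \<in> carrier V"
  using submoduleD(1)[OF submodule_G] by blast

lemma vacuum_G: "vacuum V \<in> G \<one>\<^bsub>Q\<^esub>"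
  using charge_factor by (simp add: charge_factor_def)

lemma \<Delta>_coset:
  assumes "\<alpha> \<in> carrier Q" "\<beta> \<in> carrier Q"
  shows "\<exists>c. \<Delta> \<alpha> \<beta> = c +o \<int>"
proof -
  have "\<Delta> \<alpha> \<beta> \<in> complex_mod_int"
    using charge_factor assms by (simp add: charge_factor_def symmetric_biadditive_def)
  then show ?thesis by (auto simp: complex_mod_int_def)
qed

lemma \<Delta>_diff:
  assumes "\<alpha> \<in> carrier Q" "\<beta> \<in> carrier Q" "x \<in> \<Delta> \<alpha> \<beta>"
  shows "y \<in> \<Delta> \<alpha> \<beta> \<longleftrightarrow> y - x \<in> \<int>"
proof -
  obtain c where c: "\<Delta> \<alpha> \<beta> = c +o \<int>" using \<Delta>_coset assms by blast
  have mem: "z \<in> \<Delta> \<alpha> \<beta> \<longleftrightarrow> c - z \<in> \<int>" for z using not_in_coset_iff[of z c] c by blast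
  then have x: "c - x \<in> \<int>" using assms(3) by blast
  have "c - y = (c - x) - (y - x)" "y - x = (c - x) - (c - y)" by simp_all
  then show ?thesis unfolding mem using x Ints_diff by metis
qed

lemma field_of_charge:
  assumes "\<alpha> \<in> carrier Q" "\<beta> \<in> carrier Q" "a \<in> G \<alpha>" "b \<in> G \<beta>"
  shows "modes V a n b \<in> G (\<alpha> \<otimes>\<^bsub>Q\<^esub> \<beta>)"
    "n \<notin> \<Delta> \<alpha> \<beta> \<Longrightarrow> modes V a n b = \<zero>\<^bsub>V\<^esub>"
    "\<exists>J. \<forall>j\<ge>J. modes V a (n + of_nat j) b = \<zero>\<^bsub>V\<^esub>"
proof -
  have f: "(\<lambda>e. modes V a (- e - 1) b) \<in> series_space V (G (\<alpha> \<otimes>\<^bsub>Q\<^esub> \<beta>)) (uminus ` \<Delta> \<alpha> \<beta>)"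
    using charge_factor assms by (simp add: charge_factor_def field_of_charge_def)
  then have "modes V a (- (- n - 1) - 1) b \<in> G (\<alpha> \<otimes>\<^bsub>Q\<^esub> \<beta>)" unfolding series_space_def by blast
  then show "modes V a n b \<in> G (\<alpha> \<otimes>\<^bsub>Q\<^esub> \<beta>)" by simp
  obtain D where D: "finite D" "D \<subseteq> uminus ` \<Delta> \<alpha> \<beta>"
    "\<And>e. modes V a (- e - 1) b \<noteq> \<zero>\<^bsub>V\<^esub> \<Longrightarrow> \<exists>d\<in>D. \<exists>k::nat. e = d + of_nat k"
    using f unfolding series_space_def by blast
  have nz: "\<exists>d\<in>D. \<exists>k::nat. - n - 1 = d + of_nat k" if "modes V a n b \<noteq> \<zero>\<^bsub>V\<^esub>" for n
    using D(3)[of "- n - 1"] that by simp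
  show "modes V a n b = \<zero>\<^bsub>V\<^esub>" if n: "n \<notin> \<Delta> \<alpha> \<beta>"
  proof (rule ccontr)
    assume "modes V a n b \<noteq> \<zero>\<^bsub>V\<^esub>"
    from nz[OF this] obtain d k where d: "d \<in> D" "- n - 1 = d + of_nat k" by blast
    then obtain x where x: "x \<in> \<Delta> \<alpha> \<beta>" "d = - x" using D(2) by blast
    have "n - x = - of_nat (Suc k)" using d(2) x(2) by (simp add: algebra_simps)
    then have "n - x \<in> \<int>" by simp
    then show False using \<Delta>_diff[OF assms(1,2) x(1)] n by blast
  qed
  show "\<exists>J. \<forall>j\<ge>J. modes V a (n + of_nat j) b = \<zero>\<^bsub>V\<^esub>"
  proof -
    have "finite (Re ` D)" using D(1) by simp
    \<comment> \<open>The finitely many starting exponents have real parts bounded below, while the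
      exponent belonging to the mode \<open>n + j\<close> tends to minus infinity with
      \<open>j\<close>.\<close>
    then obtain m where m: "\<And>d. d \<in> D \<Longrightarrow> m \<le> Re d" by (metis bdd_below.E bdd_below_finite image_eqI)
    have "modes V a (n + of_nat j) b = \<zero>\<^bsub>V\<^esub>" if j: "nat \<lceil>\<bar>m\<bar> + \<bar>Re n\<bar>\<rceil> \<le> j" for j
    proof (rule ccontr)
      assume "modes V a (n + of_nat j) b \<noteq> \<zero>\<^bsub>V\<^esub>"
      from nz[OF this] obtain d k where d: "d \<in> D" "- (n + of_nat j) - 1 = d + of_nat k" by blast
      then have "- Re n - real j - 1 = Re d + real k" by (metis add_diff_eq complex_Re_of_nat diff_diff_eq minus_complex.sel(1) one_complex.sel(1) plus_complex.sel(1) uminus_add_conv_diff uminus_complex.sel(1) diff_minus_eq_add minus_add_distrib)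
      then show False using m[OF d(1)] j by linarith
    qed
    then show ?thesis by blast
  qed
qed

lemma mutually_local:
  assumes "\<alpha> \<in> carrier Q" "\<beta> \<in> carrier Q" "a \<in> G \<alpha>" "b \<in> G \<beta>"
  obtains M where "locality_bound emb V (\<Delta> \<alpha> \<beta>) (\<eta>Q \<alpha> \<beta>) M (modes V a) (modes V b)"
proof -
  have "mutually_local emb V (\<Delta> \<alpha> \<beta>) (\<eta>Q \<alpha> \<beta>) (modes V a) (modes V b)"
    using charge_factor assms by (simp add: charge_factor_def)
  then show ?thesis using that unfolding mutually_local_def by blast
qed

lemma locality_bound_local_pair:
  assumes "locality_bound emb V \<Gamma> p M a b" "c \<in> carrier V"
  shows "local_pair p M (\<lambda>s t. a s (b t c)) (\<lambda>t s. b t (a s c))"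
  using assms by (simp add: locality_bound_def local_pair_def local_sum_def)

lemma truncated_modes:
  assumes "\<beta> \<in> carrier Q" "\<gamma> \<in> carrier Q" "b \<in> G \<beta>" "c \<in> G \<gamma>" "\<And>s x. x \<in> carrier V \<Longrightarrow> a s x \<in> carrier V"
    "\<And>s. a s \<zero>\<^bsub>V\<^esub> = \<zero>\<^bsub>V\<^esub>"
  shows "truncated (\<lambda>s t. a s (modes V b t c))"
  unfolding truncated_def
proof (intro conjI allI)
  show "a s (modes V b t c) \<in> carrier V" for s t
    using assms(5) modes_closed G_closed assms(1-4) by blast
  show "\<exists>J. \<forall>j\<ge>J. \<forall>s. a s (modes V b (t + of_nat j) c) = \<zero>\<^bsub>V\<^esub>" for t
    using field_of_charge(3)[OF assms(1-4), of t] assms(6) by metis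
qed

end

section \<open>Evaluation of words in a generalized vertex algebra\<close>

locale free_gva_target = charged_gva emb V Q \<Delta> \<eta>Q G
  for emb :: "complex \<Rightarrow> 'k::field" and V :: "('k, 'v) gva" and Q :: "'q monoid"
    and \<Delta> :: "'q \<Rightarrow> 'q \<Rightarrow> complex set" and \<eta>Q :: "'q \<Rightarrow> 'q \<Rightarrow> complex" and G :: "'q \<Rightarrow> 'v set" +
  fixes B :: "'b set" and N :: "'b \<Rightarrow> 'b \<Rightarrow> complex"
    and \<eta> :: "('b \<Rightarrow>\<^sub>0 int) \<Rightarrow> ('b \<Rightarrow>\<^sub>0 int) \<Rightarrow> complex"
    and \<rho> :: "('b \<Rightarrow>\<^sub>0 int) \<Rightarrow> 'q" and i :: "'b \<Rightarrow> 'v"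
  assumes N_sym: "\<And>a b. a \<in> B \<Longrightarrow> b \<in> B \<Longrightarrow> N a b = N b a"
    and \<rho>_hom: "\<rho> \<in> hom (free_Abelian_group B) Q"
    and \<rho>_\<Delta>: "\<And>\<alpha> \<beta>. \<alpha> \<in> carrier (free_Abelian_group B) \<Longrightarrow> \<beta> \<in> carrier (free_Abelian_group B)
      \<Longrightarrow> biadd_ext N \<alpha> \<beta> +o \<int> = \<Delta> (\<rho> \<alpha>) (\<rho> \<beta>)"
    and \<rho>_\<eta>: "\<And>\<alpha> \<beta>. \<alpha> \<in> carrier (free_Abelian_group B) \<Longrightarrow> \<beta> \<in> carrier (free_Abelian_group B)
      \<Longrightarrow> \<eta> \<alpha> \<beta> = \<eta>Q (\<rho> \<alpha>) (\<rho> \<beta>)"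
    and i_G: "\<And>b. b \<in> B \<Longrightarrow> i b \<in> G (\<rho> (frag_of b))"
    and bound: "\<And>b c. b \<in> B \<Longrightarrow> c \<in> B \<Longrightarrow>
      locality_bound emb V (\<Delta> (\<rho> (frag_of b)) (\<rho> (frag_of c)))
        (\<eta>Q (\<rho> (frag_of b)) (\<rho> (frag_of c))) (N b c) (modes V (i b)) (modes V (i c))"
begin

abbreviation "QB \<equiv> free_Abelian_group B"
abbreviation "W \<equiv> free_relations emb B N \<eta>"

fun act :: "'b word \<Rightarrow> 'v" where
  "act [] = vacuum V"
| "act (x # w) = modes V (i (fst x)) (snd x) (act w)"

lemma frag_of_closed: "b \<in> B \<Longrightarrow> frag_of b \<in> carrier QB"
  by simp

lemma charge_w_closed: "w \<in> lists (B \<times> UNIV) \<Longrightarrow> charge_w w \<in> carrier QB"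
proof (induction w)
  case (Cons x w)
  then show ?case using Poly_Mapping.keys_add[of "frag_of (fst x)" "charge_w w"] by auto
qed simp

lemma \<rho>_closed: "\<alpha> \<in> carrier QB \<Longrightarrow> \<rho> \<alpha> \<in> carrier Q"
  using \<rho>_hom by (auto simp: hom_def)

lemma \<rho>_add: "\<alpha> \<in> carrier QB \<Longrightarrow> \<beta> \<in> carrier QB \<Longrightarrow> \<rho> (\<alpha> + \<beta>) = \<rho> \<alpha> \<otimes>\<^bsub>Q\<^esub> \<rho> \<beta>"
  using \<rho>_hom by (auto simp: hom_def)

lemma \<rho>_zero: "\<rho> 0 = \<one>\<^bsub>Q\<^esub>"
proof -
  have "group Q" using group by (simp add: comm_group_def)
  then interpret group_hom QB Q \<rho>
    using \<rho>_hom by (simp add: group_hom_def group_hom_axioms_def)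
  show ?thesis using hom_one by simp
qed

lemma i_closed: "b \<in> B \<Longrightarrow> i b \<in> carrier V"
  using G_closed[OF \<rho>_closed[OF frag_of_closed] i_G] .

lemma act_G: "w \<in> lists (B \<times> UNIV) \<Longrightarrow> act w \<in> G (\<rho> (charge_w w))"
proof (induction w)
  case Nil
  then show ?case using vacuum_G by (simp add: \<rho>_zero)
next
  case (Cons x w)
  then have x: "fst x \<in> B" and w: "w \<in> lists (B \<times> UNIV)" by auto
  have "modes V (i (fst x)) (snd x) (act w) \<in> G (\<rho> (frag_of (fst x)) \<otimes>\<^bsub>Q\<^esub> \<rho> (charge_w w))"
    by (intro field_of_charge(1) \<rho>_closed frag_of_closed charge_w_closed i_G x w Cons.IH)
  then show ?case using \<rho>_add[OF frag_of_closed[OF x] charge_w_closed[OF w]] by simp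
qed

lemma act_closed: "w \<in> lists (B \<times> UNIV) \<Longrightarrow> act w \<in> carrier V"
  using G_closed[OF \<rho>_closed[OF charge_w_closed] act_G] .

lemma act_truncated:
  assumes "b \<in> B" "c \<in> lists (B \<times> UNIV)"
  shows "\<exists>J. \<forall>j\<ge>J. act ((b, t + of_nat j) # c) = \<zero>\<^bsub>V\<^esub>"
  using field_of_charge(3)[OF \<rho>_closed[OF frag_of_closed] \<rho>_closed[OF charge_w_closed] i_G act_G, of b c t]
    assms by auto

lemma act_append_zero:
  "u \<in> lists (B \<times> UNIV) \<Longrightarrow> act v = \<zero>\<^bsub>V\<^esub> \<Longrightarrow> act (u @ v) = \<zero>\<^bsub>V\<^esub>"
  by (induction u) (auto simp: i_closed)

section \<open>Evaluation of infinite combinations\<close>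

definition act_support :: "('b word \<Rightarrow> 'k) \<Rightarrow> 'b word set" where
  "act_support f = {w \<in> lists (B \<times> UNIV). f w \<noteq> 0 \<and> act w \<noteq> \<zero>\<^bsub>V\<^esub>}"

text \<open>Words that act by zero are left out of the sum, which is then finite for every element
  of the completion (\<open>finite_act_support\<close>), even if the combination itself is
  infinite.\<close>

definition eval_w :: "('b word \<Rightarrow> 'k) \<Rightarrow> 'v" where
  "eval_w f = (\<Oplus>\<^bsub>V\<^esub>w\<in>act_support f. f w \<odot>\<^bsub>V\<^esub> act w)"

lemma eval_w_eq:
  assumes "finite A" "A \<subseteq> lists (B \<times> UNIV)" "act_support f \<subseteq> A"
  shows "eval_w f = (\<Oplus>\<^bsub>V\<^esub>w\<in>A. f w \<odot>\<^bsub>V\<^esub> act w)"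
  unfolding eval_w_def
proof (rule V.add.finprod_mono_neutral_cong_left[OF assms(1,3)])
  show "f w \<odot>\<^bsub>V\<^esub> act w = \<zero>\<^bsub>V\<^esub>" if "w \<in> A - act_support f" for w
  proof -
    have "w \<in> lists (B \<times> UNIV)" using that assms(2) by blast
    then have "act w \<in> carrier V" "f w = 0 \<or> act w = \<zero>\<^bsub>V\<^esub>" using that act_closed unfolding act_support_def by blast+
    then show ?thesis by (elim disjE) simp_all
  qed
  show "(\<lambda>w. f w \<odot>\<^bsub>V\<^esub> act w) \<in> A \<rightarrow> carrier V" using assms(2) act_closed by blast
qed simp

lemma eval_w_mem:
  assumes U: "submodule U (ring_of_type_algebra :: 'k ring) V" and "finite (act_support f)"
    and mem: "\<And>w. w \<in> act_support f \<Longrightarrow> act w \<in> U"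
  shows "eval_w f \<in> U"
proof -
  have "(\<Oplus>\<^bsub>V\<^esub>w\<in>A. f w \<odot>\<^bsub>V\<^esub> act w) \<in> U" if "finite A" "A \<subseteq> act_support f" for A
    using that
  proof (induction A rule: finite_induct)
    case empty
    then show ?case using submoduleD(2)[OF U] by simp
  next
    case (insert w A)
    have "(\<lambda>w. f w \<odot>\<^bsub>V\<^esub> act w) \<in> insert w A \<rightarrow> carrier V"
      using insert.prems act_closed unfolding act_support_def by blast
    then have "(\<Oplus>\<^bsub>V\<^esub>w\<in>insert w A. f w \<odot>\<^bsub>V\<^esub> act w) = f w \<odot>\<^bsub>V\<^esub> act w \<oplus>\<^bsub>V\<^esub> (\<Oplus>\<^bsub>V\<^esub>w\<in>A. f w \<odot>\<^bsub>V\<^esub> act w)"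
      using insert.hyps by (intro V.finsum_insert) auto
    then show ?case using insert submoduleD(3,4)[OF U] mem by simp
  qed
  then show ?thesis using assms(2) by (simp add: eval_w_def)
qed

lemma eval_w_closed: "finite (act_support f) \<Longrightarrow> eval_w f \<in> carrier V"
  by (intro eval_w_mem V.carrier_is_submodule act_closed) (auto simp: act_support_def)

lemma act_support_add: "act_support (f + g) \<subseteq> act_support f \<union> act_support g"
  by (auto simp: act_support_def)

lemma act_support_scale: "act_support (wscale c f) \<subseteq> act_support f"
  by (auto simp: act_support_def wscale_def)

lemma act_support_lists: "act_support f \<subseteq> lists (B \<times> UNIV)"
  by (auto simp: act_support_def)

lemma eval_w_add:
  assumes "finite (act_support f)" "finite (act_support g)"
  shows "eval_w (f + g) = eval_w f \<oplus>\<^bsub>V\<^esub> eval_w g"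
proof -
  let ?A = "act_support f \<union> act_support g"
  have A: "finite ?A" "?A \<subseteq> lists (B \<times> UNIV)" using assms act_support_lists by auto
  have cl: "f w \<odot>\<^bsub>V\<^esub> act w \<in> carrier V" if "w \<in> ?A" for f w using that A(2) act_closed by blast
  have "eval_w (f + g) = (\<Oplus>\<^bsub>V\<^esub>w\<in>?A. (f + g) w \<odot>\<^bsub>V\<^esub> act w)"
    by (rule eval_w_eq[OF A act_support_add])
  also have "\<dots> = (\<Oplus>\<^bsub>V\<^esub>w\<in>?A. f w \<odot>\<^bsub>V\<^esub> act w \<oplus>\<^bsub>V\<^esub> g w \<odot>\<^bsub>V\<^esub> act w)"
  proof (rule V.finsum_cong'[OF refl])
    show "(\<lambda>w. f w \<odot>\<^bsub>V\<^esub> act w \<oplus>\<^bsub>V\<^esub> g w \<odot>\<^bsub>V\<^esub> act w) \<in> ?A \<rightarrow> carrier V" using cl by blast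
    show "(f + g) w \<odot>\<^bsub>V\<^esub> act w = f w \<odot>\<^bsub>V\<^esub> act w \<oplus>\<^bsub>V\<^esub> g w \<odot>\<^bsub>V\<^esub> act w" if "w \<in> ?A" for w
      unfolding plus_fun_apply by (rule smult_add_left) (use that A(2) act_closed in blast)
  qed
  also have "\<dots> = (\<Oplus>\<^bsub>V\<^esub>w\<in>?A. f w \<odot>\<^bsub>V\<^esub> act w) \<oplus>\<^bsub>V\<^esub> (\<Oplus>\<^bsub>V\<^esub>w\<in>?A. g w \<odot>\<^bsub>V\<^esub> act w)"
    by (rule V.finsum_addf) (use cl in blast)+
  also have "\<dots> = eval_w f \<oplus>\<^bsub>V\<^esub> eval_w g"
    using eval_w_eq[OF A, of f] eval_w_eq[OF A, of g] by simp
  finally show ?thesis .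
qed

lemma eval_w_scale:
  assumes "finite (act_support f)"
  shows "eval_w (wscale c f) = c \<odot>\<^bsub>V\<^esub> eval_w f"
proof -
  have cl: "act w \<in> carrier V" if "w \<in> act_support f" for w using that act_closed act_support_lists by blast
  have "eval_w (wscale c f) = (\<Oplus>\<^bsub>V\<^esub>w\<in>act_support f. wscale c f w \<odot>\<^bsub>V\<^esub> act w)"
    by (rule eval_w_eq[OF assms act_support_lists act_support_scale])
  also have "\<dots> = (\<Oplus>\<^bsub>V\<^esub>w\<in>act_support f. c \<odot>\<^bsub>V\<^esub> (f w \<odot>\<^bsub>V\<^esub> act w))"
    by (rule V.finsum_cong'[OF refl]) (use cl in \<open>auto simp: wscale_def smult_mult\<close>)
  also have "\<dots> = c \<odot>\<^bsub>V\<^esub> eval_w f"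
    unfolding eval_w_def by (rule V.finsum_smult_ldistr[symmetric]) (use assms cl in auto)
  finally show ?thesis .
qed

lemma act_support_monom: "act_support (monom_w w) \<subseteq> {w}"
  by (auto simp: act_support_def monom_w_def)

lemma finite_act_support_monom: "finite (act_support (monom_w w))"
  by (rule finite_subset[OF act_support_monom]) simp

lemma eval_w_monom:
  assumes "w \<in> lists (B \<times> UNIV)"
  shows "eval_w (monom_w w) = act w"
proof -
  have "eval_w (monom_w w) = (\<Oplus>\<^bsub>V\<^esub>v\<in>{w}. monom_w w v \<odot>\<^bsub>V\<^esub> act v)"
    by (rule eval_w_eq) (use assms act_support_monom in auto)
  also have "\<dots> = monom_w w w \<odot>\<^bsub>V\<^esub> act w \<oplus>\<^bsub>V\<^esub> \<zero>\<^bsub>V\<^esub>"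
    by (subst V.finsum_insert) (use assms act_closed in auto)
  finally show ?thesis using act_closed[OF assms] by (simp add: monom_w_def)
qed

lemma eval_w_letter:
  assumes a: "a \<in> B" and f: "finite (act_support f)"
  shows "finite (act_support (wmult (monom_w [(a, n)]) f))"
    "eval_w (wmult (monom_w [(a, n)]) f) = modes V (i a) n (eval_w f)"
proof -
  let ?f = "wmult (monom_w [(a, n)]) f" and ?c = "Cons (a, n)"
  have sub: "act_support ?f \<subseteq> ?c ` act_support f"
  proof
    fix w assume w: "w \<in> act_support ?f"
    then have "?f w \<noteq> 0" by (simp add: act_support_def)
    then obtain v where v: "w = (a, n) # v" "f v \<noteq> 0" by (auto simp: wmult_letter split: list.splits if_splits)
    have "act v \<noteq> \<zero>\<^bsub>V\<^esub>" using w v(1) i_closed[OF a] by (auto simp: act_support_def)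
    then show "w \<in> ?c ` act_support f" using w v by (auto simp: act_support_def)
  qed
  then show "finite (act_support ?f)" using f finite_surj by blast
  have cl: "act w \<in> carrier V" if "w \<in> act_support f" for w using that act_closed act_support_lists by blast
  have "eval_w ?f = (\<Oplus>\<^bsub>V\<^esub>w\<in>?c ` act_support f. ?f w \<odot>\<^bsub>V\<^esub> act w)"
  proof (rule eval_w_eq[OF _ _ sub])
    show "finite (?c ` act_support f)" using f by simp
    show "?c ` act_support f \<subseteq> lists (B \<times> UNIV)"
      using a by (intro image_subsetI) (simp add: act_support_def)
  qed
  also have "\<dots> = (\<Oplus>\<^bsub>V\<^esub>w\<in>act_support f. ?f (?c w) \<odot>\<^bsub>V\<^esub> act (?c w))"
  proof (rule V.finsum_reindex)
    have "act (?c w) \<in> carrier V" if "w \<in> act_support f" for w using cl[OF that] i_closed[OF a] by simp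
    then show "(\<lambda>w. ?f w \<odot>\<^bsub>V\<^esub> act w) \<in> ?c ` act_support f \<rightarrow> carrier V" by blast
    show "inj_on ?c (act_support f)" by simp
  qed
  also have "\<dots> = (\<Oplus>\<^bsub>V\<^esub>w\<in>act_support f. modes V (i a) n (f w \<odot>\<^bsub>V\<^esub> act w))"
  proof (rule V.finsum_cong'[OF refl])
    show "(\<lambda>w. modes V (i a) n (f w \<odot>\<^bsub>V\<^esub> act w)) \<in> act_support f \<rightarrow> carrier V" using cl i_closed[OF a] by auto
    show "?f (?c w) \<odot>\<^bsub>V\<^esub> act (?c w) = modes V (i a) n (f w \<odot>\<^bsub>V\<^esub> act w)" if "w \<in> act_support f" for w
      using modes_linear[OF i_closed[OF a], of n] cl[OF that] by (simp add: wmult_letter linear_map_def)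
  qed
  also have "\<dots> = modes V (i a) n (eval_w f)"
    unfolding eval_w_def
    by (rule linear_map_finsum[OF space space modes_linear[OF i_closed[OF a]] f, symmetric]) (use cl in auto)
  finally show "eval_w ?f = modes V (i a) n (eval_w f)" .
qed

lemma eval_w_sum:
  assumes "finite A" "\<And>j. j \<in> A \<Longrightarrow> finite (act_support (g j))"
  shows "finite (act_support (\<Sum>j\<in>A. g j)) \<and> eval_w (\<Sum>j\<in>A. g j) = (\<Oplus>\<^bsub>V\<^esub>j\<in>A. eval_w (g j))"
  using assms
proof (induction A rule: finite_induct)
  case empty
  have zero: "act_support 0 = {}" by (simp add: act_support_def)
  show ?case unfolding sum.empty eval_w_def zero V.finsum_empty by simp
next
  case (insert x A)
  then have IH: "finite (act_support (\<Sum>j\<in>A. g j))" "eval_w (\<Sum>j\<in>A. g j) = (\<Oplus>\<^bsub>V\<^esub>j\<in>A. eval_w (g j))"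
    and x: "finite (act_support (g x))" by simp_all
  have fin: "finite (act_support (g x + (\<Sum>j\<in>A. g j)))"
    by (rule finite_subset[OF act_support_add]) (use IH x in simp)
  have sum: "(\<Oplus>\<^bsub>V\<^esub>j\<in>insert x A. eval_w (g j)) = eval_w (g x) \<oplus>\<^bsub>V\<^esub> (\<Oplus>\<^bsub>V\<^esub>j\<in>A. eval_w (g j))"
    using insert by (intro V.finsum_insert) (auto intro: eval_w_closed)
  show ?case
    unfolding sum.insert[OF insert.hyps] eval_w_add[OF x IH(1)] IH(2) sum by (intro conjI fin refl)
qed

section \<open>The kernel of evaluation\<close>

definition eval_kernel :: "('b word \<Rightarrow> 'k) set" where
  "eval_kernel = {f. finite (act_support f) \<and> eval_w f = \<zero>\<^bsub>V\<^esub>}"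

lemma eval_kernelI: "act_support f = {} \<Longrightarrow> f \<in> eval_kernel"
  by (simp add: eval_kernel_def eval_w_def)

lemma monom_eval_kernel: "w \<in> lists (B \<times> UNIV) \<Longrightarrow> monom_w w \<in> eval_kernel \<longleftrightarrow> act w = \<zero>\<^bsub>V\<^esub>"
  by (simp add: eval_kernel_def eval_w_monom finite_act_support_monom)

lemma subspace_eval_kernel: "WS.subspace eval_kernel"
proof (unfold WS.subspace_def, intro conjI ballI allI)
  show "0 \<in> eval_kernel" by (rule eval_kernelI) (simp add: act_support_def)
next
  fix f g assume "f \<in> eval_kernel" "g \<in> eval_kernel"
  then show "f + g \<in> eval_kernel"
    using finite_subset[OF act_support_add[of f g]] eval_w_add[of f g] by (simp add: eval_kernel_def)
next
  fix c f assume "f \<in> eval_kernel"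
  then show "wscale c f \<in> eval_kernel"
    using finite_subset[OF act_support_scale[of c f]] eval_w_scale[of f c] by (simp add: eval_kernel_def)
qed

lemma act_charge_zero:
  assumes "a \<in> B" "w \<in> lists (B \<times> UNIV)" "pair_sum N a w - n \<notin> \<int>"
  shows "act ((a, n) # w) = \<zero>\<^bsub>V\<^esub>"
proof -
  have "n \<notin> \<Delta> (\<rho> (frag_of a)) (\<rho> (charge_w w))"
    using \<rho>_\<Delta>[OF frag_of_closed[OF assms(1)] charge_w_closed[OF assms(2)]] assms(3)
      not_in_coset_iff[of n "pair_sum N a w"] by (simp add: biadd_ext_charge_w)
  then show ?thesis
    using field_of_charge(2)[OF \<rho>_closed[OF frag_of_closed[OF assms(1)]] \<rho>_closed[OF charge_w_closed[OF assms(2)]]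
        i_G[OF assms(1)] act_G[OF assms(2)]] by simp
qed

text \<open>Every word of the remainder consists of one letter in front of a tail that acts by zero,
  so none contributes. This makes \<open>swap_tail\<close> immediate for the kernel.\<close>

lemma act_support_swap_rel:
  assumes "a \<in> B" "b \<in> B" "\<And>j. J \<le> j \<Longrightarrow> act ((b, t + of_nat j) # c) = \<zero>\<^bsub>V\<^esub>"
    "\<And>j. J \<le> j \<Longrightarrow> act ((a, s + of_nat j) # c) = \<zero>\<^bsub>V\<^esub>"
  shows "act_support (swap_rel emb M p a b s t c J) = {}"
proof -
  have "act w = \<zero>\<^bsub>V\<^esub>" if w: "swap_rel emb M p a b s t c J w \<noteq> 0" for w
  proof -
    obtain j where "J \<le> j" "w = (a, s + M - of_nat j) # (b, t + of_nat j) # c \<or> w = (b, t + M - of_nat j) # (a, s + of_nat j) # c"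
      using swap_rel_nonzero[OF w] by blast
    then show ?thesis using assms(3,4)[of j] i_closed assms(1,2) by auto
  qed
  then show ?thesis by (auto simp: act_support_def)
qed

lemma swap_rel_eval_kernel:
  assumes a: "a \<in> B" and b: "b \<in> B" and c: "c \<in> lists (B \<times> UNIV)"
  shows "swap_rel emb (N a b) (local_factor emb N \<eta> a b) a b s t c 0 \<in> eval_kernel"
proof -
  let ?p = "local_factor emb N \<eta> a b"
  let ?W1 = "\<lambda>j. (a, s + N a b - of_nat j) # (b, t + of_nat j) # c"
  let ?W2 = "\<lambda>j. (b, t + N a b - of_nat j) # (a, s + of_nat j) # c"
  let ?\<kappa> = "\<lambda>j. emb ((-1) ^ j * (N a b gchoose j))"
  let ?L = "\<lambda>s t. modes V (i a) s (modes V (i b) t (act c))"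
  let ?R = "\<lambda>t s. modes V (i b) t (modes V (i a) s (act c))"
  obtain J1 where J1: "\<And>j. J1 \<le> j \<Longrightarrow> act ((b, t + of_nat j) # c) = \<zero>\<^bsub>V\<^esub>" using act_truncated[OF b c] by blast
  obtain J2 where J2: "\<And>j. J2 \<le> j \<Longrightarrow> act ((a, s + of_nat j) # c) = \<zero>\<^bsub>V\<^esub>" using act_truncated[OF a c] by blast
  \<comment> \<open>Both fields are truncated on \<open>act c\<close>, so all tails from
    \<open>J\<close> on act by zero. The terms up to \<open>J\<close> carry the whole locality
    identity, and the remainder has empty support.\<close>
  define J where "J = max J1 J2"
  have J: "act ((b, t + of_nat j) # c) = \<zero>\<^bsub>V\<^esub>" "act ((a, s + of_nat j) # c) = \<zero>\<^bsub>V\<^esub>" if "J \<le> j" for j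
    using J1 J2 that by (simp_all add: J_def)
  have lists: "?W1 j \<in> lists (B \<times> UNIV)" "?W2 j \<in> lists (B \<times> UNIV)" for j using a b c by auto
  have tail: "swap_rel emb (N a b) ?p a b s t c (Suc J) \<in> eval_kernel"
    by (intro eval_kernelI act_support_swap_rel[OF a b] J) simp_all
  note carr = \<rho>_closed[OF frag_of_closed[OF a]] \<rho>_closed[OF frag_of_closed[OF b]] \<rho>_closed[OF charge_w_closed[OF c]]
  have tr: "truncated ?L" "truncated ?R"
    using truncated_modes[OF carr(2,3) i_G[OF b] act_G[OF c], of "modes V (i a)"]
      truncated_modes[OF carr(1,3) i_G[OF a] act_G[OF c], of "modes V (i b)"] i_closed a b by simp_all
  have "local_pair (\<eta> (frag_of a) (frag_of b)) (N a b) ?L ?R"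
    using locality_bound_local_pair[OF bound[OF a b] act_closed[OF c]]
    unfolding \<rho>_\<eta>[OF frag_of_closed[OF a] frag_of_closed[OF b]] .
  then have loc: "local_sum (N a b) ?L s t = ?p \<odot>\<^bsub>V\<^esub> local_sum (N a b) ?R t s"
    unfolding local_pair_def by blast
  have cl: "act (?W1 j) \<in> carrier V" "act (?W2 j) \<in> carrier V" for j using act_closed[OF lists(1)] act_closed[OF lists(2)] by auto
  have sumL: "local_sum (N a b) ?L s t = (\<Oplus>\<^bsub>V\<^esub>j\<in>{..J}. ?\<kappa> j \<odot>\<^bsub>V\<^esub> act (?W1 j))"
    using local_sum_eq[OF tr(1), of J t "N a b" s] J(1) i_closed[OF a] by simp
  have sumR: "local_sum (N a b) ?R t s = (\<Oplus>\<^bsub>V\<^esub>j\<in>{..J}. ?\<kappa> j \<odot>\<^bsub>V\<^esub> act (?W2 j))"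
    using local_sum_eq[OF tr(2), of J s "N a b" t] J(2) i_closed[OF b] by simp
  let ?m1 = "\<lambda>j. wscale (?\<kappa> j) (monom_w (?W1 j))" and ?m2 = "\<lambda>j. wscale (- (?p * ?\<kappa> j)) (monom_w (?W2 j))"
  have fin: "finite (act_support (wscale x (monom_w w)))" for x w
    by (rule finite_subset[OF act_support_scale finite_act_support_monom])
  have fin': "finite (act_support (?m1 j + ?m2 j))" for j
    by (rule finite_subset[OF act_support_add finite_UnI[OF fin fin]])
  have ev: "eval_w (?m1 j + ?m2 j) = ?\<kappa> j \<odot>\<^bsub>V\<^esub> act (?W1 j) \<oplus>\<^bsub>V\<^esub> (\<ominus>\<^bsub>V\<^esub> (?p \<odot>\<^bsub>V\<^esub> (?\<kappa> j \<odot>\<^bsub>V\<^esub> act (?W2 j))))" for j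
    unfolding eval_w_add[OF fin fin] eval_w_scale[OF finite_act_support_monom] eval_w_monom[OF lists(1)] eval_w_monom[OF lists(2)]
      smult_uminus[OF cl(2)] smult_mult[OF cl(2)] ..
  let ?S = "\<Sum>j\<in>{..J}. ?m1 j + ?m2 j"
  have S: "finite (act_support ?S)" "eval_w ?S = (\<Oplus>\<^bsub>V\<^esub>j\<in>{..J}. eval_w (?m1 j + ?m2 j))"
    using eval_w_sum[of "{..J}" "\<lambda>j. ?m1 j + ?m2 j"] fin' by blast+
  have "(\<Oplus>\<^bsub>V\<^esub>j\<in>{..J}. eval_w (?m1 j + ?m2 j))
      = (\<Oplus>\<^bsub>V\<^esub>j\<in>{..J}. ?\<kappa> j \<odot>\<^bsub>V\<^esub> act (?W1 j)) \<oplus>\<^bsub>V\<^esub> (\<Oplus>\<^bsub>V\<^esub>j\<in>{..J}. \<ominus>\<^bsub>V\<^esub> (?p \<odot>\<^bsub>V\<^esub> (?\<kappa> j \<odot>\<^bsub>V\<^esub> act (?W2 j))))"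
    unfolding ev by (rule V.finsum_addf) (intro Pi_I V.a_inv_closed smult_closed cl)+
  also have "(\<Oplus>\<^bsub>V\<^esub>j\<in>{..J}. \<ominus>\<^bsub>V\<^esub> (?p \<odot>\<^bsub>V\<^esub> (?\<kappa> j \<odot>\<^bsub>V\<^esub> act (?W2 j))))
      = \<ominus>\<^bsub>V\<^esub> (\<Oplus>\<^bsub>V\<^esub>j\<in>{..J}. ?p \<odot>\<^bsub>V\<^esub> (?\<kappa> j \<odot>\<^bsub>V\<^esub> act (?W2 j)))"
    by (rule finsum_uminus) (simp, intro smult_closed cl)
  also have "(\<Oplus>\<^bsub>V\<^esub>j\<in>{..J}. ?p \<odot>\<^bsub>V\<^esub> (?\<kappa> j \<odot>\<^bsub>V\<^esub> act (?W2 j))) = ?p \<odot>\<^bsub>V\<^esub> local_sum (N a b) ?R t s"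
    unfolding sumR by (rule V.finsum_smult_ldistr[symmetric]) (simp, simp, intro Pi_I smult_closed cl)
  also have "(\<Oplus>\<^bsub>V\<^esub>j\<in>{..J}. ?\<kappa> j \<odot>\<^bsub>V\<^esub> act (?W1 j)) = ?p \<odot>\<^bsub>V\<^esub> local_sum (N a b) ?R t s"
    unfolding sumL[symmetric] by (rule loc)
  also have "?p \<odot>\<^bsub>V\<^esub> local_sum (N a b) ?R t s \<oplus>\<^bsub>V\<^esub> (\<ominus>\<^bsub>V\<^esub> (?p \<odot>\<^bsub>V\<^esub> local_sum (N a b) ?R t s)) = \<zero>\<^bsub>V\<^esub>"
    by (rule V.r_neg) (intro smult_closed local_sum_closed tr)
  finally have "?S \<in> eval_kernel"
    unfolding eval_kernel_def mem_Collect_eq S(2)[symmetric] by (rule conjI[OF S(1)])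
  have split: "swap_rel emb (N a b) ?p a b s t c 0 = ?S + swap_rel emb (N a b) ?p a b s t c (Suc J)"
    unfolding swap_rel_sum[of _ _ _ _ _ _ _ _ "Suc J"] lessThan_Suc_atMost WS.scale_minus_left
    by (simp only: diff_conv_add_uminus)
  show ?thesis
    unfolding split by (rule WS.subspace_add[OF subspace_eval_kernel \<open>?S \<in> eval_kernel\<close> tail])
qed

text \<open>The second use of the rewriting; its conclusion \<open>level_not_nat\<close> now says
  that words whose level is not natural act by zero.\<close>

sublocale kernel: word_rewriting emb N "local_factor emb N \<eta>" B eval_kernel
proof
  show "emb 1 = 1" by (rule complex_subfieldD(1)[OF emb])
  show "WS.subspace eval_kernel" by (rule subspace_eval_kernel)
  show "wmult (monom_w [(a, n)]) f \<in> eval_kernel" if "a \<in> B" "f \<in> eval_kernel" for a n f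
    using eval_w_letter[OF that(1), of f n] that i_closed by (simp add: eval_kernel_def)
  show "monom_w [(a, n)] \<in> eval_kernel" if "a \<in> B" "- n - 1 \<notin> \<nat>" for a n
    using that modes_vacuum(2)[OF i_closed] by (subst monom_eval_kernel) auto
  show "monom_w ((a, n) # w) \<in> eval_kernel"
    if "a \<in> B" "w \<in> lists (B \<times> UNIV)" "w \<noteq> []" "pair_sum N a w - n \<notin> \<int>" for a n w
    using that act_charge_zero by (subst monom_eval_kernel) auto
  fix a b s t and c :: "'b word" and J :: nat
  assume ab: "a \<in> B" "b \<in> B" "c \<in> lists (B \<times> UNIV)"
  show "swap_rel emb (N a b) (local_factor emb N \<eta> a b) a b s t c 0 \<in> eval_kernel"
    by (rule swap_rel_eval_kernel[OF ab])
  assume tails: "\<And>j. J \<le> j \<Longrightarrow> monom_w ((b, t + of_nat j) # c) \<in> eval_kernel"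
    "\<And>j. J \<le> j \<Longrightarrow> monom_w ((a, s + of_nat j) # c) \<in> eval_kernel"
  have "act ((b, t + of_nat j) # c) = \<zero>\<^bsub>V\<^esub>" "act ((a, s + of_nat j) # c) = \<zero>\<^bsub>V\<^esub>" if "J \<le> j" for j
    using tails[OF that] ab monom_eval_kernel by auto
  then show "swap_rel emb (N a b) (local_factor emb N \<eta> a b) a b s t c J \<in> eval_kernel"
    by (intro eval_kernelI act_support_swap_rel[OF ab(1,2)])
qed (rule N_sym)

text \<open>A deep word has a suffix whose level is not natural. That suffix acts by zero, hence so
  does the word, and the depth needed depends only on the charge.\<close>

lemma compl_nbhd_act_support: "\<exists>n. \<forall>d f. f \<in> compl_nbhd B n \<alpha> d \<longrightarrow> act_support f = {}"
proof -
  obtain n where n: "\<And>(w :: 'b word) i. charge_w w = \<alpha> \<Longrightarrow> Re (weight_w (drop i w)) \<le> - real n - 1 \<Longrightarrow> level N (drop i w) \<notin> \<nat>"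
    using low_weight_level[of \<alpha> N] by blast
  have "act_support f = {}" if f: "f \<in> compl_nbhd B n \<alpha> d" for d f
  proof -
    have "act w = \<zero>\<^bsub>V\<^esub>" if w: "w \<in> lists (B \<times> UNIV)" "f w \<noteq> 0" for w
    proof -
      have "bad_word n w" and "f \<in> compl_comp B \<alpha> d" using f w(2) by (auto simp: compl_nbhd_iff)
      moreover from this(2) have "charge_w w = \<alpha>" using compl_compD(1) w(2) by (force simp: words_of_degree_def)
      ultimately obtain l where l: "level N (drop l w) \<notin> \<nat>" using n unfolding bad_word_def by blast
      have "drop l w \<in> lists (B \<times> UNIV)" "take l w \<in> lists (B \<times> UNIV)"
        using w(1) by (auto dest: in_set_dropD in_set_takeD)
      then show ?thesis
        using kernel.level_not_nat[OF _ l] monom_eval_kernel act_append_zero[of "take l w" "drop l w"] by simp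
    qed
    then show ?thesis by (auto simp: act_support_def)
  qed
  then show ?thesis by blast
qed

lemma finite_act_support:
  assumes "f \<in> compl_alg B"
  shows "finite (act_support f)"
  using assms
proof (induction rule: compl_alg_induct)
  case (add f g)
  then show ?case by (intro finite_subset[OF act_support_add]) simp
next
  case (comp f \<alpha> d)
  obtain n where n: "\<And>d f. f \<in> compl_nbhd B n \<alpha> d \<Longrightarrow> act_support f = {}" using compl_nbhd_act_support by blast
  obtain g h where gh: "f = g + h" "finite {w. g w \<noteq> 0}" "g \<in> compl_comp B \<alpha> d" "h \<in> compl_nbhd B n \<alpha> d"
    by (rule compl_comp_split[OF comp])
  have "act_support g \<subseteq> {w. g w \<noteq> 0}" by (auto simp: act_support_def)
  then have "act_support f \<subseteq> {w. g w \<noteq> 0}" using act_support_add[of g h] n[OF gh(4)] gh(1) by blast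
  then show ?case using gh(2) finite_subset by blast
qed

lemma free_relations_eval_kernel: "W \<subseteq> eval_kernel"
proof (rule kernel.free_relations_mem[OF _ refl])
  fix \<alpha>
  show "\<exists>n. \<forall>d. compl_nbhd B n \<alpha> d \<subseteq> eval_kernel"
    using compl_nbhd_act_support[of \<alpha>] eval_kernelI by blast
qed

end

section \<open>The homomorphism from the free generalized vertex algebra\<close>

locale free_gva_map = free_gva_target emb V Q \<Delta> \<eta>Q G B N \<eta> \<rho> i
  for emb :: "complex \<Rightarrow> 'k::field" and V :: "('k, 'v) gva" and Q :: "'q monoid"
    and \<Delta> :: "'q \<Rightarrow> 'q \<Rightarrow> complex set" and \<eta>Q :: "'q \<Rightarrow> 'q \<Rightarrow> complex" and G :: "'q \<Rightarrow> 'v set"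
    and B :: "'b set" and N :: "'b \<Rightarrow> 'b \<Rightarrow> complex"
    and \<eta> :: "('b \<Rightarrow>\<^sub>0 int) \<Rightarrow> ('b \<Rightarrow>\<^sub>0 int) \<Rightarrow> complex"
    and \<rho> :: "('b \<Rightarrow>\<^sub>0 int) \<Rightarrow> 'q" and i :: "'b \<Rightarrow> 'v" +
  fixes Y :: "('b word \<Rightarrow> 'k) set \<Rightarrow> complex \<Rightarrow> ('b word \<Rightarrow> 'k) set \<Rightarrow> ('b word \<Rightarrow> 'k) set"
  assumes F_gva: "free_gva_structure emb B N \<eta> Y"
begin

abbreviation "F \<equiv> free_gva emb B N \<eta> Y"
abbreviation "GF \<equiv> free_grading emb B N \<eta>"

lemma F_simps:
  "carrier F = (\<lambda>f. f +o W) ` compl_alg B" "\<zero>\<^bsub>F\<^esub> = W" "add F = (+)"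
  "c \<odot>\<^bsub>F\<^esub> S = wscale c ` S + W" "vacuum F = monom_w [] +o W" "modes F = Y"
  by (simp_all add: free_gva_def Let_def)

sublocale F: charged_gva emb F QB "\<lambda>\<alpha> \<beta>. biadd_ext N \<alpha> \<beta> +o \<int>" \<eta> GF
  using F_gva emb_subfield by unfold_locales (simp_all add: free_gva_structure_def)

lemma zero_in_W: "0 \<in> W"
  by (rule WS.subspace_0[OF subspace_free_relations])

lemma coset_closed: "f \<in> compl_alg B \<Longrightarrow> f +o W \<in> carrier F"
  by (simp add: F_simps(1))

lemma mem_coset: "f \<in> f +o W"
  using zero_in_W by (force simp: elt_set_plus_def)

lemma mem_cosetD: "g \<in> f +o W \<Longrightarrow> g - f \<in> W"
  by (auto simp: elt_set_plus_def)

lemma coset_eqI: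
  assumes "g - f \<in> W"
  shows "f +o W = g +o W"
proof -
  have "f + w \<in> g +o W" if "w \<in> W" for w
  proof -
    have "w - (g - f) \<in> W" by (rule WS.subspace_diff[OF subspace_free_relations that assms])
    moreover have "f + w = g + (w - (g - f))" by simp
    ultimately show ?thesis unfolding elt_set_plus_def by blast
  qed
  moreover have "g + w \<in> f +o W" if "w \<in> W" for w
  proof -
    have "w + (g - f) \<in> W" by (rule WS.subspace_add[OF subspace_free_relations that assms])
    moreover have "g + w = f + (w + (g - f))" by simp
    ultimately show ?thesis unfolding elt_set_plus_def by blast
  qed
  ultimately show ?thesis unfolding elt_set_plus_def by blast
qed

text \<open>A coset is determined by any one of its members. As the operations of the quotient are
  defined elementwise and the GVA axioms supply closedness, each operation on cosets is computed
  below by exhibiting a single member of the result.\<close>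

lemma carrier_cosetE:
  assumes "x \<in> carrier F" "f \<in> x"
  shows "f \<in> compl_alg B" "x = f +o W"
proof -
  obtain g where g: "g \<in> compl_alg B" "x = g +o W" using assms(1) unfolding F_simps(1) by blast
  have fg: "f - g \<in> W" using mem_cosetD assms(2) g(2) by blast
  then have "(f - g) + g \<in> compl_alg B"
    using free_relations_subset by (intro WS.subspace_add[OF subspace_compl_alg] g(1)) blast
  then show "f \<in> compl_alg B" by simp
  show "x = f +o W" unfolding g(2) by (rule coset_eqI[OF fg])
qed

lemma coset_add:
  assumes "f \<in> compl_alg B" "g \<in> compl_alg B"
  shows "(f +o W) \<oplus>\<^bsub>F\<^esub> (g +o W) = (f + g) +o W"
proof (rule carrier_cosetE(2))
  show "(f +o W) \<oplus>\<^bsub>F\<^esub> (g +o W) \<in> carrier F" using assms coset_closed by (intro F.V.a_closed)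
  show "f + g \<in> (f +o W) \<oplus>\<^bsub>F\<^esub> (g +o W)"
    unfolding F_simps(3) by (rule set_plus_intro[OF mem_coset mem_coset])
qed

lemma coset_scale:
  assumes "f \<in> compl_alg B"
  shows "c \<odot>\<^bsub>F\<^esub> (f +o W) = wscale c f +o W"
proof (rule carrier_cosetE(2))
  show "c \<odot>\<^bsub>F\<^esub> (f +o W) \<in> carrier F" using assms coset_closed by (intro F.smult_closed)
  have "wscale c f + 0 \<in> c \<odot>\<^bsub>F\<^esub> (f +o W)"
    unfolding F_simps(4) by (rule set_plus_intro[OF imageI[OF mem_coset] zero_in_W])
  then show "wscale c f \<in> c \<odot>\<^bsub>F\<^esub> (f +o W)" by simp
qed

section \<open>Generators and classes of words\<close>

abbreviation gen :: "'b \<Rightarrow> ('b word \<Rightarrow> 'k) set" where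
  "gen \<equiv> free_gen emb B N \<eta>"

abbreviation word_class :: "'b word \<Rightarrow> ('b word \<Rightarrow> 'k) set" where
  "word_class w \<equiv> monom_w w +o W"

lemma word_class_closed: "w \<in> lists (B \<times> UNIV) \<Longrightarrow> word_class w \<in> carrier F"
  by (intro coset_closed monom_in_compl_alg)

lemma word_class_grading: "w \<in> lists (B \<times> UNIV) \<Longrightarrow> word_class w \<in> GF (charge_w w)"
  unfolding free_grading_def
  by (intro imageI CollectI conjI monom_in_compl_alg) (auto simp: monom_w_def)

lemma gen_word_class: "gen a = word_class [(a, -1)]"
  by (simp add: free_gen_def)

lemma gen_closed: "a \<in> B \<Longrightarrow> gen a \<in> carrier F"
  unfolding gen_word_class by (rule word_class_closed) simp

lemma gen_grading: "a \<in> B \<Longrightarrow> gen a \<in> GF (frag_of a)"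
  using word_class_grading[of "[(a, -1)]"] by (simp add: gen_word_class)

lemma modes_gen: "a \<in> B \<Longrightarrow> x \<in> carrier F \<Longrightarrow> modes F (gen a) n x = free_act emb B N \<eta> a n x"
  using F_gva by (simp add: free_gva_structure_def F_simps(6))

lemma modes_gen_coset:
  assumes a: "a \<in> B" and f: "f \<in> compl_alg B"
  shows "modes F (gen a) n (f +o W) = wmult (monom_w [(a, n)]) f +o W"
proof (rule carrier_cosetE(2))
  show "modes F (gen a) n (f +o W) \<in> carrier F"
    by (intro F.modes_closed gen_closed a coset_closed f)
  have "wmult (monom_w [(a, n)]) f + 0 \<in> modes F (gen a) n (f +o W)"
    unfolding modes_gen[OF a coset_closed[OF f]] free_act_def
    by (rule set_plus_intro[OF imageI[OF mem_coset] zero_in_W])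
  then show "wmult (monom_w [(a, n)]) f \<in> modes F (gen a) n (f +o W)" by simp
qed

lemma word_class_Cons:
  "a \<in> B \<Longrightarrow> w \<in> lists (B \<times> UNIV) \<Longrightarrow> word_class ((a, n) # w) = modes F (gen a) n (word_class w)"
  by (simp add: modes_gen_coset monom_in_compl_alg wmult_monom)

lemma word_class_induct [consumes 1, case_names vacuum mode]:
  assumes "w \<in> lists (B \<times> UNIV)" "P (vacuum F)"
    and "\<And>a n w. a \<in> B \<Longrightarrow> w \<in> lists (B \<times> UNIV) \<Longrightarrow> P (word_class w) \<Longrightarrow> P (modes F (gen a) n (word_class w))"
  shows "P (word_class w)"
  using assms(1)
proof (induction w)
  case Nil
  then show ?case using assms(2) by (simp add: F_simps(5))
next
  case (Cons x w)
  obtain a n where x: "x = (a, n)" by (cases x)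
  have a: "a \<in> B" and w: "w \<in> lists (B \<times> UNIV)" using Cons.hyps x by auto
  show ?case unfolding x word_class_Cons[OF a w] by (rule assms(3)[OF a w Cons.IH])
qed

text \<open>The deep part of a series is a relation, so that finite combinations of words suffice.\<close>

lemma free_gva_induct [consumes 1, case_names word add scale]:
  assumes x: "x \<in> carrier F"
    and word: "\<And>w. w \<in> lists (B \<times> UNIV) \<Longrightarrow> P (word_class w)"
    and add: "\<And>x y. x \<in> carrier F \<Longrightarrow> y \<in> carrier F \<Longrightarrow> P x \<Longrightarrow> P y \<Longrightarrow> P (x \<oplus>\<^bsub>F\<^esub> y)"
    and scale: "\<And>c x. x \<in> carrier F \<Longrightarrow> P x \<Longrightarrow> P (c \<odot>\<^bsub>F\<^esub> x)"
  shows "P x"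
proof -
  let ?Z = "{f \<in> compl_alg B. P (f +o W)}"
  have Z: "WS.subspace ?Z"
  proof (unfold WS.subspace_def, intro conjI ballI allI)
    have one: "monom_w [] \<in> compl_alg B" by (rule monom_in_compl_alg) simp
    have "P (0 \<odot>\<^bsub>F\<^esub> word_class [])" by (intro scale coset_closed one word) simp
    then have "P (0 +o W)" unfolding coset_scale[OF one] WS.scale_zero_left .
    then show "0 \<in> ?Z" using WS.subspace_0[OF subspace_compl_alg] by blast
  next
    fix f g assume fg: "f \<in> ?Z" "g \<in> ?Z"
    then have "P ((f +o W) \<oplus>\<^bsub>F\<^esub> (g +o W))" by (intro add coset_closed) auto
    then have "P ((f + g) +o W)" using coset_add fg by simp
    then show "f + g \<in> ?Z" using fg WS.subspace_add[OF subspace_compl_alg] by blast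
  next
    fix c f assume f: "f \<in> ?Z"
    then have "P (c \<odot>\<^bsub>F\<^esub> (f +o W))" by (intro scale coset_closed) auto
    then have "P (wscale c f +o W)" using coset_scale f by simp
    then show "wscale c f \<in> ?Z" using f WS.subspace_scale[OF subspace_compl_alg] by blast
  qed
  have "f \<in> ?Z" if "f \<in> compl_alg B" for f
  proof (rule compl_alg_in_subspace[OF that Z])
    fix \<alpha> d
    have f: "homog_part \<alpha> d f \<in> compl_comp B \<alpha> d" by (rule compl_alg_homog[OF that])
    obtain n where n: "\<forall>d. compl_nbhd B n \<alpha> d \<subseteq> W"
      using compl_nbhd_in_free_relations[OF emb_subfield N_sym] by (rule exE)
    obtain g h where gh: "homog_part \<alpha> d f = g + h" "finite {w. g w \<noteq> 0}" "g \<in> compl_comp B \<alpha> d" "h \<in> compl_nbhd B n \<alpha> d"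
      by (rule compl_comp_split[OF f])
    have "g \<in> ?Z"
    proof (rule finite_support_in_subspace[OF Z gh(2)])
      fix w assume "g w \<noteq> 0"
      then have "w \<in> lists (B \<times> UNIV)" using compl_compD(1)[OF gh(3)] by (simp add: words_of_degree_def)
      then show "monom_w w \<in> ?Z" using word monom_in_compl_alg by blast
    qed
    moreover have "g +o W = homog_part \<alpha> d f +o W"
    proof (rule coset_eqI)
      have "h \<in> W" using gh(4) n by blast
      then show "homog_part \<alpha> d f - g \<in> W" unfolding gh(1) by simp
    qed
    moreover have "homog_part \<alpha> d f \<in> compl_alg B" by (rule subsetD[OF compl_comp_subset_alg f])
    ultimately show "homog_part \<alpha> d f \<in> ?Z" by simp
  qed
  moreover obtain f where "f \<in> compl_alg B" "x = f +o W" using x unfolding F_simps(1) by blast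
  ultimately show ?thesis by blast
qed

section \<open>The induced linear map\<close>

definition hom_map :: "('b word \<Rightarrow> 'k) set \<Rightarrow> 'v" where
  "hom_map x = eval_w (SOME f. f \<in> x)"

text \<open>Two representatives differ by a relation, and relations lie in the kernel of evaluation;
  the arbitrary choice in \<open>hom_map\<close> is therefore harmless.\<close>

lemma hom_map_coset:
  assumes f: "f \<in> compl_alg B"
  shows "hom_map (f +o W) = eval_w f"
proof -
  let ?g = "SOME g. g \<in> f +o W"
  have g: "?g \<in> f +o W" by (rule someI[of "\<lambda>g. g \<in> f +o W", OF mem_coset])
  then have w: "?g - f \<in> eval_kernel" using mem_cosetD free_relations_eval_kernel by blast
  then have "finite (act_support (?g - f))" "eval_w (?g - f) = \<zero>\<^bsub>V\<^esub>" by (simp_all add: eval_kernel_def)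
  then have "eval_w (f + (?g - f)) = eval_w f"
    by (simp only: eval_w_add[OF finite_act_support[OF f]] eval_w_closed[OF finite_act_support[OF f]] V.r_zero)
  then show ?thesis by (simp add: hom_map_def)
qed

lemma carrierE:
  assumes "x \<in> carrier F"
  obtains f where "f \<in> compl_alg B" "x = f +o W"
  using assms unfolding F_simps(1) by blast

lemma hom_map_word: "w \<in> lists (B \<times> UNIV) \<Longrightarrow> hom_map (word_class w) = act w"
  by (simp add: hom_map_coset monom_in_compl_alg eval_w_monom)

lemma hom_map_linear: "linear_map F V hom_map"
  unfolding linear_map_def
proof (intro conjI ballI allI)
  show "hom_map \<in> carrier F \<rightarrow> carrier V"
    by (auto elim!: carrierE simp: hom_map_coset intro!: eval_w_closed finite_act_support)
  show "hom_map (x \<oplus>\<^bsub>F\<^esub> y) = hom_map x \<oplus>\<^bsub>V\<^esub> hom_map y" if xy: "x \<in> carrier F" "y \<in> carrier F" for x y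
  proof -
    obtain f g where fg: "f \<in> compl_alg B" "x = f +o W" "g \<in> compl_alg B" "y = g +o W" using xy by (metis carrierE)
    have "f + g \<in> compl_alg B" by (rule WS.subspace_add[OF subspace_compl_alg fg(1,3)])
    then show ?thesis
      unfolding fg(2,4) coset_add[OF fg(1,3)] using fg(1,3)
      by (simp only: hom_map_coset eval_w_add finite_act_support)
  qed
  show "hom_map (c \<odot>\<^bsub>F\<^esub> x) = c \<odot>\<^bsub>V\<^esub> hom_map x" if x: "x \<in> carrier F" for c x
  proof -
    obtain f where f: "f \<in> compl_alg B" "x = f +o W" using x by (rule carrierE)
    have "wscale c f \<in> compl_alg B" by (rule WS.subspace_scale[OF subspace_compl_alg f(1)])
    then show ?thesis
      unfolding f(2) coset_scale[OF f(1)] using f(1)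
      by (simp only: hom_map_coset eval_w_scale finite_act_support)
  qed
qed

lemma hom_map_closed: "x \<in> carrier F \<Longrightarrow> hom_map x \<in> carrier V"
  and hom_map_add: "x \<in> carrier F \<Longrightarrow> y \<in> carrier F \<Longrightarrow> hom_map (x \<oplus>\<^bsub>F\<^esub> y) = hom_map x \<oplus>\<^bsub>V\<^esub> hom_map y"
  and hom_map_scale: "x \<in> carrier F \<Longrightarrow> hom_map (c \<odot>\<^bsub>F\<^esub> x) = c \<odot>\<^bsub>V\<^esub> hom_map x"
  using hom_map_linear by (auto simp: linear_map_def)

lemma hom_map_zero: "hom_map \<zero>\<^bsub>F\<^esub> = \<zero>\<^bsub>V\<^esub>"
  by (rule linear_map_zero[OF F.space space hom_map_linear])

lemma hom_map_vacuum: "hom_map (vacuum F) = vacuum V"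
  unfolding F_simps(5) by (simp add: hom_map_word)

lemma hom_map_gen: "a \<in> B \<Longrightarrow> hom_map (gen a) = i a"
  using modes_vacuum(1)[OF i_closed] by (simp add: gen_word_class hom_map_word)

lemma hom_map_modes_gen:
  assumes "a \<in> B" "x \<in> carrier F"
  shows "hom_map (modes F (gen a) n x) = modes V (i a) n (hom_map x)"
proof -
  obtain f where f: "f \<in> compl_alg B" "x = f +o W" using assms(2) by (rule carrierE)
  have "wmult (monom_w [(a, n)]) f \<in> compl_alg B"
    using assms(1) by (intro compl_alg_wmult monom_in_compl_alg f(1)) simp
  then show ?thesis
    unfolding f(2) modes_gen_coset[OF assms(1) f(1)] hom_map_coset[OF f(1)]
    using hom_map_coset eval_w_letter(2)[OF assms(1) finite_act_support[OF f(1)]] by simp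
qed

lemma hom_map_grading:
  assumes "\<alpha> \<in> carrier QB" "x \<in> GF \<alpha>"
  shows "hom_map x \<in> G (\<rho> \<alpha>)"
proof -
  obtain f where f: "f \<in> compl_alg B" "\<And>w. f w \<noteq> 0 \<Longrightarrow> charge_w w = \<alpha>" "x = f +o W"
    using assms(2) unfolding free_grading_def by blast
  have "act w \<in> G (\<rho> \<alpha>)" if "w \<in> act_support f" for w
    using that act_G[of w] f(2)[of w] by (simp add: act_support_def)
  then show ?thesis
    unfolding f(3) hom_map_coset[OF f(1)]
    by (intro eval_w_mem submodule_G \<rho>_closed assms(1) finite_act_support f(1))
qed

section \<open>Compatibility with translation and modes\<close>

lemma hom_map_translation_word:
  assumes "w \<in> lists (B \<times> UNIV)"
  shows "hom_map (translation F (word_class w)) = translation V (hom_map (word_class w))"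
  using assms
proof (induction rule: word_class_induct)
  case vacuum
  show ?case by (simp add: F.translation_vacuum hom_map_zero hom_map_vacuum translation_vacuum)
next
  case (mode a n w)
  note a = gen_closed[OF mode(1)] and w = word_class_closed[OF mode(2)]
  \<comment> \<open>Translation obeys the same commutation rule with the modes of
    \<open>gen a\<close> and of \<open>i a\<close>, so compatibility passes from a word to the word
    with one more letter.\<close>
  have "hom_map (translation F (modes F (gen a) n (word_class w)))
      = modes V (i a) n (hom_map (translation F (word_class w))) \<oplus>\<^bsub>V\<^esub> emb (- n) \<odot>\<^bsub>V\<^esub> modes V (i a) (n - 1) (hom_map (word_class w))"
    unfolding F.translation_modes[OF a w]
    using a w by (simp add: hom_map_add hom_map_scale hom_map_modes_gen[OF mode(1)])
  also have "\<dots> = translation V (modes V (i a) n (hom_map (word_class w)))"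
    unfolding mode.IH by (rule translation_modes[OF i_closed[OF mode(1)] hom_map_closed[OF w], symmetric])
  finally show ?case unfolding hom_map_modes_gen[OF mode(1) w] .
qed

lemma hom_map_translation: "x \<in> carrier F \<Longrightarrow> hom_map (translation F x) = translation V (hom_map x)"
proof (induction rule: free_gva_induct)
  case (word w)
  then show ?case by (rule hom_map_translation_word)
next
  case (add x y)
  then have "translation F (x \<oplus>\<^bsub>F\<^esub> y) = translation F x \<oplus>\<^bsub>F\<^esub> translation F y"
    "translation V (hom_map x \<oplus>\<^bsub>V\<^esub> hom_map y) = translation V (hom_map x) \<oplus>\<^bsub>V\<^esub> translation V (hom_map y)"
    using F.translation_linear translation_linear hom_map_closed unfolding linear_map_def by blast+
  then show ?case using add by (simp add: hom_map_add)
next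
  case (scale c x)
  then have "translation F (c \<odot>\<^bsub>F\<^esub> x) = c \<odot>\<^bsub>F\<^esub> translation F x"
    "translation V (c \<odot>\<^bsub>V\<^esub> hom_map x) = c \<odot>\<^bsub>V\<^esub> translation V (hom_map x)"
    using F.translation_linear translation_linear hom_map_closed unfolding linear_map_def by blast+
  then show ?case using scale by (simp add: hom_map_scale)
qed

text \<open>The modes on the vacuum are produced from the vector by translation and division by
  \<open>k + 1\<close>, which is nonzero because \<open>emb\<close> is injective. So compatibility
  with translation is enough; this starts the induction in Goddard's argument.\<close>

lemma hom_map_modes_vacuum:
  assumes x: "x \<in> carrier F"
  shows "hom_map (modes F x n (vacuum F)) = modes V (hom_map x) n (vacuum V)"
proof (cases "- n - 1 \<in> \<nat>")
  case False
  then show ?thesis using F.modes_vacuum(2)[OF x] modes_vacuum(2)[OF hom_map_closed[OF x]] by (simp add: hom_map_zero)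
next
  case True
  then obtain k where "- n - 1 = of_nat k" by (elim Nats_cases)
  moreover have "n = - (- n - 1) - 1" by simp
  ultimately have n: "n = - of_nat k - 1" by metis
  have "hom_map (modes F x (- of_nat k - 1) (vacuum F)) = modes V (hom_map x) (- of_nat k - 1) (vacuum V)"
  proof (induction k)
    case 0
    then show ?case using F.modes_vacuum(1)[OF x] modes_vacuum(1)[OF hom_map_closed[OF x]] by simp
  next
    case (Suc k)
    let ?c = "emb (of_nat (Suc k))"
    have nz: "?c \<noteq> 0" by (simp only: complex_subfieldD(6)[OF emb_subfield] of_nat_eq_0_iff)
    have "?c \<odot>\<^bsub>V\<^esub> hom_map (modes F x (- of_nat (Suc k) - 1) (vacuum F))
        = hom_map (translation F (modes F x (- of_nat k - 1) (vacuum F)))"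
      unfolding F.modes_vacuum_Suc[OF x, symmetric] using x by (simp only: hom_map_scale F.modes_closed F.vacuum_closed)
    also have "\<dots> = translation V (modes V (hom_map x) (- of_nat k - 1) (vacuum V))"
      using x by (simp only: hom_map_translation F.modes_closed F.vacuum_closed Suc.IH)
    also have "\<dots> = ?c \<odot>\<^bsub>V\<^esub> modes V (hom_map x) (- of_nat (Suc k) - 1) (vacuum V)"
      by (rule modes_vacuum_Suc[OF hom_map_closed[OF x], symmetric])
    finally show ?case
      by (rule smult_cancel[OF nz, rotated 2]) (intro hom_map_closed modes_closed F.modes_closed vacuum_closed F.vacuum_closed x)+
  qed
  then show ?thesis unfolding n .
qed

lemma hom_map_local_sum:
  assumes L: "F.truncated L"
  shows "hom_map (F.local_sum M L s t) = local_sum M (\<lambda>s t. hom_map (L s t)) s t"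
    "truncated (\<lambda>s t. hom_map (L s t))"
proof -
  show tr: "truncated (\<lambda>s t. hom_map (L s t))"
    using L hom_map_closed hom_map_zero unfolding truncated_def F.truncated_def by metis
  obtain J where J: "\<And>j s. J \<le> j \<Longrightarrow> L s (t + of_nat j) = \<zero>\<^bsub>F\<^esub>" using L unfolding F.truncated_def by blast
  have "F.local_sum M L s t
      = (\<Oplus>\<^bsub>F\<^esub>j\<in>{..J}. emb ((-1) ^ j * (M gchoose j)) \<odot>\<^bsub>F\<^esub> L (s + M - of_nat j) (t + of_nat j))"
    by (rule F.local_sum_eq[OF L J])
  then have "hom_map (F.local_sum M L s t)
      = hom_map (\<Oplus>\<^bsub>F\<^esub>j\<in>{..J}. emb ((-1) ^ j * (M gchoose j)) \<odot>\<^bsub>F\<^esub> L (s + M - of_nat j) (t + of_nat j))"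
    by (rule arg_cong)
  also have "\<dots> = (\<Oplus>\<^bsub>V\<^esub>j\<in>{..J}. hom_map (emb ((-1) ^ j * (M gchoose j)) \<odot>\<^bsub>F\<^esub> L (s + M - of_nat j) (t + of_nat j)))"
    by (rule linear_map_finsum[OF F.space space hom_map_linear]) (use L in auto)
  also have "\<dots> = (\<Oplus>\<^bsub>V\<^esub>j\<in>{..J}. emb ((-1) ^ j * (M gchoose j)) \<odot>\<^bsub>V\<^esub> hom_map (L (s + M - of_nat j) (t + of_nat j)))"
    using L by (simp only: hom_map_scale F.truncated_closed)
  also have "\<dots> = local_sum M (\<lambda>s t. hom_map (L s t)) s t"
    by (rule local_sum_eq[OF tr, symmetric]) (simp add: J hom_map_zero)
  finally show "hom_map (F.local_sum M L s t) = local_sum M (\<lambda>s t. hom_map (L s t)) s t" .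
qed

text \<open>
  Goddard's uniqueness argument: the fields \<open>\<pi> Y(x,z)\<close> and \<open>Y(\<pi> x,z) \<pi>\<close> agree on the vacuum and are
  both local to the generating fields, hence they agree on words.
\<close>

lemma hom_map_modes_word:
  assumes \<alpha>: "\<alpha> \<in> carrier QB" and x: "x \<in> GF \<alpha>" and w: "w \<in> lists (B \<times> UNIV)"
  shows "\<forall>n. hom_map (modes F x n (word_class w)) = modes V (hom_map x) n (hom_map (word_class w))"
  using w
proof (induction rule: word_class_induct)
  case vacuum
  show ?case using hom_map_modes_vacuum[OF F.G_closed[OF \<alpha> x]] by (simp add: hom_map_vacuum)
next
  case (mode b m w)
  let ?y = "word_class w"
  note b = frag_of_closed[OF mode(1)] and cw = charge_w_closed[OF mode(2)]
  note xc = F.G_closed[OF \<alpha> x] and y = word_class_closed[OF mode(2)] and yG = word_class_grading[OF mode(2)]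
  have hx: "hom_map x \<in> G (\<rho> \<alpha>)" by (rule hom_map_grading[OF \<alpha> x])
  have hy: "hom_map ?y \<in> G (\<rho> (charge_w w))" by (rule hom_map_grading[OF cw yG])
  let ?l = "\<lambda>s t. modes F x s (modes F (gen b) t ?y)" and ?r = "\<lambda>t s. modes F (gen b) t (modes F x s ?y)"
  let ?L = "\<lambda>s t. modes V (hom_map x) s (modes V (i b) t (hom_map ?y))"
  let ?R = "\<lambda>t s. modes V (i b) t (modes V (hom_map x) s (hom_map ?y))"
  have tl: "F.truncated ?l"
    by (rule F.truncated_modes[OF b cw gen_grading[OF mode(1)] yG]) (simp_all add: xc)
  have tr: "F.truncated ?r"
    by (rule F.truncated_modes[OF \<alpha> cw x yG]) (simp_all add: gen_closed[OF mode(1)])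
  have tL: "truncated ?L"
    by (rule truncated_modes[OF \<rho>_closed[OF b] \<rho>_closed[OF cw] i_G[OF mode(1)] hy])
      (simp_all add: hom_map_closed[OF xc])
  have tR: "truncated ?R"
    by (rule truncated_modes[OF \<rho>_closed[OF \<alpha>] \<rho>_closed[OF cw] hx hy]) (simp_all add: i_closed[OF mode(1)])
  \<comment> \<open>By the induction hypothesis the right-hand sides agree, so both left-hand sides
    are local to one and the same series.\<close>
  have R: "(\<lambda>t s. hom_map (?r t s)) = ?R"
    using mode.IH xc y by (simp add: hom_map_modes_gen[OF mode(1)])
  obtain M where M: "locality_bound emb F (biadd_ext N \<alpha> (frag_of b) +o \<int>) (\<eta> \<alpha> (frag_of b)) M (modes F x) (modes F (gen b))"
    by (rule F.mutually_local[OF \<alpha> b x gen_grading[OF mode(1)]])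
  obtain M' where M': "locality_bound emb V (\<Delta> (\<rho> \<alpha>) (\<rho> (frag_of b))) (\<eta>Q (\<rho> \<alpha>) (\<rho> (frag_of b))) M'
      (modes V (hom_map x)) (modes V (i b))"
    by (rule mutually_local[OF \<rho>_closed[OF \<alpha>] \<rho>_closed[OF b] hx i_G[OF mode(1)]])
  have "local_pair (\<eta> \<alpha> (frag_of b)) M (\<lambda>s t. hom_map (?l s t)) (\<lambda>t s. hom_map (?r t s))"
    unfolding local_pair_def
  proof (intro allI)
    fix s t
    have "F.local_sum M ?l s t = emb (\<eta> \<alpha> (frag_of b) * exp (of_real pi * \<i> * M)) \<odot>\<^bsub>F\<^esub> F.local_sum M ?r t s"
      using F.locality_bound_local_pair[OF M y] unfolding F.local_pair_def by blast
    then show "local_sum M (\<lambda>s t. hom_map (?l s t)) s t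
        = emb (\<eta> \<alpha> (frag_of b) * exp (of_real pi * \<i> * M)) \<odot>\<^bsub>V\<^esub> local_sum M (\<lambda>t s. hom_map (?r t s)) t s"
      unfolding hom_map_local_sum(1)[OF tl, symmetric] hom_map_local_sum(1)[OF tr, symmetric]
      by (simp only: hom_map_scale F.local_sum_closed[OF tr])
  qed
  moreover have "local_pair (\<eta> \<alpha> (frag_of b)) M' ?L ?R"
    using locality_bound_local_pair[OF M' hom_map_closed[OF y]] unfolding \<rho>_\<eta>[OF \<alpha> b] .
  \<comment> \<open>The two bounds come from different algebras and need not be equal, but
    \<open>\<rho>\<close> identifies the cosets in which they lie.\<close>
  moreover have "M - M' \<in> \<int>"
  proof -
    have "M \<in> \<Delta> (\<rho> \<alpha>) (\<rho> (frag_of b))" "M' \<in> \<Delta> (\<rho> \<alpha>) (\<rho> (frag_of b))"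
      using M M' \<rho>_\<Delta>[OF \<alpha> b] by (auto simp: locality_bound_def)
    then show ?thesis using \<Delta>_diff[OF \<rho>_closed[OF \<alpha>] \<rho>_closed[OF b]] by blast
  qed
  ultimately have eq: "(\<lambda>s t. hom_map (?l s t)) = ?L"
    unfolding R by (intro local_pair_unique[OF hom_map_local_sum(2)[OF tl] tL tR])
  show ?case unfolding hom_map_modes_gen[OF mode(1) y] using fun_cong[OF fun_cong[OF eq]] by blast
qed

text \<open>Both sides are linear in \<open>x\<close> and in \<open>y\<close>, so words suffice;
  their classes are homogeneous, as the locality argument requires.\<close>

lemma hom_map_modes:
  assumes "x \<in> carrier F" "y \<in> carrier F"
  shows "hom_map (modes F x n y) = modes V (hom_map x) n (hom_map y)"
  using assms(1)
proof (induction rule: free_gva_induct)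
  case (word u)
  note u = word_class_closed[OF word]
  show ?case using assms(2)
  proof (induction rule: free_gva_induct)
    case (word w)
    then show ?case
      using hom_map_modes_word[OF charge_w_closed[OF \<open>u \<in> _\<close>] word_class_grading[OF \<open>u \<in> _\<close>]] by blast
  next
    case (add x y)
    then have "modes F (word_class u) n (x \<oplus>\<^bsub>F\<^esub> y) = modes F (word_class u) n x \<oplus>\<^bsub>F\<^esub> modes F (word_class u) n y"
      "modes V (hom_map (word_class u)) n (hom_map x \<oplus>\<^bsub>V\<^esub> hom_map y)
        = modes V (hom_map (word_class u)) n (hom_map x) \<oplus>\<^bsub>V\<^esub> modes V (hom_map (word_class u)) n (hom_map y)"
      using F.modes_linear[OF u] modes_linear[OF hom_map_closed[OF u]] hom_map_closed unfolding linear_map_def by blast+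
    then show ?case using add u by (simp add: hom_map_add)
  next
    case (scale c x)
    then have "modes F (word_class u) n (c \<odot>\<^bsub>F\<^esub> x) = c \<odot>\<^bsub>F\<^esub> modes F (word_class u) n x"
      "modes V (hom_map (word_class u)) n (c \<odot>\<^bsub>V\<^esub> hom_map x) = c \<odot>\<^bsub>V\<^esub> modes V (hom_map (word_class u)) n (hom_map x)"
      using F.modes_linear[OF u] modes_linear[OF hom_map_closed[OF u]] hom_map_closed unfolding linear_map_def by blast+
    then show ?case using scale u by (simp add: hom_map_scale)
  qed
next
  case (add x x')
  then have "modes F (x \<oplus>\<^bsub>F\<^esub> x') n y = modes F x n y \<oplus>\<^bsub>F\<^esub> modes F x' n y"
    "modes V (hom_map x \<oplus>\<^bsub>V\<^esub> hom_map x') n (hom_map y) = modes V (hom_map x) n (hom_map y) \<oplus>\<^bsub>V\<^esub> modes V (hom_map x') n (hom_map y)"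
    using F.modes_linear_left[OF assms(2)] modes_linear_left[OF hom_map_closed[OF assms(2)]] hom_map_closed
    unfolding linear_map_def by blast+
  then show ?case using add assms(2) by (simp add: hom_map_add)
next
  case (scale c x)
  then have "modes F (c \<odot>\<^bsub>F\<^esub> x) n y = c \<odot>\<^bsub>F\<^esub> modes F x n y"
    "modes V (c \<odot>\<^bsub>V\<^esub> hom_map x) n (hom_map y) = c \<odot>\<^bsub>V\<^esub> modes V (hom_map x) n (hom_map y)"
    using F.modes_linear_left[OF assms(2)] modes_linear_left[OF hom_map_closed[OF assms(2)]] hom_map_closed
    unfolding linear_map_def by blast+
  then show ?case using scale assms(2) by (simp add: hom_map_scale)
qed

text \<open>The witnesses are the natural charge factor of the free algebra and the given one of
  \<open>V\<close>, with \<open>\<rho>\<close> as the map between the charge groups.\<close>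

lemma hom_map_gva_hom: "gva_hom TYPE('b \<Rightarrow>\<^sub>0 int) TYPE('q) emb F V hom_map"
  unfolding gva_hom_def
proof (intro conjI ballI allI)
  show "linear_map F V hom_map" by (rule hom_map_linear)
  show "hom_map (vacuum F) = vacuum V" by (rule hom_map_vacuum)
  show "hom_map (modes F a n b) = modes V (hom_map a) n (hom_map b)" if "a \<in> carrier F" "b \<in> carrier F" for a b n
    by (rule hom_map_modes[OF that])
  show "hom_map (translation F a) = translation V (hom_map a)" if "a \<in> carrier F" for a
    by (rule hom_map_translation[OF that])
  have "hom_map ` GF \<alpha> \<subseteq> G (\<rho> \<alpha>)" if "\<alpha> \<in> carrier QB" for \<alpha>
    using hom_map_grading[OF that] by blast
  then show "\<exists>(Q1 :: ('b \<Rightarrow>\<^sub>0 int) monoid) \<Delta>1 \<eta>1 G1 (Q2 :: 'q monoid) \<Delta>2 \<eta>2 G2 \<phi>.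
        charge_factor emb F Q1 \<Delta>1 \<eta>1 G1 \<and> charge_factor emb V Q2 \<Delta>2 \<eta>2 G2 \<and>
        \<phi> \<in> hom Q1 Q2 \<and>
        (\<forall>\<alpha>\<in>carrier Q1. hom_map ` G1 \<alpha> \<subseteq> G2 (\<phi> \<alpha>)) \<and>
        (\<forall>\<alpha>\<in>carrier Q1. \<forall>\<beta>\<in>carrier Q1.
           \<Delta>2 (\<phi> \<alpha>) (\<phi> \<beta>) = \<Delta>1 \<alpha> \<beta> \<and> \<eta>2 (\<phi> \<alpha>) (\<phi> \<beta>) = \<eta>1 \<alpha> \<beta>)"
    using F.charge_factor charge_factor \<rho>_hom \<rho>_\<Delta>[symmetric] \<rho>_\<eta>[symmetric]
    by (intro exI[of _ QB] exI[of _ "\<lambda>\<alpha> \<beta>. biadd_ext N \<alpha> \<beta> +o \<int>"] exI[of _ \<eta>] exI[of _ GF]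
        exI[of _ Q] exI[of _ \<Delta>] exI[of _ \<eta>Q] exI[of _ G] exI[of _ \<rho>] conjI ballI) blast+
qed

section \<open>Surjectivity and uniqueness\<close>

lemma hom_map_surj:
  assumes "generates_gva V (i ` B)"
  shows "hom_map ` carrier F = carrier V"
proof
  show sub: "hom_map ` carrier F \<subseteq> carrier V" using hom_map_closed by blast
  have "submodule (hom_map ` carrier F) (ring_of_type_algebra :: 'k ring) V"
  proof (rule V.submoduleI[OF sub])
    show "\<zero>\<^bsub>V\<^esub> \<in> hom_map ` carrier F"
      unfolding hom_map_zero[symmetric] by (intro imageI F.V.zero_closed)
    fix a b c assume "a \<in> hom_map ` carrier F"
    then obtain x where x: "x \<in> carrier F" "a = hom_map x" by blast
    show "\<ominus>\<^bsub>V\<^esub> a \<in> hom_map ` carrier F"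
      unfolding x(2) linear_map_uminus[OF F.space space hom_map_linear x(1), symmetric]
      by (intro imageI F.V.a_inv_closed x)
    show "c \<odot>\<^bsub>V\<^esub> a \<in> hom_map ` carrier F"
      unfolding x(2) hom_map_scale[OF x(1), symmetric] by (intro imageI F.smult_closed x)
    assume "b \<in> hom_map ` carrier F"
    then obtain y where y: "y \<in> carrier F" "b = hom_map y" by blast
    show "a \<oplus>\<^bsub>V\<^esub> b \<in> hom_map ` carrier F"
      unfolding x(2) y(2) hom_map_add[OF x(1) y(1), symmetric] by (intro imageI F.V.a_closed x y)
  qed
  moreover have "translation V ` hom_map ` carrier F \<subseteq> hom_map ` carrier F"
  proof (intro image_subsetI)
    fix a assume "a \<in> hom_map ` carrier F"
    then obtain x where x: "x \<in> carrier F" "a = hom_map x" by blast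
    show "translation V a \<in> hom_map ` carrier F"
      unfolding x(2) hom_map_translation[OF x(1), symmetric] by (intro imageI F.translation_closed x)
  qed
  moreover have "vacuum V \<in> hom_map ` carrier F"
    unfolding hom_map_vacuum[symmetric] by (intro imageI F.vacuum_closed)
  moreover have "modes V u n v \<in> hom_map ` carrier F" if uv: "u \<in> hom_map ` carrier F" "v \<in> hom_map ` carrier F" for u v n
  proof -
    obtain x y where xy: "x \<in> carrier F" "u = hom_map x" "y \<in> carrier F" "v = hom_map y" using uv by blast
    show ?thesis
      unfolding xy(2,4) hom_map_modes[OF xy(1,3), symmetric] by (intro imageI F.modes_closed xy)
  qed
  ultimately have "gva_subspace V (hom_map ` carrier F)" by (simp add: gva_subspace_def)
  moreover have "i ` B \<subseteq> hom_map ` carrier F"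
  proof (intro image_subsetI)
    fix b assume b: "b \<in> B"
    show "i b \<in> hom_map ` carrier F"
      unfolding hom_map_gen[OF b, symmetric] by (intro imageI gen_closed b)
  qed
  ultimately have "gva_subspace V hull (i ` B) \<subseteq> hom_map ` carrier F" by (intro hull_minimal)
  then show "carrier V \<subseteq> hom_map ` carrier F" using assms by (simp add: generates_gva_def)
qed

text \<open>Words are iterated modes of the generators applied to the vacuum, which leaves a
  homomorphism no freedom. The types of the charge groups of \<open>h\<close> are arbitrary, so the
  comparison is not confined to homomorphisms with the charge groups used for
  \<open>hom_map\<close>.\<close>

lemma hom_map_unique:
  assumes h: "gva_hom TYPE('p1) TYPE('p2) emb F V h" and gen: "\<And>b. b \<in> B \<Longrightarrow> h (gen b) = i b" and x: "x \<in> carrier F"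
  shows "h x = hom_map x"
proof -
  have lin: "linear_map F V h" and modes: "\<And>a b n. a \<in> carrier F \<Longrightarrow> b \<in> carrier F \<Longrightarrow> h (modes F a n b) = modes V (h a) n (h b)"
    and vac: "h (vacuum F) = vacuum V"
    using h unfolding gva_hom_def by blast+
  show ?thesis using x
  proof (induction rule: free_gva_induct)
    case (word w)
    then show ?case
    proof (induction rule: word_class_induct)
      case vacuum
      then show ?case by (simp add: vac hom_map_vacuum)
    next
      case (mode a n w)
      then show ?case
        using modes[OF gen_closed word_class_closed] gen hom_map_modes_gen[OF _ word_class_closed] by simp
    qed
  next
    case (add x y)
    then show ?case using lin by (simp add: hom_map_add linear_map_def)
  next
    case (scale c x)
    then show ?case using lin by (simp add: hom_map_scale linear_map_def)
  qed
qed

end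

theorem theorem4p1:
  fixes emb :: "complex \<Rightarrow> 'k::field"
    and B :: "'b set"
    and N :: "'b \<Rightarrow> 'b \<Rightarrow> complex"
    and \<eta> :: "('b \<Rightarrow>\<^sub>0 int) \<Rightarrow> ('b \<Rightarrow>\<^sub>0 int) \<Rightarrow> complex"
    and Y :: "('b word \<Rightarrow> 'k) set \<Rightarrow> complex \<Rightarrow> ('b word \<Rightarrow> 'k) set \<Rightarrow> ('b word \<Rightarrow> 'k) set"
    and V' :: "('k, 'v) gva"
    and Q' :: "'q monoid"
    and \<Delta>' :: "'q \<Rightarrow> 'q \<Rightarrow> complex set"
    and \<eta>' :: "'q \<Rightarrow> 'q \<Rightarrow> complex"
    and G' :: "'q \<Rightarrow> 'v set"
    and \<rho> :: "('b \<Rightarrow>\<^sub>0 int) \<Rightarrow> 'q"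
    and i :: "'b \<Rightarrow> 'v"
  defines "Q\<^sub>B \<equiv> free_Abelian_group B"
    and "F \<equiv> free_gva emb B N \<eta> Y"
  assumes k_contains_C: "complex_subfield emb"
    and N_sym: "\<And>a b. a \<in> B \<Longrightarrow> b \<in> B \<Longrightarrow> N a b = N b a"
    and \<eta>_bimult: "bimultiplicative Q\<^sub>B \<eta>"
    and \<eta>_diag: "\<And>\<alpha>. \<alpha> \<in> carrier Q\<^sub>B \<Longrightarrow> \<eta> \<alpha> \<alpha> = exp (- of_real pi * \<i> * biadd_ext N \<alpha> \<alpha>)"
    and F_structure: "free_gva_structure emb B N \<eta> Y"
    and V'_gva: "gva_with_charge_factor emb V' Q' \<Delta>' \<eta>' G'"
    and \<rho>_hom: "\<rho> \<in> hom Q\<^sub>B Q'"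
    and \<rho>_\<Delta>: "\<And>\<alpha> \<beta>. \<alpha> \<in> carrier Q\<^sub>B \<Longrightarrow> \<beta> \<in> carrier Q\<^sub>B \<Longrightarrow> biadd_ext N \<alpha> \<beta> +o \<int> = \<Delta>' (\<rho> \<alpha>) (\<rho> \<beta>)"
    and \<rho>_\<eta>: "\<And>\<alpha> \<beta>. \<alpha> \<in> carrier Q\<^sub>B \<Longrightarrow> \<beta> \<in> carrier Q\<^sub>B \<Longrightarrow> \<eta> \<alpha> \<beta> = \<eta>' (\<rho> \<alpha>) (\<rho> \<beta>)"
    and i_homog: "\<And>b. b \<in> B \<Longrightarrow> i b = \<zero>\<^bsub>V'\<^esub> \<or> i b \<in> G' (\<rho> (frag_of b))"
    and i_gen: "generates_gva V' (i ` B)"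
    and N'_well_defined: "\<And>b c b' c'. b \<in> B \<Longrightarrow> c \<in> B \<Longrightarrow> b' \<in> B \<Longrightarrow> c' \<in> B \<Longrightarrow>
          i b = i b' \<Longrightarrow> i c = i c' \<Longrightarrow> N b c = N b' c'"
    and N'_bound: "\<And>b c. b \<in> B \<Longrightarrow> c \<in> B \<Longrightarrow>
          locality_bound emb V' (\<Delta>' (\<rho> (frag_of b)) (\<rho> (frag_of c)))
            (\<eta>' (\<rho> (frag_of b)) (\<rho> (frag_of c))) (N b c) (modes V' (i b)) (modes V' (i c))"
  shows "\<exists>\<pi>.
    (gva_hom TYPE('b \<Rightarrow>\<^sub>0 int) TYPE('q) emb F V' \<pi> \<and> \<pi> ` carrier F = carrier V' \<and>
       (\<forall>b\<in>B. \<pi> (free_gen emb B N \<eta> b) = i b)) \<and>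
    (\<forall>\<pi>'. gva_hom TYPE('p1) TYPE('p2) emb F V' \<pi>' \<and> \<pi>' ` carrier F = carrier V' \<and>
       (\<forall>b\<in>B. \<pi>' (free_gen emb B N \<eta> b) = i b)
       \<longrightarrow> (\<forall>x\<in>carrier F. \<pi>' x = \<pi> x))"
proof -
  have V: "charged_gva emb V' Q' \<Delta>' \<eta>' G'"
    using k_contains_C V'_gva by (rule charged_gva.intro)
  interpret V: charged_gva emb V' Q' \<Delta>' \<eta>' G' by (rule V)
  \<comment> \<open>The zero vector lies in every graded component, so the two alternatives for
    \<open>i b\<close> merge into one.\<close>
  have i_G: "i b \<in> G' (\<rho> (frag_of b))" if "b \<in> B" for b
  proof -
    have "\<rho> (frag_of b) \<in> carrier Q'" using \<rho>_hom that unfolding hom_def Q\<^sub>B_def by auto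
    then show ?thesis using i_homog[OF that] V.submoduleD(2)[OF V.submodule_G] by auto
  qed
  interpret M: free_gva_map emb V' Q' \<Delta>' \<eta>' G' B N \<eta> \<rho> i Y
    using N_sym \<rho>_hom \<rho>_\<Delta> \<rho>_\<eta> i_G N'_bound F_structure unfolding Q\<^sub>B_def by unfold_locales
  show ?thesis
    unfolding F_def
  proof (intro exI[of _ M.hom_map] conjI allI impI ballI)
    show "gva_hom TYPE('b \<Rightarrow>\<^sub>0 int) TYPE('q) emb (free_gva emb B N \<eta> Y) V' M.hom_map"
      by (rule M.hom_map_gva_hom)
    show "M.hom_map ` carrier (free_gva emb B N \<eta> Y) = carrier V'" by (rule M.hom_map_surj[OF i_gen])
    show "M.hom_map (free_gen emb B N \<eta> b) = i b" if "b \<in> B" for b by (rule M.hom_map_gen[OF that])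
    show "\<pi>' x = M.hom_map x"
      if "gva_hom TYPE('p1) TYPE('p2) emb (free_gva emb B N \<eta> Y) V' \<pi>' \<and>
          \<pi>' ` carrier (free_gva emb B N \<eta> Y) = carrier V' \<and> (\<forall>b\<in>B. \<pi>' (free_gen emb B N \<eta> b) = i b)"
        "x \<in> carrier (free_gva emb B N \<eta> Y)" for \<pi>' x
      by (rule M.hom_map_unique) (use that in blast)+
  qed
qed

end
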